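(* Let $F$ be a non-Archimedean local field with residue field of order $q$, let $n\ge 2$, and let $M:\mathcal C_+\to\mathcal C_-$ be the Radon transform $Mf(\xi)=\int_{\xi\cdot x=1}f(x)\,d\mu_\xi$. Then $M$ is an isomorphism. The inverse of $M$ is $A_\beta:\mathcal C_-\to\mathcal C_+$, where $\beta$ is the compactly supported distribution on $F$ equal to $$\beta=\frac{1-q^{n-1}}{1-q^{-n}}\left(|s-1|^{-n}-|s|^{-n}\right).$$
   Context: Notation. $F$ is a non-Archimedean local field, $\mathcal O$ its ring of integers, $q$ the order of the residue field, $|\cdot|$ the normalized absolute value; $n\ge2$; $K=GL_n(\mathcal O)$. $E$ is a fixed field of characteristic $0$; all functions and distributions are $E$-valued. The Haar measure on $F$ gives $\mathcal O$ measure $1$, $F^n$ has the product measure, and $d^\times t=dt/|t|$ on $F^\times$. For $x\in F^n$, $\|x\|$ is the maximum of the absolute values of the coordinates, and $v(x)=-\log_q\|x\|$ for $x\neq0$. Put $\xi\cdot x=\xi_1x_1+\dots+\xi_nx_n$. Function spaces. $\mathcal C$ is the space of $K$-finite locally constant functions on $F^n\setminus\{0\}$, where $g\in GL_n(F)$ acts by $(g\cdot f)(x)=f(g^{-1}x)$. $\mathcal C_+\subset\mathcal C$ is the subspace of functions with bounded support in $F^n$ (there is $R$ with $f(x)\ne0\Rightarrow v(x)\ge R$); $\mathcal C_-\subset\mathcal C$ is the subspace of functions vanishing in a neighborhood of $0$ (there is $R$ with $f(x)\neq0\Rightarrow v(x)\le R$). Radon transform. For $f\in\mathcal C_+$ and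 $\xi\in F^n\setminus\{0\}$, $Mf(\xi)=\int_{\xi\cdot x=1}f(x)\,d\mu_\xi$, where $d\mu_\xi$ is the measure on the hyperplane $\{\xi\cdot x=t\}$ such that $d\mu_\xi\,dt=dx$. This gives an operator $M:\mathcal C_+\to\mathcal C_-$. Distributions. $\mathcal S(F)$ is the space of locally constant compactly supported functions on $F$; a distribution on $F$ is a linear functional on $\mathcal S(F)$, written $\langle\beta,f\rangle=\int_F\beta(s)f(s)\,ds$. $\mathcal S'_b(F)$ is the space of distributions $\beta$ on $F$ such that for every open subgroup $U\subset\mathcal O^\times$ the multiplicative average $\beta_U(t)=\frac1{\mathrm{mes}(U)}\int_U\beta(ut)\,d^\times u$ has compact support and $\langle\beta_U,1\rangle=0$. The operator $A_\beta$. For $\beta\in\mathcal S'_b(F)$, $\varphi\in\mathcal C_-$ (extended by $0$ to $0\in F^n$), $x\in F^n\setminus\{0\}$ and an open compact subgroup $\Lambda\subset F^n$, put $I(\Lambda)=\int_\Lambda\beta(\xi\cdot x)\varphi(\xi)\,d\xi$, i.e. $\beta$ is applied to the function $s\mapsto\int_{\{\xi\in\Lambda:\ \xi\cdot x=s\}}\varphi(\xi)\,d\mu_x$ in $\mathcal S(F)$. There is a $\Lambda$ with $I(\Lambda')=I(\Lambda)$ for all open compact subgroups $\Lambda'\supset\Lambda$; for such $\Lambda$, $(A_\beta\varphi)(x):=I(\Lambda)$. This defines $A_\beta:\mathcal C_-\to\mathcal C_+$. The distribution $|s|^{-n}$ is defined by $\langle|s|^{-n},f\rangle=\int_F|s|^{-n}(f(s)-f(0))\,ds$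 for $f\in\mathcal S(F)$, and $|s-1|^{-n}$ is its translate: $\langle|s-1|^{-n},f\rangle=\int_F|s|^{-n}(f(s+1)-f(1))\,ds$. *)

theory Defs
  imports "HOL-Analysis.Analysis" "HOL-Library.Function_Algebras"
begin

section \<open>Non-Archimedean local fields\<close>

class absval = minus +
  fixes absval :: "'a \<Rightarrow> real"
begin

definition ring_of_integers :: "'a set"
  where "ring_of_integers = {x. absval x \<le> 1}"

definition residue_field :: "'a set set"
  where "residue_field = ring_of_integers //
     {(x, y). x \<in> ring_of_integers \<and> y \<in> ring_of_integers \<and> absval (x - y) < 1}"

end

text \<open>
  The absolute value is normalized: its value group is exactly the set of integral
  powers of the order of the residue field. Since the order of the (finite)
  residue field is at least 2, the valuation is discrete and nontrivial. The
  metric, and with it the topology, is the one of the absolute value.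
\<close>

class nonarch_local_field = field + absval + complete_space +
  assumes dist_absval: "dist x y = absval (x - y)"
    and absval_mult: "absval (x * y) = absval x * absval y"
    and absval_ultrametric: "absval (x + y) \<le> max (absval x) (absval y)"
    and finite_residue_field: "finite residue_field"
    and value_group: "absval ` (- {0}) = range (\<lambda>k::int. real (card residue_field) powi k)"

definition residue_order :: "'f::nonarch_local_field itself \<Rightarrow> nat"
  where "residue_order _ = card (residue_field :: 'f set set)"

definition vec_norm :: "('f::nonarch_local_field)^'n::finite \<Rightarrow> real"
  where "vec_norm x = Max (range (\<lambda>i. absval (x $ i)))"

definition vec_val :: "('f::nonarch_local_field)^'n::finite \<Rightarrow> real"
  where "vec_val x = - log (real (residue_order TYPE('f))) (vec_norm x)"

definition GL_integers :: "(('f::nonarch_local_field)^'n::finite^'n) set"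
  where "GL_integers = {A. (\<forall>i j. A $ i $ j \<in> ring_of_integers) \<and>
     (\<exists>B. (\<forall>i j. B $ i $ j \<in> ring_of_integers) \<and> A ** B = mat 1 \<and> B ** A = mat 1)}"

section \<open>Locally constant functions\<close>

definition locally_constant_on :: "'a::topological_space set \<Rightarrow> ('a \<Rightarrow> 'e) \<Rightarrow> bool"
  where "locally_constant_on S f \<longleftrightarrow>
     (\<forall>x\<in>S. \<exists>U. openin (top_of_set S) U \<and> x \<in> U \<and> f constant_on U)"

definition test_functions :: "('a::topological_space \<Rightarrow> 'e::zero) set"
  where "test_functions = {f. locally_constant_on UNIV f \<and> compact (closure {x. f x \<noteq> 0})}"

definition fun_scale :: "'e::times \<Rightarrow> ('a \<Rightarrow> 'e) \<Rightarrow> 'a \<Rightarrow> 'e"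
  where "fun_scale c f = (\<lambda>x. c * f x)"

definition K_finite :: "(('f::nonarch_local_field)^'n::finite \<Rightarrow> 'e::field_char_0) \<Rightarrow> bool"
  where "K_finite f \<longleftrightarrow>
     (\<exists>B. finite B \<and> module.span fun_scale ((\<lambda>g x. f (matrix_inv g *v x)) ` GL_integers)
            = module.span fun_scale B)"

text \<open>
  A function on the punctured space is represented by its extension by 0 to the origin;
  it is required to be locally constant only away from the origin.
\<close>

definition C_space :: "(('f::nonarch_local_field)^'n::finite \<Rightarrow> 'e::field_char_0) set"
  where "C_space = {f. f 0 = 0 \<and> locally_constant_on (- {0}) f \<and> K_finite f}"

definition C_plus :: "(('f::nonarch_local_field)^'n::finite \<Rightarrow> 'e::field_char_0) set"
  where "C_plus = {f \<in> C_space. \<exists>R. \<forall>x. f x \<noteq> 0 \<longrightarrow> vec_val x \<ge> R}"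

definition C_minus :: "(('f::nonarch_local_field)^'n::finite \<Rightarrow> 'e::field_char_0) set"
  where "C_minus = {f \<in> C_space. \<exists>R. \<forall>x. f x \<noteq> 0 \<longrightarrow> vec_val x \<le> R}"

section \<open>Measures and integration\<close>

text \<open>
  All integrands are valued in an arbitrary field of characteristic 0, so measures are
  used as finitely additive rational-valued functions of compact open sets (on these
  sets, the Haar measures in question take rational values, and finite additivity
  is the same as countable additivity). The values on other sets are irrelevant.
\<close>

definition content_on :: "'a set set \<Rightarrow> ('a set \<Rightarrow> rat) \<Rightarrow> bool"
  where "content_on M \<mu> \<longleftrightarrow> (\<forall>A\<in>M. 0 \<le> \<mu> A) \<and>
     (\<forall>A\<in>M. \<forall>B\<in>M. A \<inter> B = {} \<longrightarrow> \<mu> (A \<union> B) = \<mu> A + \<mu> B)"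

definition compact_opens :: "'a::topological_space set \<Rightarrow> 'a set set"
  where "compact_opens S = {A. compact A \<and> openin (top_of_set S) A}"

definition haar :: "('f::nonarch_local_field) set \<Rightarrow> rat"
  where "haar = (SOME \<mu>. content_on (compact_opens UNIV) \<mu> \<and>
     (\<forall>a. \<forall>A\<in>compact_opens UNIV. \<mu> ((+) a ` A) = \<mu> A) \<and> \<mu> ring_of_integers = 1)"

definition haar_vec :: "(('f::nonarch_local_field)^'n::finite) set \<Rightarrow> rat"
  where "haar_vec = (SOME \<mu>. content_on (compact_opens UNIV) \<mu> \<and>
     (\<forall>A. (\<forall>i. A i \<in> compact_opens UNIV) \<longrightarrow>
        \<mu> {x. \<forall>i. x $ i \<in> A i} = (\<Prod>i\<in>UNIV. haar (A i))))"

text \<open>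
  The integral of a locally constant compactly supported function, which takes
  only finitely many values.
\<close>

definition integ :: "('a set \<Rightarrow> rat) \<Rightarrow> ('a \<Rightarrow> 'e::field_char_0) \<Rightarrow> 'e"
  where "integ \<mu> f = (\<Sum>c\<in>range f - {0}. c * of_rat (\<mu> {x. f x = c}))"

definition hyperplane :: "('f::nonarch_local_field)^'n::finite \<Rightarrow> 'f \<Rightarrow> ('f^'n) set"
  where "hyperplane \<xi> t = {x. scalar_product \<xi> x = t}"

text \<open>
  For nonzero \<open>\<xi>\<close>, a single set function gives the measures on all the hyperplanes
  \<open>\<xi> \<cdot> x = t\<close> simultaneously. Its translation invariance says that each of them is a
  Haar measure, depending on \<open>t\<close> by translation; the last clause is \<open>d\<mu>\<^sub>\<xi> dt = dx\<close>.
  The two together determine the measure.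
\<close>

definition hyperplane_measure :: "('f::nonarch_local_field)^'n::finite \<Rightarrow> ('f^'n) set \<Rightarrow> rat"
  where "hyperplane_measure \<xi> = (SOME \<mu>.
     (\<forall>t. content_on (compact_opens (hyperplane \<xi> t)) \<mu>) \<and>
     (\<forall>t. \<forall>A\<in>compact_opens (hyperplane \<xi> t). \<forall>a. \<mu> ((+) a ` A) = \<mu> A) \<and>
     (\<forall>A\<in>compact_opens UNIV. integ haar (\<lambda>t. \<mu> (A \<inter> hyperplane \<xi> t)) = haar_vec A))"

definition hyperplane_integral ::
    "('f::nonarch_local_field)^'n::finite \<Rightarrow> 'f \<Rightarrow> ('f^'n \<Rightarrow> 'e::field_char_0) \<Rightarrow> 'e"
  where "hyperplane_integral \<xi> t f =
     integ (hyperplane_measure \<xi>) (\<lambda>x. if x \<in> hyperplane \<xi> t then f x else 0)"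

definition radon :: "(('f::nonarch_local_field)^'n::finite \<Rightarrow> 'e::field_char_0) \<Rightarrow> 'f^'n \<Rightarrow> 'e"
  where "radon f \<xi> = (if \<xi> = 0 then 0 else hyperplane_integral \<xi> 1 f)"

section \<open>Distributions\<close>

definition linear_map_on :: "('a \<Rightarrow> 'e::field) set \<Rightarrow> (('a \<Rightarrow> 'e) \<Rightarrow> 'v::plus) \<Rightarrow> ('e \<Rightarrow> 'v \<Rightarrow> 'v) \<Rightarrow> bool"
  where "linear_map_on V T smul \<longleftrightarrow>
     (\<forall>f\<in>V. \<forall>g\<in>V. T (f + g) = T f + T g) \<and> (\<forall>c. \<forall>f\<in>V. T (fun_scale c f) = smul c (T f))"

text \<open>A distribution is determined by, and only evaluated at, test functions.\<close>

type_synonym ('f, 'e) functional = "('f \<Rightarrow> 'e) \<Rightarrow> 'e"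

definition distribution :: "('f::nonarch_local_field, 'e::field_char_0) functional \<Rightarrow> bool"
  where "distribution \<beta> \<longleftrightarrow> linear_map_on test_functions \<beta> (*)"

definition supported_in :: "'f set \<Rightarrow> ('f::nonarch_local_field, 'e::field_char_0) functional \<Rightarrow> bool"
  where "supported_in C \<beta> \<longleftrightarrow> (\<forall>f\<in>test_functions. (\<forall>s\<in>C. f s = 0) \<longrightarrow> \<beta> f = 0)"

definition compactly_supported :: "('f::nonarch_local_field, 'e::field_char_0) functional \<Rightarrow> bool"
  where "compactly_supported \<beta> \<longleftrightarrow> (\<exists>C. compact C \<and> supported_in C \<beta>)"

text \<open>
  The pairing of a compactly supported distribution with the constant function 1:
  its value at any test function equal to 1 on an open compact set containing the support.
\<close>

definition pairing_one :: "('f::nonarch_local_field, 'e::field_char_0) functional \<Rightarrow> 'e"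
  where "pairing_one \<beta> = (THE v. \<forall>C. compact C \<and> open C \<and> supported_in C \<beta> \<longrightarrow>
     (\<forall>f\<in>test_functions. (\<forall>s\<in>C. f s = 1) \<longrightarrow> \<beta> f = v))"

definition open_unit_subgroup :: "('f::nonarch_local_field) set \<Rightarrow> bool"
  where "open_unit_subgroup U \<longleftrightarrow> open U \<and> U \<subseteq> {u. absval u = 1} \<and> 1 \<in> U \<and>
     (\<forall>u\<in>U. \<forall>w\<in>U. u * w \<in> U) \<and> (\<forall>u\<in>U. inverse u \<in> U)"

text \<open>
  On the units, \<open>d\<^sup>\<times>u = du\<close>; and for a unit \<open>u\<close> the distribution \<open>\<beta>(ut)\<close> sends
  \<open>f\<close> to \<open>\<integral> \<beta>(t) f(t/u) dt\<close>, by the change of variables \<open>t \<mapsto> t/u\<close>.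
\<close>

definition mult_average ::
    "'f set \<Rightarrow> ('f::nonarch_local_field, 'e::field_char_0) functional \<Rightarrow> ('f, 'e) functional"
  where "mult_average U \<beta> f =
     1 / of_rat (haar U) * integ haar (\<lambda>u. if u \<in> U then \<beta> (\<lambda>t. f (t / u)) else 0)"

definition S_b :: "('f::nonarch_local_field, 'e::field_char_0) functional set"
  where "S_b = {\<beta>. distribution \<beta> \<and>
     (\<forall>U. open_unit_subgroup U \<longrightarrow>
        compactly_supported (mult_average U \<beta>) \<and> pairing_one (mult_average U \<beta>) = 0)}"

section \<open>The operator given by a distribution\<close>

definition open_compact_subgroup :: "(('f::nonarch_local_field)^'n::finite) set \<Rightarrow> bool"
  where "open_compact_subgroup L \<longleftrightarrow> open L \<and> compact L \<and> 0 \<in> L \<and>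
     (\<forall>x\<in>L. \<forall>y\<in>L. x + y \<in> L) \<and> (\<forall>x\<in>L. - x \<in> L)"

definition A_partial :: "('f::nonarch_local_field, 'e::field_char_0) functional \<Rightarrow>
    ('f^'n::finite \<Rightarrow> 'e) \<Rightarrow> 'f^'n \<Rightarrow> ('f^'n) set \<Rightarrow> 'e"
  where "A_partial \<beta> \<phi> x L =
     \<beta> (\<lambda>s. hyperplane_integral x s (\<lambda>\<xi>. if \<xi> \<in> L then \<phi> \<xi> else 0))"

definition A_op :: "('f::nonarch_local_field, 'e::field_char_0) functional \<Rightarrow>
    ('f^'n::finite \<Rightarrow> 'e) \<Rightarrow> 'f^'n \<Rightarrow> 'e"
  where "A_op \<beta> \<phi> x = (if x = 0 then 0 else
     (THE v. \<exists>L. open_compact_subgroup L \<and>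
        (\<forall>L'. open_compact_subgroup L' \<and> L \<subseteq> L' \<longrightarrow> A_partial \<beta> \<phi> x L' = v)))"

section \<open>The distribution given by a negative power of the absolute value\<close>

text \<open>
  The integral of \<open>|s|\<^sup>-\<^sup>n\<close> over a set \<open>A\<close> meeting every sphere \<open>|s| = q\<^sup>k\<close> in an open compact
  set, computed by countable additivity over these spheres. It is a convergent
  series of real numbers; for the sets below its sum is rational.
\<close>

definition norm_power_measure :: "nat \<Rightarrow> ('f::nonarch_local_field) set \<Rightarrow> rat"
  where "norm_power_measure n A = (THE r.
     ((\<lambda>k::int. real (residue_order TYPE('f)) powi (- (int n * k)) *
         of_rat (haar (A \<inter> {s. absval s = real (residue_order TYPE('f)) powi k})))
       has_sum of_rat r) UNIV)"

text \<open>
  \<open>\<integral> |s|\<^sup>-\<^sup>n (f(s) - f(0)) ds\<close>. The function \<open>f(s) - f(0)\<close> takes finitely many values and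
  vanishes near 0, but it equals \<open>- f(0)\<close> near infinity, where the integral is a convergent
  (for \<open>n \<ge> 2\<close>) infinite sum.
\<close>

definition norm_neg_power :: "nat \<Rightarrow> ('f::nonarch_local_field, 'e::field_char_0) functional"
  where "norm_neg_power n f = integ (norm_power_measure n) (\<lambda>s. f s - f 0)"

definition translate_by_one ::
    "('f::nonarch_local_field, 'e::field_char_0) functional \<Rightarrow> ('f, 'e) functional"
  where "translate_by_one \<beta> f = \<beta> (\<lambda>s. f (s + 1))"

end

theory Submission
  imports Defs
begin

text \<open>
  Call two nonzero vectors \<open>x, y\<close> equivalent if \<open>\<bar>y - x\<bar> \<le> q\<^sup>-\<^sup>m \<bar>x\<bar>\<close>. A locally constant function is
  \<open>K\<close>-finite iff it is constant on these classes for some \<open>m\<close>: finitely many points separate the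
  finite-dimensional span of its orbit, so its stabilizer is open. On such functions \<open>M\<close> and \<open>A\<^sub>\<beta>\<close> are
  locally finite matrices indexed by the classes. For a distribution \<open>\<gamma>\<close> (\<open>\<delta>\<^sub>1\<close> for \<open>M\<close>, and \<open>\<beta>\<close> for \<open>A\<^sub>\<beta>\<close>)
  the kernel at \<open>(\<xi>, x)\<close> is the mean of \<open>\<gamma>\<close> over the ball about \<open>\<xi> \<cdot> x\<close> of radius \<open>q\<^sup>-\<^sup>m \<bar>\<xi>\<bar> \<bar>x\<bar>\<close>. Both
  kernels are symmetric, so \<open>M A\<^sub>\<beta>\<close> and \<open>A\<^sub>\<beta> M\<close> have the same kernel, the integral of the \<open>\<beta>\<close>-kernel at \<open>(\<xi>, x)\<close>
  over \<open>\<eta> \<cdot> x = 1\<close>. It is computed shell by shell in \<open>\<bar>x\<bar>\<close>: if \<open>\<xi>\<close> is far from the line of \<open>\<eta>\<close>, the sum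
  telescopes to a mean of \<open>\<beta>\<close> over a large ball, which is 0; if \<open>\<xi>\<close> is close to \<open>\<lambda>\<eta>\<close>, it is a
  geometric sum that vanishes unless \<open>\<lambda>\<close> is close to 1.
\<close>

subsection \<open>Ultrametric balls and contents\<close>

text \<open>The values lie in an arbitrary field of characteristic 0, so no limit can be taken
  there: every integral and every application of a distribution must become a finite sum over balls.
  The measures are given only by characterizing properties; their existence and their values on
  balls come from counting, since a ball splits into q^d balls of the next smaller radius (d = 1, n,
  n - 1 for the field, the space, a hyperplane). The one infinite sum is the mass of |s|^-n outside
  a ball, a rational geometric series. Functions of the two spaces may be singular at 0 or have
  unbounded support. The matrices are still locally finite: \<eta> \<cdot> x = 1 forces |x| \<ge>
  1/|\<eta>|, and the means of \<beta> over balls of radius at least 1 vanish, because such a ball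
  about 0 contains 1 and |u - 1| = |u| outside it. The constant in \<beta> comes from the geometric
  sum: if t is the mass of |s|^-n on |s| > 1, the shells leave the factor t + q^-n = (1 - q^-n) /
  (q^(n-1) - 1), and the constant is minus its inverse.\<close>

lemma integ_partition:
  fixes f :: "'a \<Rightarrow> 'e::field_char_0"
  assumes fin: "finite I" and disj: "disjoint_family_on A I"
    and val: "\<And>i x. i \<in> I \<Longrightarrow> x \<in> A i \<Longrightarrow> f x = c i"
    and off: "\<And>x. x \<notin> (\<Union>i\<in>I. A i) \<Longrightarrow> f x = 0"
    and add: "\<And>J. J \<subseteq> I \<Longrightarrow> \<mu> (\<Union>i\<in>J. A i) = (\<Sum>i\<in>J. \<mu> (A i))"
  shows "integ \<mu> f = (\<Sum>i\<in>I. c i * of_rat (\<mu> (A i)))"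
proof -
  \<comment> \<open>Empty pieces and zero coefficients are discarded so that the nonzero values of
    \<open>f\<close> are exactly the image of \<open>c\<close>.\<close>
  define I' where "I' = {i\<in>I. A i \<noteq> {} \<and> c i \<noteq> 0}"
  have fin': "finite I'" and sub: "I' \<subseteq> I" using fin by (auto simp: I'_def)
  have ran: "range f - {0} = c ` I'"
  proof (intro equalityI subsetI)
    fix y assume "y \<in> range f - {0}"
    then obtain x where x: "y = f x" "f x \<noteq> 0" by auto
    with off obtain i where "i \<in> I" "x \<in> A i" by blast
    with val x show "y \<in> c ` I'" unfolding I'_def by force
  next
    fix y assume "y \<in> c ` I'"
    then obtain i where i: "i \<in> I" "A i \<noteq> {}" "c i \<noteq> 0" "y = c i" unfolding I'_def by auto
    then obtain x where "x \<in> A i" by auto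
    with i val show "y \<in> range f - {0}" by (metis DiffI rangeI singletonD)
  qed
  have lev: "{x. f x = y} = (\<Union>i\<in>{i\<in>I'. c i = y}. A i)" if "y \<noteq> 0" for y
  proof (intro equalityI subsetI)
    fix x assume "x \<in> {x. f x = y}"
    with off that obtain i where "i \<in> I" "x \<in> A i" by fastforce
    with val that \<open>x \<in> {x. f x = y}\<close> show "x \<in> (\<Union>i\<in>{i\<in>I'. c i = y}. A i)"
      unfolding I'_def by auto
  qed (use val I'_def in auto)
  have empty: "\<mu> {} = 0" using add[of "{}"] by simp
  \<comment> \<open>\<open>integ\<close> runs over values, not over pieces: pieces sharing a value
    are merged, which is why additivity is assumed for every subfamily \<open>J\<close>.\<close>
  have "integ \<mu> f = (\<Sum>y\<in>c ` I'. y * of_rat (\<mu> (\<Union>i\<in>{i\<in>I'. c i = y}. A i)))"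
    unfolding integ_def ran using lev by (intro sum.cong) (auto simp: I'_def)
  also have "\<dots> = (\<Sum>y\<in>c ` I'. \<Sum>i\<in>{i\<in>I'. c i = y}. c i * of_rat (\<mu> (A i)))"
  proof (intro sum.cong refl)
    fix y
    have "\<mu> (\<Union>i\<in>{i\<in>I'. c i = y}. A i) = (\<Sum>i\<in>{i\<in>I'. c i = y}. \<mu> (A i))"
      by (rule add) (use sub in auto)
    then show "y * of_rat (\<mu> (\<Union>i\<in>{i\<in>I'. c i = y}. A i)) = (\<Sum>i\<in>{i\<in>I'. c i = y}. c i * of_rat (\<mu> (A i)))"
      by (simp add: of_rat_sum sum_distrib_left)
  qed
  also have "\<dots> = (\<Sum>i\<in>I'. c i * of_rat (\<mu> (A i)))"
    by (rule sum.image_gen[OF fin', symmetric])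
  also have "\<dots> = (\<Sum>i\<in>I. c i * of_rat (\<mu> (A i)))"
    by (rule sum.mono_neutral_left) (use fin I'_def empty in auto)
  finally show ?thesis .
qed

lemma integ_zero: "integ \<mu> (\<lambda>x. 0) = 0"
  unfolding integ_def by (auto intro: sum.neutral)

text \<open>A content only sees members of \<open>M\<close>, and \<open>M\<close> is an arbitrary
  family of sets, so each partial union met in the induction must be known to lie in
  \<open>M\<close>. The empty union supplies \<open>\<mu> {} = 0\<close>.\<close>

lemma content_on_Union:
  assumes "content_on M \<mu>" "finite J" "disjoint_family_on A J"
    and M: "\<And>J'. J' \<subseteq> J \<Longrightarrow> (\<Union>i\<in>J'. A i) \<in> M"
  shows "\<mu> (\<Union>i\<in>J. A i) = (\<Sum>i\<in>J. \<mu> (A i))"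
  using assms(2,3) M
proof (induction J rule: finite_induct)
  case empty
  have "{} \<in> M" using empty(2)[of "{}"] by simp
  then have "\<mu> ({} \<union> {}) = \<mu> {} + \<mu> {}" using assms(1) unfolding content_on_def by blast
  then show ?case by simp
next
  case (insert x F)
  have "A x \<in> M" using insert.prems(2)[of "{x}"] by simp
  moreover have "(\<Union>i\<in>F. A i) \<in> M" by (rule insert.prems(2)) auto
  moreover have "A x \<inter> (\<Union>i\<in>F. A i) = {}"
    using insert.prems(1) insert.hyps unfolding disjoint_family_on_def by auto
  ultimately have "\<mu> (A x \<union> (\<Union>i\<in>F. A i)) = \<mu> (A x) + \<mu> (\<Union>i\<in>F. A i)"
    using assms(1) unfolding content_on_def by blast
  moreover have "\<mu> (\<Union>i\<in>F. A i) = (\<Sum>i\<in>F. \<mu> (A i))"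
    using insert.prems by (intro insert.IH) (auto simp: disjoint_family_on_def)
  ultimately show ?case using insert.hyps by simp
qed

text \<open>One theory for the field and for its vector space, interpreted below as \<open>F\<close>
  and \<open>V\<close>. Norms are integral powers of \<open>q\<close>, so radii can be indexed by
  integers; the last two assumptions tie the norm to the topology and provide local
  compactness.\<close>

locale ultranorm =
  fixes nrm :: "'a::{ab_group_add,t2_space} \<Rightarrow> real" and q :: nat
  assumes q_gt_1: "q > 1"
    and nrm_eq_0 [simp]: "nrm x = 0 \<longleftrightarrow> x = 0"
    and nrm_minus [simp]: "nrm (- x) = nrm x"
    and nrm_add: "nrm (x + y) \<le> max (nrm x) (nrm y)"
    and nrm_value: "x \<noteq> 0 \<Longrightarrow> \<exists>k::int. nrm x = real q powi k"
    and open_iff: "open U \<longleftrightarrow> (\<forall>x\<in>U. \<exists>k::int. \<forall>y. nrm (y - x) \<le> real q powi k \<longrightarrow> y \<in> U)"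
    and compact_nrm_ball: "compact {y. nrm (y - x) \<le> real q powi k}"
begin

definition bl :: "int \<Rightarrow> 'a \<Rightarrow> 'a set"
  where "bl k x = {y. nrm (y - x) \<le> real q powi k}"

text \<open>Minus the valuation. It is unspecified at 0, which explains the recurring alternative
  \<open>x = 0\<close>.\<close>

definition lev :: "'a \<Rightarrow> int"
  where "lev x = (THE k. nrm x = real q powi k)"

lemma powi_le_iff [simp]: "real q powi j \<le> real q powi k \<longleftrightarrow> j \<le> k"
  using q_gt_1 power_int_strict_increasing[of k j "real q"] power_int_increasing[of j k "real q"]
  by (metis less_eq_real_def linorder_not_less of_nat_1 of_nat_less_iff)

lemma powi_less_iff [simp]: "real q powi j < real q powi k \<longleftrightarrow> j < k"
  using powi_le_iff[of k j] by linarith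

lemma powi_eq_iff [simp]: "real q powi j = real q powi k \<longleftrightarrow> j = k"
  by (metis order.eq_iff powi_le_iff)

lemma powi_pos [simp]: "0 < real q powi k"
  using q_gt_1 by simp

lemma nrm_lev: "x \<noteq> 0 \<Longrightarrow> nrm x = real q powi lev x"
  unfolding lev_def using nrm_value[of x] by (metis (mono_tags, lifting) powi_eq_iff theI)

lemma lev_eqI: "nrm x = real q powi k \<Longrightarrow> lev x = k"
  unfolding lev_def by auto

lemma nrm_0 [simp]: "nrm 0 = 0" by simp

lemma nrm_nonneg [simp]: "0 \<le> nrm x"
  using nrm_lev[of x] by (cases "x = 0") (auto simp: less_imp_le)

lemma nrm_diff_commute: "nrm (x - y) = nrm (y - x)"
  by (metis minus_diff_eq nrm_minus)

lemma nrm_diff: "nrm (x - y) \<le> max (nrm x) (nrm y)"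
  using nrm_add[of x "- y"] by simp

lemma nrm_add_le: "nrm x \<le> c \<Longrightarrow> nrm y \<le> c \<Longrightarrow> nrm (x + y) \<le> c"
  using nrm_add[of x y] by auto

lemma nrm_diff_le: "nrm x \<le> c \<Longrightarrow> nrm y \<le> c \<Longrightarrow> nrm (x - y) \<le> c"
  using nrm_diff[of x y] by auto

lemma nrm_add_dominant: "nrm y < nrm x \<Longrightarrow> nrm (x + y) = nrm x"
  using nrm_add[of x y] nrm_diff[of "x + y" y] by auto

lemma nrm_eq_if_close: "nrm (y - x) < nrm x \<Longrightarrow> nrm y = nrm x"
  using nrm_add_dominant[of "y - x" x] by simp

lemma mem_bl_0: "x \<in> bl k 0 \<longleftrightarrow> x = 0 \<or> lev x \<le> k"
  by (cases "x = 0") (auto simp: bl_def nrm_lev less_imp_le)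

lemma mem_bl: "y \<in> bl k x \<longleftrightarrow> y = x \<or> lev (y - x) \<le> k"
  using mem_bl_0[of "y - x" k] by (auto simp: bl_def)

lemma bl_refl [simp]: "x \<in> bl k x"
  by (simp add: mem_bl)

lemma bl_sym: "y \<in> bl k x \<longleftrightarrow> x \<in> bl k y"
  by (simp add: bl_def nrm_diff_commute)

lemma bl_trans: "y \<in> bl k x \<Longrightarrow> z \<in> bl k y \<Longrightarrow> z \<in> bl k x"
  using nrm_add_le[of "z - y" _ "y - x"] by (simp add: bl_def)

lemma bl_eq: "y \<in> bl k x \<Longrightarrow> bl k y = bl k x"
  using bl_trans bl_sym by blast

lemma bl_eq_iff: "bl k y = bl k x \<longleftrightarrow> y \<in> bl k x"
  using bl_eq bl_refl by blast

lemma bl_mono: "j \<le> k \<Longrightarrow> bl j x \<subseteq> bl k x"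
  by (auto simp: mem_bl)

lemma bl_disjoint: "bl k x \<inter> bl k y \<noteq> {} \<Longrightarrow> bl k x = bl k y"
  using bl_eq by (metis disjoint_iff)

lemma bl_translate: "(+) a ` bl k x = bl k (a + x)"
proof (intro equalityI subsetI)
  fix y assume "y \<in> bl k (a + x)"
  then have "y - a \<in> bl k x" by (simp add: bl_def algebra_simps)
  then show "y \<in> (+) a ` bl k x" by (metis add.commute diff_add_cancel image_eqI)
qed (auto simp: bl_def algebra_simps)

lemma open_bl: "open (bl k x)"
  unfolding open_iff
proof
  fix y assume "y \<in> bl k x"
  then have "\<forall>z. nrm (z - y) \<le> real q powi k \<longrightarrow> z \<in> bl k x"
    using bl_trans[of y k x] unfolding bl_def mem_Collect_eq by blast
  then show "\<exists>j. \<forall>z. nrm (z - y) \<le> real q powi j \<longrightarrow> z \<in> bl k x" by blast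
qed

lemma compact_bl: "compact (bl k x)"
  unfolding bl_def by (rule compact_nrm_ball)

lemma closed_bl: "closed (bl k x)"
  by (simp add: compact_bl compact_imp_closed)

lemma bl_0_change_center: "x \<in> bl k c \<Longrightarrow> \<exists>N. bl k c \<subseteq> bl N 0"
proof -
  have "bl k c \<subseteq> bl (max k (lev c)) 0"
  proof
    fix y assume y: "y \<in> bl k c"
    have "y \<in> bl (max k (lev c)) c" using bl_mono[of k "max k (lev c)" c] y by auto
    moreover have "c \<in> bl (max k (lev c)) 0" by (simp add: mem_bl_0)
    ultimately show "y \<in> bl (max k (lev c)) 0" using bl_trans by blast
  qed
  then show ?thesis by blast
qed

lemma finite_bl_image: assumes "A \<subseteq> bl N c" shows "finite (bl k ` A)"
proof -
  have "bl N c \<subseteq> (\<Union>x\<in>bl N c. bl k x)" by auto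
  then obtain D where D: "D \<subseteq> bl N c" "finite D" "bl N c \<subseteq> (\<Union>x\<in>D. bl k x)"
    using compactE_image[OF compact_bl[of N c], of "bl N c" "bl k"] open_bl by metis
  have "bl k ` A \<subseteq> bl k ` D"
  proof
    fix B assume "B \<in> bl k ` A"
    then obtain x where x: "x \<in> A" "B = bl k x" by auto
    then obtain d where "d \<in> D" "x \<in> bl k d" using D assms by blast
    then show "B \<in> bl k ` D" using x bl_eq by auto
  qed
  then show ?thesis using D finite_subset by blast
qed

lemma obtain_transversal:
  assumes "A \<subseteq> bl N c"
  obtains T where "finite T" "T \<subseteq> A" "inj_on (bl k) T" "bl k ` T = bl k ` A"
    "\<forall>x\<in>A. \<exists>t\<in>T. x \<in> bl k t"
proof -
  obtain T where T: "T \<subseteq> A" "inj_on (bl k) T" "bl k ` A = bl k ` T"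
    using subset_image_inj[of "bl k ` A" "bl k" A] by auto
  moreover have "finite T"
    using finite_bl_image[OF assms, of k] T by (metis finite_imageD)
  moreover have "\<exists>t\<in>T. x \<in> bl k t" if "x \<in> A" for x
    using that T(3) bl_refl by (metis imageE image_eqI)
  ultimately show thesis using that by metis
qed

lemma disjoint_bl_transversal: "inj_on (bl k) T \<Longrightarrow> disjoint_family_on (\<lambda>t. bl k t \<inter> S) T"
  unfolding disjoint_family_on_def inj_on_def using bl_disjoint by blast

lemma compact_bounded: assumes "compact A" obtains N where "A \<subseteq> bl N 0"
proof -
  have cov: "A \<subseteq> (\<Union>N\<in>(UNIV::int set). bl N 0)"
    by (auto simp: mem_bl_0)
  obtain D where D: "finite D" "A \<subseteq> (\<Union>N\<in>D. bl N 0)"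
    using compactE_image[OF assms, of UNIV "\<lambda>N. bl N 0"] cov open_bl by metis
  show thesis
  proof (cases "D = {}")
    case True then show ?thesis using D that[of 0] by auto
  next
    case False
    have "A \<subseteq> bl (Max D) 0"
    proof
      fix x assume "x \<in> A"
      then obtain N where N: "N \<in> D" "x \<in> bl N 0" using D by auto
      then have "N \<le> Max D" using D by simp
      then show "x \<in> bl (Max D) 0" using N bl_mono by blast
    qed
    then show ?thesis using that by blast
  qed
qed

text \<open>A Lebesgue number argument. Every point of an ultrametric ball is a centre of it, so a
  finite subcover by balls on which \<open>P\<close> holds passes \<open>P\<close> on to all points,
  and the smallest radius works everywhere.\<close>

lemma compact_uniform:
  assumes "compact A" and loc: "\<And>x. x \<in> A \<Longrightarrow> \<exists>k. P x k"
    and shift: "\<And>x y k. P x k \<Longrightarrow> y \<in> bl k x \<Longrightarrow> P y k"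
    and mono: "\<And>x k j. P x k \<Longrightarrow> j \<le> k \<Longrightarrow> P x j"
  shows "\<exists>k. \<forall>x\<in>A. P x k"
proof -
  from loc obtain kk where kk: "\<And>x. x \<in> A \<Longrightarrow> P x (kk x)" by metis
  have cov: "A \<subseteq> (\<Union>x\<in>A. bl (kk x) x)" by auto
  obtain D where D: "D \<subseteq> A" "finite D" "A \<subseteq> (\<Union>x\<in>D. bl (kk x) x)"
    using compactE_image[OF assms(1), of A "\<lambda>x. bl (kk x) x"] cov open_bl by metis
  show ?thesis
  proof (cases "D = {}")
    case True then show ?thesis using D by auto
  next
    case False
    have "P x (Min (kk ` D))" if x: "x \<in> A" for x
    proof -
      obtain d where d: "d \<in> D" "x \<in> bl (kk d) d" using D x by auto
      then have "P x (kk d)" using shift kk D by blast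
      moreover have "Min (kk ` D) \<le> kk d" using D d by simp
      ultimately show ?thesis using mono by blast
    qed
    then show ?thesis by blast
  qed
qed

text \<open>A union of traces on \<open>S\<close> of balls of radius q^k. For closed
  \<open>S\<close>, the compact open subsets of \<open>S\<close> are the bounded sets saturated for
  some \<open>k\<close>; see \<open>saturated_compact_opens\<close> and
  \<open>compact_opens_saturated\<close>.\<close>

definition saturated :: "int \<Rightarrow> 'a set \<Rightarrow> 'a set \<Rightarrow> bool"
  where "saturated k S A \<longleftrightarrow> A \<subseteq> S \<and> (\<forall>x\<in>A. bl k x \<inter> S \<subseteq> A)"

lemma saturated_mono: "saturated k S A \<Longrightarrow> j \<le> k \<Longrightarrow> saturated j S A"
  unfolding saturated_def using bl_mono by blast

lemma saturated_compact_opens: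
  assumes "closed S" "saturated k S A" "A \<subseteq> bl N c"
  shows "A \<in> compact_opens S"
proof -
  define O' where "O' = (\<Union>x\<in>A. bl k x)"
  have "open O'" unfolding O'_def by (intro open_UN ballI open_bl)
  have A: "A = S \<inter> O'" using assms(2) unfolding O'_def saturated_def by auto
  \<comment> \<open>Balls of equal radius are equal or disjoint, so the complement of
    \<open>O'\<close> is again a union of balls and \<open>O'\<close> is clopen.\<close>
  define O2 where "O2 = (\<Union>x\<in>-O'. bl k x)"
  have "- O' = O2"
  proof (intro equalityI subsetI)
    fix x assume "x \<in> O2"
    then obtain y where y: "y \<notin> O'" "x \<in> bl k y" unfolding O2_def by auto
    then have "bl k x = bl k y" by (simp add: bl_eq)
    then have "y \<in> bl k a" if "x \<in> bl k a" for a
      using that bl_eq_iff by metis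
    with y show "x \<in> - O'" unfolding O'_def by blast
  qed (use bl_refl in \<open>auto simp del: bl_refl simp: O2_def\<close>)
  then have "open (- O')" unfolding O2_def by (metis open_UN open_bl)
  then have "closed O'" by (simp add: closed_def)
  then have "closed A" using A assms(1) by auto
  then have "compact A" using assms(3) compact_bl by (metis compact_Int_closed inf.absorb_iff2)
  moreover have "openin (top_of_set S) A" using A \<open>open O'\<close> by (auto simp: openin_open)
  ultimately show ?thesis by (simp add: compact_opens_def)
qed

lemma compact_opens_saturated:
  assumes "A \<in> compact_opens S"
  obtains k N where "saturated k S A" "A \<subseteq> bl N 0"
proof -
  have cA: "compact A" and oA: "openin (top_of_set S) A" using assms by (auto simp: compact_opens_def)
  then obtain O' where O': "open O'" "A = S \<inter> O'" by (auto simp: openin_open)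
  have "\<exists>k. \<forall>x\<in>A. bl k x \<inter> S \<subseteq> A"
  proof (rule compact_uniform[OF cA])
    fix x assume "x \<in> A"
    then obtain k where "\<forall>y. nrm (y - x) \<le> real q powi k \<longrightarrow> y \<in> O'" using O' open_iff by auto
    then show "\<exists>k. bl k x \<inter> S \<subseteq> A" using O' by (auto simp: bl_def)
  next
    fix x y k assume "bl k x \<inter> S \<subseteq> A" "y \<in> bl k x"
    then show "bl k y \<inter> S \<subseteq> A" using bl_eq by auto
  qed (use bl_mono in blast)
  then obtain k where "saturated k S A" using O' unfolding saturated_def by auto
  moreover obtain N where "A \<subseteq> bl N 0" using compact_bounded[OF cA] .
  ultimately show thesis using that by blast
qed


section \<open>Step functions and their integrals\<close>

definition step_fun :: "'a set \<Rightarrow> int \<Rightarrow> int \<Rightarrow> ('a \<Rightarrow> 'e::zero) \<Rightarrow> bool"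
  where "step_fun S k N f \<longleftrightarrow> (\<forall>x\<in>S. \<forall>y\<in>bl k x \<inter> S. f y = f x) \<and> (\<forall>x. f x \<noteq> 0 \<longrightarrow> x \<in> S \<inter> bl N 0)"

text \<open>The Schwartz-Bruhat functions on \<open>S\<close>, extended by 0: \<open>k\<close> is
  the scale of constancy and \<open>N\<close> bounds the support.\<close>

definition schwartz :: "'a set \<Rightarrow> ('a \<Rightarrow> 'e::zero) set"
  where "schwartz S = {f. \<exists>k N. step_fun S k N f}"

lemma step_funD:
  assumes "step_fun S k N f"
  shows "x \<in> S \<Longrightarrow> y \<in> S \<Longrightarrow> y \<in> bl k x \<Longrightarrow> f y = f x" "f x \<noteq> 0 \<Longrightarrow> x \<in> S" "f x \<noteq> 0 \<Longrightarrow> x \<in> bl N 0"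
  using assms unfolding step_fun_def by blast+

lemma step_fun_mono: "step_fun S k N f \<Longrightarrow> j \<le> k \<Longrightarrow> N \<le> M \<Longrightarrow> step_fun S j M f"
  unfolding step_fun_def using bl_mono by blast

lemma schwartz_common:
  assumes "finite I" "\<And>i. i \<in> I \<Longrightarrow> f i \<in> schwartz S"
  shows "\<exists>k N. \<forall>i\<in>I. step_fun S k N (f i)"
  using assms
proof (induction I rule: finite_induct)
  case (insert i I)
  then obtain k N where kN: "\<forall>i\<in>I. step_fun S k N (f i)" by blast
  obtain k' N' where kN': "step_fun S k' N' (f i)"
    using insert.prems[of i] by (auto simp: schwartz_def)
  have "step_fun S (min k k') (max N N') (f j)" if "j \<in> insert i I" for j
    using that kN kN' step_fun_mono[of S k N "f j" "min k k'" "max N N'"]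
      step_fun_mono[of S k' N' "f i" "min k k'" "max N N'"] by auto
  then show ?case by blast
qed simp

lemma step_fun_sum:
  fixes f :: "'i \<Rightarrow> 'a \<Rightarrow> 'e::field_char_0"
  assumes kN: "\<And>i. i \<in> I \<Longrightarrow> step_fun S k N (f i)"
  shows "step_fun S k N (\<lambda>x. \<Sum>i\<in>I. c i * f i x)"
  unfolding step_fun_def
proof (intro conjI ballI allI impI)
  fix x y assume "x \<in> S" "y \<in> bl k x \<inter> S"
  then show "(\<Sum>i\<in>I. c i * f i y) = (\<Sum>i\<in>I. c i * f i x)"
    using step_funD(1)[OF kN, of _ x y] by (intro sum.cong) auto
next
  fix x assume "(\<Sum>i\<in>I. c i * f i x) \<noteq> 0"
  then obtain i where "i \<in> I" "c i * f i x \<noteq> 0"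
    using sum.not_neutral_contains_not_neutral by blast
  then show "x \<in> S \<inter> bl N 0" using step_funD(2,3)[OF kN, of i x] by auto
qed

lemma integ_transversal:
  fixes f :: "'a \<Rightarrow> 'e::field_char_0"
  assumes \<mu>: "content_on (compact_opens S) \<mu>" and S: "closed S"
    and f: "step_fun S k N f"
    and T: "finite T" "T \<subseteq> S" "inj_on (bl k) T" and cov: "\<And>x. f x \<noteq> 0 \<Longrightarrow> \<exists>t\<in>T. x \<in> bl k t"
  shows "integ \<mu> f = (\<Sum>t\<in>T. f t * of_rat (\<mu> (bl k t \<inter> S)))"
proof (rule integ_partition[OF T(1) disjoint_bl_transversal[OF T(3)]])
  fix t x assume "t \<in> T" "x \<in> bl k t \<inter> S" then show "f x = f t"
    using f T(2) unfolding step_fun_def by blast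
next
  fix x assume "x \<notin> (\<Union>t\<in>T. bl k t \<inter> S)"
  then show "f x = 0" using cov f unfolding step_fun_def by fastforce
next
  fix J assume J: "J \<subseteq> T"
  then have fJ: "finite J" using T finite_subset by blast
  obtain M where M: "J \<subseteq> bl M 0" using compact_bounded[OF finite_imp_compact[OF fJ]] .
  show "\<mu> (\<Union>t\<in>J. bl k t \<inter> S) = (\<Sum>t\<in>J. \<mu> (bl k t \<inter> S))"
  proof (rule content_on_Union[OF \<mu> fJ])
    show "disjoint_family_on (\<lambda>t. bl k t \<inter> S) J"
      using disjoint_bl_transversal[OF T(3)] J unfolding disjoint_family_on_def by blast
    fix J' assume J': "J' \<subseteq> J"
    show "(\<Union>t\<in>J'. bl k t \<inter> S) \<in> compact_opens S"
    proof (rule saturated_compact_opens[OF S, of k])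
      show "saturated k S (\<Union>t\<in>J'. bl k t \<inter> S)"
        unfolding saturated_def using bl_eq by auto
      show "(\<Union>t\<in>J'. bl k t \<inter> S) \<subseteq> bl (max k M) 0"
      proof
        fix x assume "x \<in> (\<Union>t\<in>J'. bl k t \<inter> S)"
        then obtain t where "t \<in> J'" "x \<in> bl k t" by auto
        then have "t \<in> bl (max k M) 0" "x \<in> bl (max k M) t"
          using M J' bl_mono[of M "max k M" 0] bl_mono[of k "max k M" t] by auto
        then show "x \<in> bl (max k M) 0" using bl_trans by blast
      qed
    qed
  qed
qed

text \<open>Linearity is not visible from \<open>integ\<close>, which is organized by the values of
  the integrand; all summands are therefore evaluated on one transversal of balls on which each of
  them is constant.\<close>

lemma integ_sum:
  fixes f :: "'i \<Rightarrow> 'a \<Rightarrow> 'e::field_char_0"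
  assumes \<mu>: "content_on (compact_opens S) \<mu>" and S: "closed S"
    and "finite I" "\<And>i. i \<in> I \<Longrightarrow> f i \<in> schwartz S"
  shows "integ \<mu> (\<lambda>x. \<Sum>i\<in>I. c i * f i x) = (\<Sum>i\<in>I. c i * integ \<mu> (f i))"
proof -
  obtain k N where kN: "\<And>i. i \<in> I \<Longrightarrow> step_fun S k N (f i)"
    using schwartz_common[of I f S, OF assms(3) assms(4)] by auto
  obtain T where T: "finite T" "T \<subseteq> S \<inter> bl N 0" "inj_on (bl k) T"
    "bl k ` T = bl k ` (S \<inter> bl N 0)" "\<forall>x\<in>S \<inter> bl N 0. \<exists>t\<in>T. x \<in> bl k t"
    using obtain_transversal[of "S \<inter> bl N 0" N 0 k, OF Int_lower2] .
  have TS: "T \<subseteq> S" using T by blast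
  have tr: "integ \<mu> g = (\<Sum>t\<in>T. g t * of_rat (\<mu> (bl k t \<inter> S)))" if "step_fun S k N g" for g :: "'a \<Rightarrow> 'e"
    by (rule integ_transversal[OF \<mu> S that T(1) TS T(3)]) (use T(5) step_funD(2,3)[OF that] in blast)
  have "step_fun S k N (\<lambda>x. \<Sum>i\<in>I. c i * f i x)"
    using kN by (rule step_fun_sum)
  then have "integ \<mu> (\<lambda>x. \<Sum>i\<in>I. c i * f i x) = (\<Sum>t\<in>T. (\<Sum>i\<in>I. c i * f i t) * of_rat (\<mu> (bl k t \<inter> S)))"
    by (rule tr)
  also have "\<dots> = (\<Sum>i\<in>I. \<Sum>t\<in>T. c i * f i t * of_rat (\<mu> (bl k t \<inter> S)))"
    unfolding sum_distrib_right by (rule sum.swap)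
  also have "\<dots> = (\<Sum>i\<in>I. c i * integ \<mu> (f i))"
    using tr[OF kN] by (intro sum.cong) (auto simp: sum_distrib_left mult.assoc)
  finally show ?thesis .
qed

lemma schwartz_sum:
  fixes f :: "'i \<Rightarrow> 'a \<Rightarrow> 'e::field_char_0"
  assumes "finite I" "\<And>i. i \<in> I \<Longrightarrow> f i \<in> schwartz S"
  shows "(\<lambda>x. \<Sum>i\<in>I. c i * f i x) \<in> schwartz S"
proof -
  obtain k N where kN: "\<And>i. i \<in> I \<Longrightarrow> step_fun S k N (f i)"
    using schwartz_common[of I f S, OF assms(1) assms(2)] by auto
  have "step_fun S k N (\<lambda>x. \<Sum>i\<in>I. c i * f i x)"
    using kN by (rule step_fun_sum)
  then show ?thesis unfolding schwartz_def by blast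
qed

lemma indicator_schwartz:
  assumes "A \<in> compact_opens S"
  shows "(\<lambda>x. if x \<in> A then c else 0) \<in> schwartz S"
proof -
  obtain k N where kN: "saturated k S A" "A \<subseteq> bl N 0" using compact_opens_saturated[OF assms] .
  have mem: "y \<in> A \<longleftrightarrow> x \<in> A" if "x \<in> S" "y \<in> S" "y \<in> bl k x" for x y
    using that kN(1) bl_eq[OF that(3)] unfolding saturated_def by (metis IntI bl_refl subsetD)
  have "step_fun S k N (\<lambda>x. if x \<in> A then c else 0)"
    unfolding step_fun_def
  proof (intro conjI ballI allI impI)
    fix x y assume "x \<in> S" "y \<in> bl k x \<inter> S"
    then show "(if y \<in> A then c else 0) = (if x \<in> A then c else 0)" using mem[of x y] by simp
  next
    fix x assume "(if x \<in> A then c else 0) \<noteq> 0"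
    then show "x \<in> S \<inter> bl N 0" using kN unfolding saturated_def by (auto split: if_splits)
  qed
  then show ?thesis unfolding schwartz_def by blast
qed

lemma bl_compact_opens: "closed S \<Longrightarrow> bl k x \<inter> S \<in> compact_opens S"
  by (rule saturated_compact_opens[of S k _ k x]) (auto simp: saturated_def dest: bl_eq)

lemma integ_indicator:
  fixes c :: "'e::field_char_0"
  assumes "content_on (compact_opens S) \<mu>" "A \<in> compact_opens S"
  shows "integ \<mu> (\<lambda>x. if x \<in> A then c else 0) = c * of_rat (\<mu> A)"
proof -
  have "{} \<in> compact_opens S" by (simp add: compact_opens_def)
  then have "\<mu> ({} \<union> {}) = \<mu> {} + \<mu> {}" using assms(1) unfolding content_on_def by blast
  then have "\<mu> {} = 0" by simp
  then have "\<mu> (\<Union>i\<in>J. A) = (\<Sum>i\<in>J. \<mu> A)" if "J \<subseteq> {()}" for J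
  proof -
    have "J = {} \<or> J = {()}" using that by blast
    then show ?thesis using \<open>\<mu> {} = 0\<close> by (elim disjE) simp_all
  qed
  then show ?thesis
    using integ_partition[of "{()}" "\<lambda>_. A" "\<lambda>x. if x \<in> A then c else 0" "\<lambda>_. c" \<mu>]
    by (simp add: disjoint_family_on_def)
qed

lemma test_functions_eq: "test_functions = (schwartz UNIV :: ('a \<Rightarrow> 'e::zero) set)"
proof (intro equalityI subsetI)
  fix f :: "'a \<Rightarrow> 'e" assume f: "f \<in> test_functions"
  define C where "C = closure {x. f x \<noteq> 0}"
  have C: "compact C" and lc: "locally_constant_on UNIV f" using f by (auto simp: test_functions_def C_def)
  obtain N where N: "C \<subseteq> bl N 0" using compact_bounded[OF C] .
  have "\<exists>k. \<forall>x\<in>C. \<forall>y\<in>bl k x. f y = f x"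
  proof (rule compact_uniform[OF C])
    fix x
    obtain U where "open U" "x \<in> U" "f constant_on U"
      using lc unfolding locally_constant_on_def by auto
    moreover then obtain k where "bl k x \<subseteq> U" unfolding open_iff bl_def by blast
    ultimately show "\<exists>k. \<forall>y\<in>bl k x. f y = f x" unfolding constant_on_def by (metis bl_refl subsetD)
  next
    fix x y k assume "\<forall>y\<in>bl k x. f y = f x" "y \<in> bl k x"
    then show "\<forall>z\<in>bl k y. f z = f y" using bl_eq[of y k x] by metis
  qed (use bl_mono in blast)
  then obtain k where k: "\<And>x y. x \<in> C \<Longrightarrow> y \<in> bl k x \<Longrightarrow> f y = f x" by blast
  have out: "f x = 0" if "x \<notin> C" for x
    using that closure_subset[of "{x. f x \<noteq> 0}"] unfolding C_def by auto
  \<comment> \<open>If one of the two points lies in \<open>C\<close>, the radius \<open>k\<close>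
    applies there, the relation being symmetric; if neither does, both values are 0.\<close>
  have "f y = f x" if "y \<in> bl k x" for x y
    using k[of x y] k[of y x] out[of x] out[of y] that bl_sym[of y k x] by metis
  moreover have "x \<in> bl N 0" if "f x \<noteq> 0" for x using that N out by blast
  ultimately have "step_fun UNIV k N f" unfolding step_fun_def by blast
  then show "f \<in> schwartz UNIV" unfolding schwartz_def by blast
next
  fix f :: "'a \<Rightarrow> 'e" assume "f \<in> schwartz UNIV"
  then obtain k N where f: "step_fun UNIV k N f" unfolding schwartz_def by blast
  have "locally_constant_on UNIV f"
    unfolding locally_constant_on_def
  proof
    fix x
    have "f constant_on bl k x" unfolding constant_on_def
      by (intro exI[of _ "f x"] ballI step_funD(1)[OF f]) simp_all
    then show "\<exists>U. openin (top_of_set UNIV) U \<and> x \<in> U \<and> f constant_on U"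
      by (intro exI[of _ "bl k x"]) (simp add: open_bl)
  qed
  moreover have "compact (closure {x. f x \<noteq> 0})"
  proof -
    have "closure {x. f x \<noteq> 0} \<subseteq> bl N 0"
      by (rule closure_minimal) (use step_funD(3)[OF f] closed_bl in auto)
    then show ?thesis by (metis closed_closure compact_Int_closed compact_bl inf.absorb_iff2)
  qed
  ultimately show "f \<in> test_functions" by (simp add: test_functions_def)
qed

section \<open>Haar contents by counting balls\<close>

definition num_balls :: "int \<Rightarrow> 'a set \<Rightarrow> nat"
  where "num_balls k A = card (bl k ` A)"

text \<open>\<open>d\<close> is the dimension of \<open>S\<close>: it makes the count of balls of
  radius q^k, weighted with q^(d k), independent of the radius once this is small enough.\<close>

definition homogeneous :: "nat \<Rightarrow> 'a set \<Rightarrow> bool"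
  where "homogeneous d S \<longleftrightarrow> closed S \<and> (\<forall>k. \<forall>x\<in>S. num_balls (k - 1) (bl k x \<inter> S) = q ^ d)"

lemma num_balls_translate: "num_balls k ((+) a ` A) = num_balls k A"
proof -
  have "bl k ` (+) a ` A = (`) ((+) a) ` bl k ` A"
    by (simp add: image_image bl_translate)
  moreover have "inj ((`) ((+) a))"
    by (rule inj_on_image) (simp add: inj_on_def)
  ultimately show ?thesis unfolding num_balls_def
    by (metis card_image inj_on_subset subset_UNIV)
qed

lemma num_balls_Un:
  assumes "A \<inter> B = {}" "saturated k S A" "saturated k S B" "A \<subseteq> bl N 0" "B \<subseteq> bl N 0"
  shows "num_balls k (A \<union> B) = num_balls k A + num_balls k B"
proof -
  have "bl k ` A \<inter> bl k ` B = {}"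
  proof (rule ccontr)
    assume "bl k ` A \<inter> bl k ` B \<noteq> {}"
    then obtain a b where "a \<in> A" "b \<in> B" "bl k b = bl k a" by auto
    then have "b \<in> bl k a \<inter> S" using bl_eq_iff assms(3) by (auto simp: saturated_def)
    then show False using assms(1,2) \<open>a \<in> A\<close> \<open>b \<in> B\<close> unfolding saturated_def by blast
  qed
  then show ?thesis unfolding num_balls_def image_Un
    using finite_bl_image[OF assms(4)] finite_bl_image[OF assms(5)] by (rule_tac card_Un_disjoint) auto
qed

lemma num_balls_refine:
  assumes S: "homogeneous d S" and A: "saturated k S A" "A \<subseteq> bl N 0"
  shows "num_balls (k - 1) A = q ^ d * num_balls k A"
proof -
  obtain T where T: "finite T" "T \<subseteq> A" "inj_on (bl k) T" "bl k ` T = bl k ` A"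
    "\<forall>x\<in>A. \<exists>t\<in>T. x \<in> bl k t"
    using obtain_transversal[OF A(2)] .
  have A_eq: "A = (\<Union>t\<in>T. bl k t \<inter> S)"
  proof
    show "A \<subseteq> (\<Union>t\<in>T. bl k t \<inter> S)" using T(5) A(1) unfolding saturated_def by auto
    show "(\<Union>t\<in>T. bl k t \<inter> S) \<subseteq> A" using T(2) A(1) unfolding saturated_def by auto
  qed
  have "bl (k - 1) ` A = (\<Union>t\<in>T. bl (k - 1) ` (bl k t \<inter> S))"
    by (subst A_eq) (simp only: image_UN)
  also have "card \<dots> = (\<Sum>t\<in>T. card (bl (k - 1) ` (bl k t \<inter> S)))"
  proof (rule card_UN_disjoint[OF T(1)])
    show "\<forall>i\<in>T. finite (bl (k - 1) ` (bl k i \<inter> S))"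
      by (intro ballI finite_bl_image) (rule Int_lower1)
    have "bl (k - 1) ` (bl k i \<inter> S) \<inter> bl (k - 1) ` (bl k j \<inter> S) = {}" if "i \<in> T" "j \<in> T" "i \<noteq> j" for i j
    proof (rule ccontr)
      assume "\<not> ?thesis"
      then obtain x y where xy: "x \<in> bl k i" "y \<in> bl k j" "bl (k - 1) x = bl (k - 1) y" by auto
      then have "x \<in> bl (k - 1) y" by (simp add: bl_eq_iff)
      then have "x \<in> bl k y" using bl_mono[of "k - 1" k y] by auto
      then have "bl k i = bl k j"
        using bl_eq[OF xy(1)] bl_eq[OF xy(2)] bl_eq[of x k y] by simp
      then show False using T(3) that unfolding inj_on_def by blast
    qed
    then show "\<forall>i\<in>T. \<forall>j\<in>T. i \<noteq> j \<longrightarrow> bl (k - 1) ` (bl k i \<inter> S) \<inter> bl (k - 1) ` (bl k j \<inter> S) = {}"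
      by blast
  qed
  also have "\<dots> = (\<Sum>t\<in>T. q ^ d)"
    using S T A(1) unfolding homogeneous_def num_balls_def saturated_def by (intro sum.cong) auto
  also have "\<dots> = q ^ d * card (bl k ` A)"
    using T by (metis card_image mult.commute sum_constant of_nat_id)
  finally show ?thesis unfolding num_balls_def .
qed

text \<open>The eventually constant value of the weighted count as the radius shrinks. It mentions
  neither \<open>S\<close> nor a level of saturation, so a single set function serves all parallel
  hyperplanes, and translation invariance is that of \<open>num_balls\<close>.\<close>

definition ball_content :: "nat \<Rightarrow> 'a set \<Rightarrow> rat"
  where "ball_content d A = (THE r. \<exists>k0. \<forall>k\<le>k0. r = of_nat (num_balls k A) * of_nat q powi (int d * k))"

lemma ball_content_eqI:
  fixes r :: rat
  assumes "\<And>k. k \<le> k0 \<Longrightarrow> r = of_nat (num_balls k A) * of_nat q powi (int d * k)"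
  shows "ball_content d A = r"
  unfolding ball_content_def
proof (rule the_equality)
  fix r' :: rat assume "\<exists>k0. \<forall>k\<le>k0. r' = of_nat (num_balls k A) * of_nat q powi (int d * k)"
  then obtain k1 where "\<forall>k\<le>k1. r' = of_nat (num_balls k A) * of_nat q powi (int d * k)" by blast
  with assms[of "min k0 k1"] show "r' = r" by (metis min.cobounded1 min.cobounded2)
qed (use assms in blast)

lemma ball_content_eq:
  assumes S: "homogeneous d S" and A: "saturated k S A" "A \<subseteq> bl N 0"
  shows "ball_content d A = of_nat (num_balls k A) * of_nat q powi (int d * k)"
proof (rule ball_content_eqI[of k])
  have q0: "(of_nat q :: rat) \<noteq> 0" using q_gt_1 by simp
  fix j assume "j \<le> k"
  then show "of_nat (num_balls k A) * (of_nat q :: rat) powi (int d * k) = of_nat (num_balls j A) * of_nat q powi (int d * j)"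
  proof (induction j rule: int_le_induct)
    case (step j)
    have "num_balls (j - 1) A = q ^ d * num_balls j A"
      by (rule num_balls_refine[OF S saturated_mono[OF A(1)] A(2)]) (use step in auto)
    moreover have "(of_nat q :: rat) powi (int d * j) = of_nat q ^ d * of_nat q powi (int d * (j - 1))"
      using q0 by (metis add.commute diff_add_cancel distrib_left mult.right_neutral power_int_add power_int_of_nat)
    ultimately show ?case using step by simp
  qed simp
qed

lemma content_on_ball_content:
  assumes S: "homogeneous d S" shows "content_on (compact_opens S) (ball_content d)"
  unfolding content_on_def
proof (intro conjI ballI impI)
  fix A assume "A \<in> compact_opens S"
  then obtain k N where "saturated k S A" "A \<subseteq> bl N 0" using compact_opens_saturated by blast
  then show "0 \<le> ball_content d A" by (simp add: ball_content_eq[OF S])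
next
  fix A B assume "A \<in> compact_opens S" "B \<in> compact_opens S" and dis: "A \<inter> B = {}"
  then obtain k N j M where AB: "saturated k S A" "A \<subseteq> bl N 0" "saturated j S B" "B \<subseteq> bl M 0"
    using compact_opens_saturated by metis
  define l L where "l = min k j" and "L = max N M"
  have *: "saturated l S A" "A \<subseteq> bl L 0" "saturated l S B" "B \<subseteq> bl L 0"
    using AB saturated_mono[of k S A l] saturated_mono[of j S B l] bl_mono[of N L 0] bl_mono[of M L 0]
    unfolding l_def L_def by auto
  then have "saturated l S (A \<union> B)" "A \<union> B \<subseteq> bl L 0" unfolding saturated_def by auto
  then show "ball_content d (A \<union> B) = ball_content d A + ball_content d B"
    using * num_balls_Un[OF dis *(1,3,2,4)] by (simp add: ball_content_eq[OF S, of l _ L] distrib_right)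
qed

lemma ball_content_translate: "ball_content d ((+) a ` A) = ball_content d A"
  unfolding ball_content_def num_balls_translate ..

lemma ball_content_ball:
  assumes S: "homogeneous d S" and x: "x \<in> bl k c" "x \<in> S"
  shows "ball_content d (bl k c \<inter> S) = of_nat q powi (int d * k)"
proof -
  have "saturated k S (bl k c \<inter> S)" unfolding saturated_def using bl_eq by auto
  moreover obtain N where "bl k c \<subseteq> bl N 0" using bl_0_change_center[OF x(1)] by blast
  moreover have "num_balls k (bl k c \<inter> S) = 1"
  proof -
    have "bl k ` (bl k c \<inter> S) = {bl k c}" using x bl_eq by blast
    then show ?thesis by (simp add: num_balls_def)
  qed
  ultimately show ?thesis using ball_content_eq[OF S, of k "bl k c \<inter> S" N] by auto
qed

end

subsection \<open>The field and its vector space as ultranormed groups\<close>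

lemma absval_0 [simp]: "absval (0::'f::nonarch_local_field) = 0"
  by (metis diff_self dist_absval dist_self)

lemma absval_eq_0 [simp]: "absval (x::'f::nonarch_local_field) = 0 \<longleftrightarrow> x = 0"
  by (metis diff_zero dist_absval dist_eq_0_iff)

lemma absval_nonneg [simp]: "0 \<le> absval (x::'f::nonarch_local_field)"
  by (metis diff_zero dist_absval zero_le_dist)

lemma absval_1 [simp]: "absval (1::'f::nonarch_local_field) = 1"
  by (metis absval_eq_0 absval_mult mult_cancel_left2 mult_1_right zero_neq_one)

lemma absval_minus [simp]: "absval (- x::'f::nonarch_local_field) = absval x"
  by (metis diff_zero dist_absval dist_commute minus_diff_eq)

lemma absval_inverse: "absval (inverse x::'f::nonarch_local_field) = inverse (absval x)"
  by (metis absval_0 absval_1 absval_mult inverse_zero left_inverse absval_eq_0 inverse_unique mult.commute)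

lemma absval_divide: "absval (x / y::'f::nonarch_local_field) = absval x / absval y"
  by (simp add: absval_inverse absval_mult divide_inverse)

lemma residue_order_gt_1: "residue_order TYPE('f::nonarch_local_field) > 1"
proof -
  define r where "r = {(x::'f, y). x \<in> ring_of_integers \<and> y \<in> ring_of_integers \<and> absval (x - y) < 1}"
  have "r `` {0} \<in> (residue_field :: 'f set set)" "r `` {1} \<in> (residue_field :: 'f set set)"
    unfolding residue_field_def r_def[symmetric] by (auto intro!: quotientI simp: ring_of_integers_def)
  moreover have "0 \<in> r `` {0}" "0 \<notin> r `` {1}" by (auto simp: r_def ring_of_integers_def)
  ultimately have "{r `` {0}, r `` {1}} \<subseteq> (residue_field :: 'f set set)" "r `` {0} \<noteq> r `` {1}" by auto
  then show ?thesis unfolding residue_order_def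
    using card_mono[OF finite_residue_field, of "{r `` {0}, r `` {1}}"] by auto
qed

lemma absval_powi:
  assumes "(x::'f::nonarch_local_field) \<noteq> 0"
  shows "\<exists>k::int. absval x = real (residue_order TYPE('f)) powi k"
  using value_group[where 'a='f] assms unfolding residue_order_def by blast

lemma ex_absval_powi: "\<exists>x::'f::nonarch_local_field. x \<noteq> 0 \<and> absval x = real (residue_order TYPE('f)) powi k"
proof -
  have "real (residue_order TYPE('f)) powi k \<in> absval ` (- {0::'f})"
    unfolding value_group residue_order_def by (rule rangeI)
  then show ?thesis by auto
qed

lemma residue_field_eq_balls:
  "(residue_field :: 'f::nonarch_local_field set set) =
     (\<lambda>x. {y. absval (y - x) \<le> real (residue_order TYPE('f)) powi (- 1)}) ` {x. absval x \<le> 1}"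
proof -
  let ?q = "real (residue_order TYPE('f))"
  have q: "?q > 1" using residue_order_gt_1[where 'f='f] by simp
  \<comment> \<open>The value group is discrete: no norm lies strictly between
    \<open>?q powi (- 1)\<close> and 1, so residue classes are closed balls.\<close>
  have lt: "absval z < 1 \<longleftrightarrow> absval z \<le> ?q powi (- 1)" for z :: 'f
  proof (cases "z = 0")
    case False
    then obtain k where k: "absval z = ?q powi k" using absval_powi by blast
    have "?q powi k < ?q powi 0 \<longleftrightarrow> k < 0"
      using q power_int_strict_increasing[of k 0 ?q] power_int_increasing[of 0 k ?q] by linarith
    moreover have "?q powi k \<le> ?q powi (- 1) \<longleftrightarrow> k \<le> - 1"
      using q power_int_strict_increasing[of "- 1" k ?q] power_int_increasing[of k "- 1" ?q] by linarith
    ultimately show ?thesis using k by auto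
  qed (use q in auto)
  have "{(x, y). x \<in> ring_of_integers \<and> y \<in> ring_of_integers \<and> absval (x - y) < 1} `` {x}
        = {y. absval (y - x) \<le> ?q powi (- 1)}" if "absval x \<le> 1" for x :: 'f
  proof -
    have "absval y \<le> 1" if "absval (y - x) < 1" for y
      using absval_ultrametric[of "y - x" x] that \<open>absval x \<le> 1\<close> by auto
    moreover have "absval (x - y) = absval (y - x)" for y by (metis absval_minus minus_diff_eq)
    ultimately show ?thesis using that lt by (auto simp: ring_of_integers_def)
  qed
  then show ?thesis unfolding residue_field_def quotient_def
    by (auto simp: ring_of_integers_def)
qed

text \<open>The affine map \<open>h\<close> carries the unit ball and its residue classes onto the
  given ball and its subballs, so every ball splits into as many pieces as the residue field has
  elements. Normalization of the absolute value supplies \<open>c\<close> of norm exactly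
  \<open>?q powi k\<close>.\<close>

lemma absval_ball_refine:
  fixes x :: "'f::nonarch_local_field"
  defines "B \<equiv> \<lambda>k (x::'f). {y. absval (y - x) \<le> real (residue_order TYPE('f)) powi k}"
  shows "finite (B (k - 1) ` B k x) \<and> card (B (k - 1) ` B k x) = residue_order TYPE('f)"
proof -
  let ?q = "real (residue_order TYPE('f))"
  have q: "?q > 1" using residue_order_gt_1[where 'f='f] by simp
  obtain c :: 'f where c: "c \<noteq> 0" "absval c = ?q powi k" using ex_absval_powi by blast
  define h where "h = (\<lambda>y::'f. x + c * y)"
  define g where "g = (\<lambda>y::'f. (y - x) / c)"
  have gh: "g (h y) = y" "h (g y) = y" for y using c by (auto simp: g_def h_def)
  have h_mem: "h y \<in> B (k + j) (h z) \<longleftrightarrow> y \<in> B j z" for y z j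
  proof -
    have "absval (h y - h z) = ?q powi k * absval (y - z)"
      by (simp add: h_def c(2)[symmetric] absval_mult[symmetric] algebra_simps)
    moreover have "?q powi (k + j) = ?q powi k * ?q powi j" using q by (simp add: power_int_add)
    moreover have "?q powi k > 0" using q by simp
    ultimately show ?thesis by (simp add: B_def mult_le_cancel_left_pos)
  qed
  have hB: "h ` B j z = B (k + j) (h z)" for j z
  proof (intro equalityI subsetI)
    fix y assume "y \<in> B (k + j) (h z)"
    then have "g y \<in> B j z" using h_mem[of "g y" j z] gh by simp
    then show "y \<in> h ` B j z" using gh by (metis image_eqI)
  qed (use h_mem in auto)
  have "B k x = h ` B 0 0" using hB[of 0 0] by (simp add: h_def)
  then have "B (k - 1) ` B k x = (`) h ` (B (- 1) ` B 0 0)"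
    using hB[of "- 1"] by (simp add: image_image)
  moreover have "inj ((`) h)"
    using gh by (intro inj_on_image) (metis inj_on_inverseI inj_on_subset subset_UNIV)
  moreover have "B (- 1) ` B 0 0 = residue_field"
    unfolding residue_field_eq_balls B_def by simp
  ultimately show ?thesis
    using finite_residue_field[where 'a='f] card_image[of "(`) h" "residue_field :: 'f set set"] inj_on_subset
    unfolding residue_order_def by (metis finite_imageI subset_UNIV)
qed

text \<open>Refining \<open>m\<close> times keeps the number of centres finite; as \<open>m\<close>
  grows this gives the total boundedness which, with completeness, makes closed balls
  compact.\<close>

lemma absval_ball_finite_net:
  "\<exists>T. finite T \<and> (\<forall>y::'f::nonarch_local_field. absval (y - x) \<le> real (residue_order TYPE('f)) powi k \<longrightarrow>
     (\<exists>t\<in>T. absval (y - t) \<le> real (residue_order TYPE('f)) powi (k - int m)))"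
proof (induction m)
  case 0
  then show ?case by (intro exI[of _ "{x}"]) auto
next
  case (Suc m)
  let ?q = "real (residue_order TYPE('f))"
  obtain T where T: "finite T" "\<And>y. absval (y - x) \<le> ?q powi k \<Longrightarrow> \<exists>t\<in>T. absval (y - t) \<le> ?q powi (k - int m)"
    using Suc by blast
  define B where "B = (\<lambda>k (x::'f). {y. absval (y - x) \<le> ?q powi k})"
  define j where "j = k - int m"
  have "\<exists>U. finite U \<and> B (j - 1) ` B j t = B (j - 1) ` U" for t :: 'f
  proof -
    have "finite (B (j - 1) ` B j t)" using absval_ball_refine[of j t] unfolding B_def by blast
    then show ?thesis by (metis finite_subset_image order_refl)
  qed
  then obtain U where U: "\<And>t. finite (U t)" "\<And>t. B (j - 1) ` B j t = B (j - 1) ` U t" by metis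
  have "\<exists>u\<in>\<Union>(U ` T). absval (y - u) \<le> ?q powi (k - int (Suc m))" if y: "absval (y - x) \<le> ?q powi k" for y
  proof -
    obtain t where t: "t \<in> T" "y \<in> B j t" using T(2)[OF y] by (auto simp: B_def j_def)
    then have "B (j - 1) y \<in> B (j - 1) ` U t" using U(2)[of t] by blast
    then obtain u where u: "u \<in> U t" "B (j - 1) y = B (j - 1) u" by auto
    have "y \<in> B (j - 1) y" using residue_order_gt_1[where 'f='f] by (simp add: B_def)
    then have "y \<in> B (j - 1) u" using u by simp
    then show ?thesis using u t by (auto simp: B_def j_def algebra_simps)
  qed
  then show ?case using T U by (intro exI[of _ "\<Union>(U ` T)"]) auto
qed

lemma powi_small:
  assumes "(b::real) > 1" "e > 0" shows "\<exists>m::nat. b powi (k - int m) < e"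
proof -
  have b: "b powi k > 0" using assms by simp
  obtain m where "(1 / b) ^ m < e / b powi k"
    using real_arch_pow_inv[of "e / b powi k" "1 / b"] assms b by auto
  then have "b powi k * (1 / b) ^ m < e" using b by (simp add: field_simps)
  moreover have "b powi (k - int m) = b powi k * (1 / b) ^ m"
    using assms by (simp add: power_int_diff field_simps)
  ultimately show ?thesis by metis
qed

lemma compact_absval_ball: "compact {y. absval (y - x) \<le> real (residue_order TYPE('f)) powi k}"
  for x :: "'f::nonarch_local_field"
proof -
  let ?q = "real (residue_order TYPE('f))"
  let ?C = "{y. absval (y - x) \<le> ?q powi k}"
  have q: "?q > 1" using residue_order_gt_1[where 'f='f] by simp
  have "?C = cball x (?q powi k)" by (auto simp: dist_absval[symmetric] dist_commute)
  then have "complete ?C" by (simp add: complete_eq_closed)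
  moreover have "\<exists>T. finite T \<and> ?C \<subseteq> (\<Union>t\<in>T. ball t e)" if e: "e > 0" for e
  proof -
    obtain m where m: "?q powi (k - int m) < e" using powi_small[OF q e] by blast
    obtain T where T: "finite T" "\<And>y. y \<in> ?C \<Longrightarrow> \<exists>t\<in>T. absval (y - t) \<le> ?q powi (k - int m)"
      using absval_ball_finite_net[of x k m] by auto
    have "?C \<subseteq> (\<Union>t\<in>T. ball t e)"
    proof
      fix y assume "y \<in> ?C"
      then obtain t where "t \<in> T" "absval (y - t) \<le> ?q powi (k - int m)" using T by blast
      then have "y \<in> ball t e" using m by (simp add: dist_absval[symmetric] dist_commute)
      then show "y \<in> (\<Union>t\<in>T. ball t e)" using \<open>t \<in> T\<close> by blast
    qed
    then show ?thesis using T by blast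
  qed
  ultimately show ?thesis unfolding compact_eq_totally_bounded by blast
qed

global_interpretation F: ultranorm "absval :: 'f::nonarch_local_field \<Rightarrow> real" "residue_order TYPE('f)"
proof
  fix U :: "'f set"
  let ?q = "real (residue_order TYPE('f))"
  have q: "?q > 1" using residue_order_gt_1[where 'f='f] by simp
  show "open U \<longleftrightarrow> (\<forall>x\<in>U. \<exists>k::int. \<forall>y. absval (y - x) \<le> ?q powi k \<longrightarrow> y \<in> U)"
  proof
    assume "open U"
    show "\<forall>x\<in>U. \<exists>k::int. \<forall>y. absval (y - x) \<le> ?q powi k \<longrightarrow> y \<in> U"
    proof
      fix x assume "x \<in> U"
      then obtain e where e: "e > 0" "\<And>y. dist y x < e \<Longrightarrow> y \<in> U"
        using \<open>open U\<close> unfolding open_dist by blast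
      obtain m where "?q powi (0 - int m) < e" using powi_small[OF q e(1)] by blast
      then have "\<forall>y. absval (y - x) \<le> ?q powi (0 - int m) \<longrightarrow> y \<in> U"
        using e(2) by (auto simp: dist_absval)
      then show "\<exists>k::int. \<forall>y. absval (y - x) \<le> ?q powi k \<longrightarrow> y \<in> U" by blast
    qed
  next
    assume *: "\<forall>x\<in>U. \<exists>k::int. \<forall>y. absval (y - x) \<le> ?q powi k \<longrightarrow> y \<in> U"
    show "open U" unfolding open_dist
    proof
      fix x assume "x \<in> U"
      then obtain k :: int where "\<forall>y. absval (y - x) \<le> ?q powi k \<longrightarrow> y \<in> U" using * by blast
      then show "\<exists>e>0. \<forall>y. dist y x < e \<longrightarrow> y \<in> U"
        using q by (intro exI[of _ "?q powi k"]) (auto simp: dist_absval)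
    qed
  qed
qed (use residue_order_gt_1 absval_ultrametric absval_powi compact_absval_ball in auto)

lemma homogeneous_UNIV_F: "F.homogeneous 1 (UNIV :: 'f::nonarch_local_field set)"
  unfolding F.homogeneous_def F.num_balls_def F.bl_def
  using absval_ball_refine[where 'f='f] by simp

lemma vec_norm_nth: "absval (x $ i) \<le> vec_norm (x :: 'f::nonarch_local_field^'n::finite)"
  unfolding vec_norm_def by (rule Max_ge) auto

lemma vec_norm_le_iff: "vec_norm (x :: 'f::nonarch_local_field^'n::finite) \<le> r \<longleftrightarrow> (\<forall>i. absval (x $ i) \<le> r)"
  unfolding vec_norm_def by (subst Max_le_iff) auto

lemma vec_norm_attained: "\<exists>i. vec_norm (x :: 'f::nonarch_local_field^'n::finite) = absval (x $ i)"
proof -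
  have "Max (range (\<lambda>i. absval (x $ i))) \<in> range (\<lambda>i. absval (x $ i))" by (rule Max_in) auto
  then show ?thesis unfolding vec_norm_def by blast
qed

lemma finite_vec_components: "finite T \<Longrightarrow> finite {v :: 'a^'n::finite. \<forall>i. v $ i \<in> T}"
proof -
  assume "finite T"
  then have "finite (vec_lambda ` (Pi\<^sub>E (UNIV::'n set) (\<lambda>_. T)))" by (intro finite_imageI finite_PiE) auto
  moreover have "{v :: 'a^'n. \<forall>i. v $ i \<in> T} \<subseteq> vec_lambda ` (Pi\<^sub>E (UNIV::'n set) (\<lambda>_. T))"
  proof
    fix v :: "'a^'n" assume "v \<in> {v. \<forall>i. v $ i \<in> T}"
    then have "vec_nth v \<in> Pi\<^sub>E UNIV (\<lambda>_. T)" by auto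
    then show "v \<in> vec_lambda ` (Pi\<^sub>E UNIV (\<lambda>_. T))" by (metis image_eqI vec_nth_inverse)
  qed
  ultimately show ?thesis using finite_subset by blast
qed

text \<open>The topology of the vector type comes from a Euclidean combination of the coordinate
  distances. Together with the reverse estimate \<open>vec_norm_le_dist\<close> this shows that the
  maximum norm defines the same topology.\<close>

lemma dist_le_vec_norm: "dist x y \<le> real CARD('n) * vec_norm (x - y)"
  for x y :: "'f::nonarch_local_field^'n::finite"
proof -
  have "dist x y \<le> (\<Sum>i\<in>UNIV. dist (x $ i) (y $ i))"
    unfolding dist_vec_def by (rule L2_set_le_sum) simp
  also have "\<dots> \<le> (\<Sum>i\<in>(UNIV::'n set). vec_norm (x - y))"
    by (rule sum_mono) (metis dist_absval vec_norm_nth vector_minus_component)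
  finally show ?thesis by simp
qed

lemma vec_norm_le_dist: "vec_norm (x - y) \<le> dist x y"
  for x y :: "'f::nonarch_local_field^'n::finite"
  unfolding vec_norm_le_iff by (metis dist_absval dist_vec_nth_le vector_minus_component)

lemma compact_vec_norm_ball: "compact {y. vec_norm (y - x) \<le> real (residue_order TYPE('f)) powi k}"
  for x :: "'f::nonarch_local_field^'n::finite"
proof -
  let ?q = "real (residue_order TYPE('f))"
  let ?C = "{y. vec_norm (y - x) \<le> ?q powi k}"
  have q: "?q > 1" using residue_order_gt_1[where 'f='f] by simp
  have "?C = {y. \<forall>i. y $ i \<in> {z. absval (z - x $ i) \<le> ?q powi k}}"
    by (auto simp: vec_norm_le_iff)
  moreover have "closed {z. absval (z - x $ i) \<le> ?q powi k}" for i
    using compact_absval_ball compact_imp_closed by blast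
  ultimately have "closed ?C" using closed_vector_box[of "\<lambda>i. {z. absval (z - x $ i) \<le> ?q powi k}"] by simp
  then have "complete ?C" by (simp add: complete_eq_closed)
  moreover have "\<exists>T. finite T \<and> ?C \<subseteq> (\<Union>t\<in>T. ball t e)" if e: "e > 0" for e
  proof -
    have e': "e / real CARD('n) > 0" using e by simp
    obtain m where m: "?q powi (k - int m) < e / real CARD('n)" using powi_small[OF q e'] by blast
    have "\<forall>i. \<exists>T. finite T \<and> (\<forall>z. absval (z - x $ i) \<le> ?q powi k \<longrightarrow> (\<exists>t\<in>T. absval (z - t) \<le> ?q powi (k - int m)))"
      using absval_ball_finite_net by blast
    then obtain T where T: "\<And>i. finite (T i)"
      "\<And>i z. absval (z - x $ i) \<le> ?q powi k \<Longrightarrow> \<exists>t\<in>T i. absval (z - t) \<le> ?q powi (k - int m)" by metis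
    define V where "V = {v :: 'f^'n. \<forall>i. v $ i \<in> (\<Union>i. T i)}"
    have "finite V" unfolding V_def using T by (intro finite_vec_components) auto
    moreover have "?C \<subseteq> (\<Union>t\<in>V. ball t e)"
    proof
      fix y assume "y \<in> ?C"
      then have "\<forall>i. \<exists>t\<in>T i. absval (y $ i - t) \<le> ?q powi (k - int m)" using T(2) by (simp add: vec_norm_le_iff)
      then obtain t where t: "\<And>i. t i \<in> T i" "\<And>i. absval (y $ i - t i) \<le> ?q powi (k - int m)" by metis
      have "vec_norm (y - vec_lambda t) \<le> ?q powi (k - int m)" using t by (simp add: vec_norm_le_iff)
      then have "dist y (vec_lambda t) < e"
        using m dist_le_vec_norm[of y "vec_lambda t"] mult_left_mono[of _ _ "real CARD('n)"]
        by (smt (verit) less_divide_eq mult.commute of_nat_0_less_iff zero_less_card_finite)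
      moreover have "vec_lambda t \<in> V" using t by (auto simp: V_def)
      ultimately show "y \<in> (\<Union>t\<in>V. ball t e)" by (auto simp: dist_commute)
    qed
    ultimately show ?thesis by blast
  qed
  ultimately show ?thesis unfolding compact_eq_totally_bounded by blast
qed

global_interpretation V: ultranorm "vec_norm :: 'f::nonarch_local_field^'n::finite \<Rightarrow> real" "residue_order TYPE('f)"
proof
  let ?q = "real (residue_order TYPE('f))"
  have q: "?q > 1" using residue_order_gt_1[where 'f='f] by simp
  fix x y :: "'f^'n" and U :: "('f^'n) set" and k :: int
  have nonneg: "0 \<le> vec_norm x" by (metis absval_nonneg vec_norm_attained)
  show z: "vec_norm x = 0 \<longleftrightarrow> x = 0"
    using vec_norm_le_iff[of x 0] nonneg by (metis absval_nonneg absval_eq_0 dual_order.antisym order_refl vec_eq_iff zero_index)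
  show "vec_norm (- x) = vec_norm x" unfolding vec_norm_def by simp
  have "absval (x $ i + y $ i) \<le> max (vec_norm x) (vec_norm y)" for i
    using absval_ultrametric[of "x $ i" "y $ i"] vec_norm_nth[of x i] vec_norm_nth[of y i] by linarith
  then show "vec_norm (x + y) \<le> max (vec_norm x) (vec_norm y)" unfolding vec_norm_le_iff by simp
  show "\<exists>k::int. vec_norm x = ?q powi k" if "x \<noteq> 0"
    using vec_norm_attained[of x] that z absval_powi by (metis absval_eq_0)
  show "compact {y. vec_norm (y - x) \<le> ?q powi k}" by (rule compact_vec_norm_ball)
  show "open U \<longleftrightarrow> (\<forall>x\<in>U. \<exists>k::int. \<forall>y. vec_norm (y - x) \<le> ?q powi k \<longrightarrow> y \<in> U)"
  proof
    assume "open U"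
    show "\<forall>x\<in>U. \<exists>k::int. \<forall>y. vec_norm (y - x) \<le> ?q powi k \<longrightarrow> y \<in> U"
    proof
      fix x assume "x \<in> U"
      then obtain e where e: "e > 0" "\<And>y. dist y x < e \<Longrightarrow> y \<in> U"
        using \<open>open U\<close> unfolding open_dist by blast
      have "e / real CARD('n) > 0" using e by simp
      then obtain m where m: "?q powi (0 - int m) < e / real CARD('n)" using powi_small[OF q] by blast
      have "y \<in> U" if "vec_norm (y - x) \<le> ?q powi (0 - int m)" for y
      proof (rule e(2))
        have "vec_norm (y - x) < e / real CARD('n)" using that m by linarith
        then have "real CARD('n) * vec_norm (y - x) < e" by (simp add: field_simps)
        then show "dist y x < e" using dist_le_vec_norm[of y x] by linarith
      qed
      then show "\<exists>k::int. \<forall>y. vec_norm (y - x) \<le> ?q powi k \<longrightarrow> y \<in> U" by blast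
    qed
  next
    assume *: "\<forall>x\<in>U. \<exists>k::int. \<forall>y. vec_norm (y - x) \<le> ?q powi k \<longrightarrow> y \<in> U"
    show "open U" unfolding open_dist
    proof
      fix x assume "x \<in> U"
      then obtain k :: int where k: "\<forall>y. vec_norm (y - x) \<le> ?q powi k \<longrightarrow> y \<in> U" using * by blast
      have "y \<in> U" if "dist y x < ?q powi k" for y
        using k vec_norm_le_dist[of y x] that by (meson less_imp_le order_trans)
      then show "\<exists>e>0. \<forall>y. dist y x < e \<longrightarrow> y \<in> U"
        using q by (intro exI[of _ "?q powi k"]) auto
    qed
  qed
qed (use residue_order_gt_1 in auto)

subsection \<open>Haar measures and hyperplane measures\<close>

context ultranorm begin

lemma UN_bl_transversal:
  assumes "saturated k S A" "T \<subseteq> A" "\<forall>x\<in>A. \<exists>t\<in>T. x \<in> bl k t"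
  shows "A = (\<Union>t\<in>T. bl k t \<inter> S)"
proof
  show "A \<subseteq> (\<Union>t\<in>T. bl k t \<inter> S)" using assms unfolding saturated_def by auto
  show "(\<Union>t\<in>T. bl k t \<inter> S) \<subseteq> A" using assms unfolding saturated_def by auto
qed

lemma saturated_UN_bl: "saturated k S (\<Union>t\<in>T. bl k t \<inter> S)"
  unfolding saturated_def using bl_eq by auto

text \<open>The way to evaluate a content known only through its defining properties: equal masses
  on the small balls reduce it to a count.\<close>

lemma content_saturated:
  assumes \<mu>: "content_on (compact_opens S) \<mu>" and S: "closed S"
    and A: "saturated k S A" "A \<subseteq> bl N c" and v: "\<And>t. t \<in> A \<Longrightarrow> \<mu> (bl k t \<inter> S) = v"
  shows "\<mu> A = of_nat (num_balls k A) * v"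
proof -
  obtain T where T: "finite T" "T \<subseteq> A" "inj_on (bl k) T" "bl k ` T = bl k ` A"
    "\<forall>x\<in>A. \<exists>t\<in>T. x \<in> bl k t"
    using obtain_transversal[OF A(2)] .
  have A_eq: "A = (\<Union>t\<in>T. bl k t \<inter> S)" by (rule UN_bl_transversal[OF A(1) T(2,5)])
  have "\<mu> (\<Union>t\<in>T. bl k t \<inter> S) = (\<Sum>t\<in>T. \<mu> (bl k t \<inter> S))"
  proof (rule content_on_Union[OF \<mu> T(1) disjoint_bl_transversal[OF T(3)]])
    fix J assume "J \<subseteq> T"
    then have "(\<Union>t\<in>J. bl k t \<inter> S) \<subseteq> bl N c" using A_eq A(2) by blast
    then show "(\<Union>t\<in>J. bl k t \<inter> S) \<in> compact_opens S"
      by (rule saturated_compact_opens[OF S saturated_UN_bl])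
  qed
  also have "\<dots> = (\<Sum>t\<in>T. v)" using v T(2) by (intro sum.cong) auto
  also have "\<dots> = of_nat (num_balls k A) * v"
    using T(3,4) card_image[of "bl k" T] by (simp add: num_balls_def)
  finally show ?thesis using A_eq by simp
qed

lemma num_balls_Union:
  assumes "finite I" "disjoint_family_on A I" "\<And>i. i \<in> I \<Longrightarrow> saturated k S (A i)" "\<And>i. i \<in> I \<Longrightarrow> A i \<subseteq> bl N c"
  shows "num_balls k (\<Union>i\<in>I. A i) = (\<Sum>i\<in>I. num_balls k (A i))"
proof -
  have "bl k ` A i \<inter> bl k ` A j = {}" if "i \<in> I" "j \<in> I" "i \<noteq> j" for i j
  proof (rule ccontr)
    assume "\<not> ?thesis"
    then obtain a b where ab: "a \<in> A i" "b \<in> A j" "bl k b = bl k a" by auto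
    then have "b \<in> bl k a \<inter> S" using bl_eq_iff assms(3)[OF that(2)] by (auto simp: saturated_def)
    then have "b \<in> A i" using assms(3)[OF that(1)] ab(1) unfolding saturated_def by blast
    then show False using ab that assms(2) unfolding disjoint_family_on_def by blast
  qed
  moreover have "finite (bl k ` A i)" if "i \<in> I" for i
    using finite_bl_image[OF assms(4)[OF that]] .
  ultimately show ?thesis
    unfolding num_balls_def image_UN using assms(1) by (intro card_UN_disjoint) auto
qed

lemma bl_saturated: "saturated k S (bl j x \<inter> S)" if "k \<le> j"
proof -
  have "bl k y \<inter> S \<subseteq> bl j x \<inter> S" if "y \<in> bl j x \<inter> S" for y
    using that bl_mono[OF \<open>k \<le> j\<close>, of y] bl_eq[of y j x] by auto
  then show ?thesis unfolding saturated_def by auto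
qed

end

text \<open>\<open>haar\<close> is a choice, so a witness is needed before any of its properties can
  be used; it is the ball-counting content in dimension 1.\<close>

lemma content_on_haar: "content_on (compact_opens UNIV) (haar :: 'f::nonarch_local_field set \<Rightarrow> rat)"
  and haar_translate: "A \<in> compact_opens UNIV \<Longrightarrow> haar ((+) a ` A) = haar (A :: 'f set)"
  and haar_ring_of_integers: "haar (ring_of_integers :: 'f set) = 1"
proof -
  have R: "(ring_of_integers :: 'f set) = F.bl 0 0" by (auto simp: ring_of_integers_def F.bl_def)
  have "F.ball_content 1 (ring_of_integers :: 'f set) = 1"
    unfolding R using F.ball_content_ball[OF homogeneous_UNIV_F, of 0 0 0] by simp
  then have "\<exists>\<mu>. content_on (compact_opens UNIV) \<mu> \<and>
     (\<forall>a. \<forall>A\<in>compact_opens UNIV. \<mu> ((+) a ` A) = \<mu> A) \<and> \<mu> (ring_of_integers :: 'f set) = 1"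
    using F.content_on_ball_content[OF homogeneous_UNIV_F] F.ball_content_translate by blast
  from someI_ex[OF this, folded haar_def]
  show "content_on (compact_opens UNIV) (haar :: 'f set \<Rightarrow> rat)"
    "A \<in> compact_opens UNIV \<Longrightarrow> haar ((+) a ` A) = haar (A :: 'f set)"
    "haar (ring_of_integers :: 'f set) = 1" by auto
qed

text \<open>Uniqueness of Haar measure at the level of balls: translation invariance and the
  splitting into q subballs propagate the normalization on the ring of integers to all radii,
  upwards and downwards.\<close>

lemma haar_ball: "haar (F.bl k (a :: 'f::nonarch_local_field)) = of_nat (residue_order TYPE('f)) powi k"
proof -
  let ?q = "of_nat (residue_order TYPE('f)) :: rat"
  have q: "?q \<noteq> 0" using residue_order_gt_1[where 'f='f] by simp
  have co: "F.bl k a \<in> compact_opens UNIV" for k and a :: 'f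
    using F.bl_compact_opens[of UNIV k a] by simp
  have tr: "haar (F.bl k a) = haar (F.bl k (0::'f))" for k and a :: 'f
    using haar_translate[OF co[of k 0], of a] by (simp add: F.bl_translate)
  have step: "haar (F.bl k (0::'f)) = ?q * haar (F.bl (k - 1) (0::'f))" for k
  proof -
    have "haar (F.bl k (0::'f)) = of_nat (F.num_balls (k - 1) (F.bl k (0::'f))) * haar (F.bl (k - 1) (0::'f))"
    proof (rule F.content_saturated[OF content_on_haar closed_UNIV _ order_refl])
      show "F.saturated (k - 1) UNIV (F.bl k (0::'f))" using F.bl_saturated[of "k - 1" k UNIV 0] by simp
      show "haar (F.bl (k - 1) t \<inter> UNIV) = haar (F.bl (k - 1) (0::'f))" for t :: 'f
        using tr[of "k - 1" t] by simp
    qed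
    moreover have "F.num_balls (k - 1) (F.bl k (0::'f)) = residue_order TYPE('f)"
      using homogeneous_UNIV_F[where 'f='f] unfolding F.homogeneous_def by simp
    ultimately show ?thesis by simp
  qed
  have "F.bl 0 0 = (ring_of_integers :: 'f set)" by (auto simp: ring_of_integers_def F.bl_def)
  then have h0: "haar (F.bl 0 (0::'f)) = 1" by (simp add: haar_ring_of_integers)
  have "haar (F.bl k (0::'f)) = ?q powi k"
  proof (induction k rule: int_induct[where k=0])
    case (step1 i)
    then show ?case using step[of "i + 1"] q by (simp add: power_int_add)
  next
    case (step2 i)
    then show ?case using step[of i] q by (simp add: power_int_diff field_simps)
  qed (use h0 in simp)
  then show ?thesis using tr[of k a] by simp
qed

lemma haar_saturated:
  fixes A :: "'f::nonarch_local_field set"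
  assumes "F.saturated k UNIV A" "A \<subseteq> F.bl N c"
  shows "haar A = of_nat (F.num_balls k A) * of_nat (residue_order TYPE('f)) powi k"
  by (rule F.content_saturated[OF content_on_haar _ assms]) (simp_all add: haar_ball)

lemma V_bl_box: "V.bl k x = {y. \<forall>i. y $ i \<in> F.bl k (x $ i)}" for x :: "'f::nonarch_local_field^'n::finite"
  by (auto simp: V.bl_def F.bl_def vec_norm_le_iff)

text \<open>Balls of the maximum norm are boxes of balls, and a box with nonempty sides determines
  its sides, so the balls meeting a box correspond to tuples of balls meeting its sides.\<close>

lemma num_balls_box:
  fixes A :: "'n::finite \<Rightarrow> 'f::nonarch_local_field set"
  shows "V.num_balls k {x. \<forall>i. x $ i \<in> A i} = (\<Prod>i\<in>UNIV. F.num_balls k (A i))"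
proof -
  define \<Phi> where "\<Phi> = (\<lambda>B. {y :: 'f^'n. \<forall>i. y $ i \<in> B i})"
  define P where "P = Pi\<^sub>E (UNIV :: 'n set) (\<lambda>i. F.bl k ` A i)"
  have "V.bl k ` {x. \<forall>i. x $ i \<in> A i} = \<Phi> ` P"
  proof (intro equalityI subsetI)
    fix B assume "B \<in> V.bl k ` {x. \<forall>i. x $ i \<in> A i}"
    then obtain x where x: "\<forall>i. x $ i \<in> A i" "B = V.bl k x" by auto
    then have "B = \<Phi> (\<lambda>i. F.bl k (x $ i))" "(\<lambda>i. F.bl k (x $ i)) \<in> P"
      by (auto simp: \<Phi>_def P_def V_bl_box)
    then show "B \<in> \<Phi> ` P" by blast
  next
    fix B assume "B \<in> \<Phi> ` P"
    then obtain C where C: "C \<in> P" "B = \<Phi> C" by auto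
    then have "\<forall>i. \<exists>a. a \<in> A i \<and> C i = F.bl k a" by (auto simp: P_def PiE_iff)
    then obtain a where a: "\<And>i. a i \<in> A i" "\<And>i. C i = F.bl k (a i)" by metis
    then have "B = V.bl k (vec_lambda a)" using C by (simp add: \<Phi>_def V_bl_box)
    then show "B \<in> V.bl k ` {x. \<forall>i. x $ i \<in> A i}" using a by simp
  qed
  moreover have "inj_on \<Phi> P"
  proof (rule inj_onI)
    fix C D assume CD: "C \<in> P" "D \<in> P" "\<Phi> C = \<Phi> D"
    have ne: "\<exists>a. a \<in> C' i" if "C' \<in> P" for C' i
    proof -
      have "C' i \<in> F.bl k ` A i" using that by (auto simp: P_def PiE_iff)
      then show ?thesis using F.bl_refl by blast
    qed
    have sub: "C' i \<subseteq> D' i" if \<Phi>_eq: "\<Phi> C' = \<Phi> D'" and inh: "\<forall>i. \<exists>a. a \<in> C' i" for C' D' i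
    proof
      fix z assume z: "z \<in> C' i"
      obtain a where "\<And>j. a j \<in> C' j" using inh by metis
      then have "(\<chi> j. if j = i then z else a j) \<in> \<Phi> C'" using z by (simp add: \<Phi>_def)
      then have "(\<chi> j. if j = i then z else a j) \<in> \<Phi> D'" using \<Phi>_eq by simp
      then show "z \<in> D' i" unfolding \<Phi>_def by (auto dest: spec[of _ i])
    qed
    have "C i = D i" for i using sub[of C D i] sub[of D C i] CD ne[of C] ne[of D] by auto
    then show "C = D" by auto
  qed
  ultimately show ?thesis
    unfolding V.num_balls_def F.num_balls_def by (simp add: card_image P_def card_PiE)
qed

lemma homogeneous_UNIV_V: "V.homogeneous CARD('n) (UNIV :: ('f::nonarch_local_field^'n::finite) set)"
  unfolding V.homogeneous_def
proof (intro conjI allI ballI)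
  fix k and x :: "'f^'n"
  have "F.num_balls (k - 1) (F.bl k (x $ i)) = residue_order TYPE('f)" for i
    using homogeneous_UNIV_F[where 'f='f] unfolding F.homogeneous_def by simp
  then show "V.num_balls (k - 1) (V.bl k x \<inter> UNIV) = residue_order TYPE('f) ^ CARD('n)"
    unfolding V_bl_box by (simp add: num_balls_box)
qed simp

lemma content_on_haar_vec: "content_on (compact_opens UNIV) (haar_vec :: ('f::nonarch_local_field^'n::finite) set \<Rightarrow> rat)"
  and haar_vec_box: "(\<And>i. A i \<in> compact_opens UNIV) \<Longrightarrow> haar_vec {x :: 'f^'n. \<forall>i. x $ i \<in> A i} = (\<Prod>i\<in>UNIV. haar (A i))"
proof -
  have box: "V.ball_content CARD('n) {x :: 'f^'n. \<forall>i. x $ i \<in> A i} = (\<Prod>i\<in>UNIV. haar (A i))"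
    if A: "\<And>i. A i \<in> compact_opens UNIV" for A
  proof -
    have "\<forall>i. \<exists>k N. F.saturated k UNIV (A i) \<and> A i \<subseteq> F.bl N 0"
      using F.compact_opens_saturated[OF A] by metis
    then obtain k N where kN: "\<And>i. F.saturated (k i) UNIV (A i)" "\<And>i. A i \<subseteq> F.bl (N i) 0" by metis
    define l where "l = Min (range k)"
    define M where "M = Max (range N)"
    have l: "l \<le> k i" and M: "N i \<le> M" for i unfolding l_def M_def by auto
    have A': "F.saturated l UNIV (A i)" "A i \<subseteq> F.bl M 0" for i
      using F.saturated_mono[OF kN(1) l] kN(2)[of i] F.bl_mono[OF M, of i 0] by auto
    have sat: "V.saturated l UNIV {x :: 'f^'n. \<forall>i. x $ i \<in> A i}"
      unfolding V.saturated_def V_bl_box using A'(1) unfolding F.saturated_def by blast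
    have bd: "{x :: 'f^'n. \<forall>i. x $ i \<in> A i} \<subseteq> V.bl M 0"
      unfolding V_bl_box using A'(2) by auto
    show ?thesis
      unfolding V.ball_content_eq[OF homogeneous_UNIV_V sat bd] num_balls_box haar_saturated[OF A']
      by (simp add: prod.distrib power_int_power' mult.commute)
  qed
  have "\<exists>\<mu>. content_on (compact_opens UNIV) \<mu> \<and>
     (\<forall>A. (\<forall>i. A i \<in> compact_opens UNIV) \<longrightarrow>
        \<mu> {x :: 'f^'n. \<forall>i. x $ i \<in> A i} = (\<Prod>i\<in>UNIV. haar (A i)))"
    using V.content_on_ball_content[OF homogeneous_UNIV_V] box by blast
  from someI_ex[OF this, folded haar_vec_def]
  show "content_on (compact_opens UNIV) (haar_vec :: ('f^'n) set \<Rightarrow> rat)"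
    "(\<And>i. A i \<in> compact_opens UNIV) \<Longrightarrow> haar_vec {x :: 'f^'n. \<forall>i. x $ i \<in> A i} = (\<Prod>i\<in>UNIV. haar (A i))"
    by blast+
qed

lemma haar_vec_ball: "haar_vec (V.bl k (a :: 'f::nonarch_local_field^'n::finite)) = of_nat (residue_order TYPE('f)) powi (int CARD('n) * k)"
proof -
  have "F.bl k x \<in> compact_opens UNIV" for x :: 'f
    using F.bl_compact_opens[of UNIV k x] by simp
  then show ?thesis unfolding V_bl_box
    by (subst haar_vec_box) (auto simp: haar_ball power_int_power' mult.commute)
qed

section \<open>The scalar product and its hyperplanes\<close>

lemma absval_sum_le:
  assumes "0 \<le> r" "\<And>i. i \<in> S \<Longrightarrow> absval (f i) \<le> r"
  shows "absval (\<Sum>i\<in>S. f i :: 'f::nonarch_local_field) \<le> r"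
  using assms
proof (induction S rule: infinite_finite_induct)
  case (insert x F)
  then show ?case using F.nrm_add_le[of "f x" r "sum f F"] by simp
qed auto

lemma scalar_product_add: "scalar_product \<xi> (x + y) = scalar_product \<xi> x + scalar_product \<xi> (y :: 'f::nonarch_local_field^'n::finite)"
  and scalar_product_diff: "scalar_product \<xi> (x - y) = scalar_product \<xi> x - scalar_product \<xi> y"
  and scalar_product_add_left: "scalar_product (x + y) \<xi> = scalar_product x \<xi> + scalar_product y \<xi>"
  and scalar_product_diff_left: "scalar_product (x - y) \<xi> = scalar_product x \<xi> - scalar_product y \<xi>"
  and scalar_product_scale_left: "scalar_product (c *s x) \<xi> = c * scalar_product x \<xi>"
  and scalar_product_axis: "scalar_product \<xi> (axis i c) = \<xi> $ i * c"
  and scalar_product_commute: "scalar_product x y = scalar_product y x"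
  by (simp_all add: scalar_product_def algebra_simps sum.distrib sum_subtractf sum_distrib_left axis_def if_distrib sum.delta cong: if_cong)

lemma scalar_product_zero [simp]: "scalar_product x 0 = 0" "scalar_product 0 x = 0"
  for x :: "'f::nonarch_local_field^'n::finite"
  by (simp_all add: scalar_product_def)

lemma absval_scalar_product: "absval (scalar_product x y) \<le> vec_norm x * vec_norm y"
  for x y :: "'f::nonarch_local_field^'n::finite"
  unfolding scalar_product_def
  by (rule absval_sum_le) (auto simp: absval_mult intro!: mult_mono vec_norm_nth)

lemma vec_norm_axis: "vec_norm (axis i c :: 'f::nonarch_local_field^'n::finite) = absval c"
proof (rule antisym)
  show "vec_norm (axis i c :: 'f^'n) \<le> absval c" unfolding vec_norm_le_iff by (auto simp: axis_def)
  show "absval c \<le> vec_norm (axis i c :: 'f^'n)" using vec_norm_nth[of "axis i c :: 'f^'n" i] by (simp add: axis_def)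
qed

lemma vec_norm_scale: "vec_norm (c *s x) = absval c * vec_norm (x :: 'f::nonarch_local_field^'n::finite)"
proof (rule antisym)
  show "vec_norm (c *s x) \<le> absval c * vec_norm x" unfolding vec_norm_le_iff
    by (auto simp: absval_mult intro!: mult_left_mono vec_norm_nth)
  obtain i where "vec_norm x = absval (x $ i)" using vec_norm_attained by blast
  then show "absval c * vec_norm x \<le> vec_norm (c *s x)" using vec_norm_nth[of "c *s x" i] by (simp add: absval_mult)
qed

lemma scalar_product_bl:
  assumes "\<xi> \<noteq> 0" "y \<in> V.bl k x"
  shows "scalar_product \<xi> y \<in> F.bl (k + V.lev \<xi>) (scalar_product \<xi> (x :: 'f::nonarch_local_field^'n::finite))"
proof -
  have "absval (scalar_product \<xi> y - scalar_product \<xi> x) \<le> vec_norm \<xi> * vec_norm (y - x)"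
    using absval_scalar_product[of \<xi> "y - x"] by (simp add: scalar_product_diff)
  also have "\<dots> \<le> real (residue_order TYPE('f)) powi V.lev \<xi> * real (residue_order TYPE('f)) powi k"
    using assms(2) V.nrm_lev[OF assms(1)] by (simp add: V.bl_def mult_left_mono)
  also have "\<dots> = real (residue_order TYPE('f)) powi (k + V.lev \<xi>)"
    using residue_order_gt_1[where 'f='f] by (simp add: power_int_add)
  finally show ?thesis by (simp add: F.bl_def)
qed

lemma ex_max_coordinate: 
  assumes "(\<xi> :: 'f::nonarch_local_field^'n::finite) \<noteq> 0"
  obtains i where "\<xi> $ i \<noteq> 0" "absval (\<xi> $ i) = vec_norm \<xi>" "F.lev (\<xi> $ i) = V.lev \<xi>"
proof -
  obtain i where i: "absval (\<xi> $ i) = vec_norm \<xi>" using vec_norm_attained[of \<xi>] by metis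
  then have "\<xi> $ i \<noteq> 0" using assms V.nrm_eq_0[of \<xi>] by auto
  moreover have "F.lev (\<xi> $ i) = V.lev \<xi>" using i V.nrm_lev[OF assms] by (intro F.lev_eqI) simp
  ultimately show thesis using that i by blast
qed

text \<open>A right inverse of the form x \<mapsto> \<xi> \<cdot> x: the shift is made along a
  coordinate where \<open>\<xi>\<close> is largest, so its norm is |s| / |\<xi>|, the least
  possible.\<close>

lemma ex_scalar_product_shift:
  assumes "(\<xi> :: 'f::nonarch_local_field^'n::finite) \<noteq> 0"
  obtains u where "\<And>s. scalar_product \<xi> (u s) = s" "\<And>s k. s \<in> F.bl (k + V.lev \<xi>) 0 \<Longrightarrow> u s \<in> V.bl k 0"
proof -
  obtain i where i: "\<xi> $ i \<noteq> 0" "absval (\<xi> $ i) = vec_norm \<xi>" using ex_max_coordinate[OF assms] by metis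
  define u :: "'f \<Rightarrow> 'f^'n" where "u = (\<lambda>s. axis i (s / \<xi> $ i))"
  have "u s \<in> V.bl k 0" if "s \<in> F.bl (k + V.lev \<xi>) 0" for s k
  proof -
    let ?q = "real (residue_order TYPE('f))"
    have q: "?q > 1" using residue_order_gt_1[where 'f='f] by simp
    have "absval s \<le> ?q powi k * ?q powi V.lev \<xi>" using that q by (simp add: F.bl_def power_int_add)
    then have "absval s / ?q powi V.lev \<xi> \<le> ?q powi k" using q by (simp add: field_simps)
    then show ?thesis
      by (simp add: V.bl_def u_def vec_norm_axis absval_divide i(2) V.nrm_lev[OF assms])
  qed
  then show thesis using that[of u] i(1) by (simp add: u_def scalar_product_axis)
qed

lemma closed_hyperplane: "closed (hyperplane \<xi> t)" for \<xi> :: "'f::nonarch_local_field^'n::finite"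
proof (cases "\<xi> = 0")
  case True
  then show ?thesis by (cases "t = 0") (auto simp: hyperplane_def)
next
  case False
  have "open (- hyperplane \<xi> t)"
    unfolding V.open_iff
  proof
    fix x assume "x \<in> - hyperplane \<xi> t"
    then have ne: "scalar_product \<xi> x - t \<noteq> 0" by (simp add: hyperplane_def)
    define l where "l = F.lev (scalar_product \<xi> x - t) - V.lev \<xi> - 1"
    have "y \<in> - hyperplane \<xi> t" if "y \<in> V.bl l x" for y
    proof
      assume "y \<in> hyperplane \<xi> t"
      then have "scalar_product \<xi> x - t = scalar_product \<xi> x - scalar_product \<xi> y" by (simp add: hyperplane_def)
      moreover have "scalar_product \<xi> x \<in> F.bl (l + V.lev \<xi>) (scalar_product \<xi> y)"
        using scalar_product_bl[OF False that] F.bl_sym by blast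
      ultimately show False using ne by (auto simp: F.mem_bl l_def)
    qed
    then show "\<exists>k::int. \<forall>y. vec_norm (y - x) \<le> real (residue_order TYPE('f)) powi k \<longrightarrow> y \<in> - hyperplane \<xi> t"
      unfolding V.bl_def by blast
  qed
  then show ?thesis by (simp add: closed_def)
qed

text \<open>The form maps a ball of radius q^k onto a ball of radius q^k |\<xi>|; surjectivity uses
  the economical shift of \<open>ex_scalar_product_shift\<close>.\<close>

lemma bl_meets_hyperplane:
  fixes \<xi> :: "'f::nonarch_local_field^'n::finite"
  assumes "\<xi> \<noteq> 0"
  shows "V.bl k x \<inter> hyperplane \<xi> t \<noteq> {} \<longleftrightarrow> t \<in> F.bl (k + V.lev \<xi>) (scalar_product \<xi> x)"
proof
  assume "V.bl k x \<inter> hyperplane \<xi> t \<noteq> {}"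
  then obtain y where "y \<in> V.bl k x" "scalar_product \<xi> y = t" by (auto simp: hyperplane_def)
  then show "t \<in> F.bl (k + V.lev \<xi>) (scalar_product \<xi> x)" using scalar_product_bl[OF assms] by blast
next
  assume t: "t \<in> F.bl (k + V.lev \<xi>) (scalar_product \<xi> x)"
  obtain u where u: "\<And>s. scalar_product \<xi> (u s) = s" "\<And>s k. s \<in> F.bl (k + V.lev \<xi>) 0 \<Longrightarrow> u s \<in> V.bl k 0"
    using ex_scalar_product_shift[OF assms] by blast
  have "x + u (t - scalar_product \<xi> x) \<in> V.bl k x"
    using u(2)[of "t - scalar_product \<xi> x" k] t by (simp add: V.bl_def F.bl_def)
  moreover have "x + u (t - scalar_product \<xi> x) \<in> hyperplane \<xi> t"
    by (simp add: hyperplane_def scalar_product_add u(1))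
  ultimately show "V.bl k x \<inter> hyperplane \<xi> t \<noteq> {}" by blast
qed

text \<open>A ball about a point of the hyperplane is cut by the value of the form into q thick
  slices, which are translates of each other. So each contains q^(n-1) of the q^n subballs, and the
  subballs of the slice at \<open>t\<close> are exactly those that meet the hyperplane.\<close>

lemma homogeneous_hyperplane:
  fixes \<xi> :: "'f::nonarch_local_field^'n::finite"
  assumes "\<xi> \<noteq> 0"
  shows "V.homogeneous (CARD('n) - 1) (hyperplane \<xi> t)"
  unfolding V.homogeneous_def
proof (intro conjI allI ballI closed_hyperplane)
  fix k x assume x: "x \<in> hyperplane \<xi> t"
  let ?q = "residue_order TYPE('f)"
  define l where "l = V.lev \<xi>"
  \<comment> \<open>The slices are one step thinner than the range of the form on the ball, yet
    thick enough to be unions of balls of radius q^(k-1).\<close>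
  define Y where "Y = (\<lambda>s. {y \<in> V.bl k x. scalar_product \<xi> y \<in> F.bl (k - 1 + l) s})"
  have xt: "scalar_product \<xi> x = t" using x by (simp add: hyperplane_def)
  obtain u where u: "\<And>s. scalar_product \<xi> (u s) = s" "\<And>s k. s \<in> F.bl (k + l) 0 \<Longrightarrow> u s \<in> V.bl k 0"
    using ex_scalar_product_shift[OF assms] unfolding l_def by blast
  obtain T where T: "finite T" "T \<subseteq> F.bl (k + l) t" "inj_on (F.bl (k - 1 + l)) T"
    "F.bl (k - 1 + l) ` T = F.bl (k - 1 + l) ` F.bl (k + l) t"
    "\<forall>s\<in>F.bl (k + l) t. \<exists>t'\<in>T. s \<in> F.bl (k - 1 + l) t'"
    using F.obtain_transversal[OF order_refl, of "k + l" t "k - 1 + l"] .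
  have cardT: "card T = ?q"
  proof -
    have "card T = F.num_balls (k + l - 1) (F.bl (k + l) t)"
      unfolding F.num_balls_def using T(4) card_image[OF T(3)] by (simp add: algebra_simps)
    then show ?thesis using homogeneous_UNIV_F[where 'f='f] unfolding F.homogeneous_def by simp
  qed
  have sat: "V.saturated (k - 1) UNIV (Y s)" for s
  proof -
    have "z \<in> Y s" if "y \<in> Y s" "z \<in> V.bl (k - 1) y" for y z
    proof -
      have "z \<in> V.bl k x" using that V.bl_mono[of "k - 1" k y] V.bl_eq[of y k x] by (auto simp: Y_def)
      moreover have "scalar_product \<xi> z \<in> F.bl (k - 1 + l) s"
        using scalar_product_bl[OF assms that(2)] that(1) F.bl_eq[of "scalar_product \<xi> y" "k - 1 + l" s]
        by (auto simp: Y_def l_def)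
      ultimately show ?thesis by (simp add: Y_def)
    qed
    then show ?thesis unfolding V.saturated_def by blast
  qed
  have un: "V.bl k x = (\<Union>s\<in>T. Y s)"
  proof (intro equalityI subsetI)
    fix y assume y: "y \<in> V.bl k x"
    then have "scalar_product \<xi> y \<in> F.bl (k + l) t" using scalar_product_bl[OF assms y] xt by (simp add: l_def)
    then show "y \<in> (\<Union>s\<in>T. Y s)" using T(5) y by (auto simp: Y_def)
  qed (auto simp: Y_def)
  have disj: "disjoint_family_on Y T"
    unfolding disjoint_family_on_def
  proof (intro ballI impI)
    fix s s' assume "s \<in> T" "s' \<in> T" "s \<noteq> s'"
    then have "F.bl (k - 1 + l) s \<inter> F.bl (k - 1 + l) s' = {}"
      using F.bl_disjoint T(3) unfolding inj_on_def by blast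
    then show "Y s \<inter> Y s' = {}" unfolding Y_def by blast
  qed
  have tr: "V.num_balls (k - 1) (Y s) = V.num_balls (k - 1) (Y t)" if s: "s \<in> F.bl (k + l) t" for s
  proof -
    have us: "u (s - t) \<in> V.bl k 0" using s by (intro u(2)) (simp add: F.bl_def)
    have "Y s = (+) (u (s - t)) ` Y t"
    proof (intro equalityI subsetI)
      fix y assume "y \<in> Y s"
      then have y: "y \<in> V.bl k x" "scalar_product \<xi> y \<in> F.bl (k - 1 + l) s" by (auto simp: Y_def)
      have "y - u (s - t) \<in> V.bl k x"
        using V.nrm_diff_le[of "y - x" _ "u (s - t)"] y us by (simp add: V.bl_def algebra_simps)
      moreover have "scalar_product \<xi> (y - u (s - t)) \<in> F.bl (k - 1 + l) t"
        using y by (simp add: scalar_product_diff u(1) F.bl_def algebra_simps)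
      ultimately have "y - u (s - t) \<in> Y t" by (simp add: Y_def)
      then show "y \<in> (+) (u (s - t)) ` Y t" by (metis add.commute diff_add_cancel image_eqI)
    next
      fix y assume "y \<in> (+) (u (s - t)) ` Y t"
      then obtain z where z: "z \<in> V.bl k x" "scalar_product \<xi> z \<in> F.bl (k - 1 + l) t" "y = u (s - t) + z" by (auto simp: Y_def)
      have "y \<in> V.bl k x"
        using V.nrm_add_le[of "z - x" _ "u (s - t)"] z us by (simp add: V.bl_def algebra_simps)
      moreover have "scalar_product \<xi> y \<in> F.bl (k - 1 + l) s"
        using z by (simp add: scalar_product_add u(1) F.bl_def algebra_simps)
      ultimately show "y \<in> Y s" by (simp add: Y_def)
    qed
    then show ?thesis by (simp add: V.num_balls_translate)
  qed
  have "V.num_balls (k - 1) (V.bl k x) = (\<Sum>s\<in>T. V.num_balls (k - 1) (Y s))"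
    unfolding un by (rule V.num_balls_Union[OF T(1) disj sat]) (auto simp: Y_def)
  also have "\<dots> = (\<Sum>s\<in>T. V.num_balls (k - 1) (Y t))"
    by (intro sum.cong refl tr) (use T(2) in blast)
  also have "\<dots> = ?q * V.num_balls (k - 1) (Y t)" using cardT by simp
  finally have eq: "?q ^ CARD('n) = ?q * V.num_balls (k - 1) (Y t)"
    using homogeneous_UNIV_V[where 'f='f and 'n='n] unfolding V.homogeneous_def by simp
  have "?q * ?q ^ (CARD('n) - 1) = ?q ^ CARD('n)" by (simp add: power_eq_if)
  then have "V.num_balls (k - 1) (Y t) = ?q ^ (CARD('n) - 1)"
    using eq residue_order_gt_1[where 'f='f] by (metis mult_cancel1 not_less_zero)
  moreover have "V.bl (k - 1) ` Y t = V.bl (k - 1) ` (V.bl k x \<inter> hyperplane \<xi> t)"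
  proof (intro equalityI subsetI)
    fix B assume "B \<in> V.bl (k - 1) ` Y t"
    then obtain y where y: "y \<in> V.bl k x" "scalar_product \<xi> y \<in> F.bl (k - 1 + l) t" "B = V.bl (k - 1) y" by (auto simp: Y_def)
    then have "t \<in> F.bl (k - 1 + l) (scalar_product \<xi> y)" using F.bl_sym by blast
    then obtain z where z: "z \<in> V.bl (k - 1) y" "z \<in> hyperplane \<xi> t"
      using bl_meets_hyperplane[OF assms, of "k - 1" y t] by (auto simp: l_def)
    then have "z \<in> V.bl k x" using V.bl_mono[of "k - 1" k y] V.bl_eq[OF y(1)] by auto
    moreover have "B = V.bl (k - 1) z" using V.bl_eq[OF z(1)] y(3) by simp
    ultimately show "B \<in> V.bl (k - 1) ` (V.bl k x \<inter> hyperplane \<xi> t)" using z by blast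
  next
    fix B assume "B \<in> V.bl (k - 1) ` (V.bl k x \<inter> hyperplane \<xi> t)"
    then show "B \<in> V.bl (k - 1) ` Y t" by (auto simp: Y_def hyperplane_def)
  qed
  ultimately show "V.num_balls (k - 1) (V.bl k x \<inter> hyperplane \<xi> t) = residue_order TYPE('f) ^ (CARD('n) - 1)"
    by (simp add: V.num_balls_def)
qed


lemma hyperplane_translate:
  "(+) a ` hyperplane \<xi> t = hyperplane \<xi> (scalar_product \<xi> a + t)" for \<xi> :: "'f::nonarch_local_field^'n::finite"
proof (intro equalityI subsetI)
  fix y assume "y \<in> hyperplane \<xi> (scalar_product \<xi> a + t)"
  then have "y - a \<in> hyperplane \<xi> t" by (simp add: hyperplane_def scalar_product_diff)
  then show "y \<in> (+) a ` hyperplane \<xi> t" by (metis add.commute diff_add_cancel image_eqI)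
qed (auto simp: hyperplane_def scalar_product_add)

lemma saturated_Int: "V.saturated k UNIV A \<Longrightarrow> V.saturated k S (A \<inter> S)"
  unfolding V.saturated_def by blast

lemma hyperplane_measure_exists:
  fixes \<xi> :: "'f::nonarch_local_field^'n::finite"
  assumes \<xi>: "\<xi> \<noteq> 0"
  shows "\<exists>\<mu>. (\<forall>t. content_on (compact_opens (hyperplane \<xi> t)) \<mu>) \<and>
     (\<forall>t. \<forall>A\<in>compact_opens (hyperplane \<xi> t). \<forall>a. \<mu> ((+) a ` A) = \<mu> A) \<and>
     (\<forall>A\<in>compact_opens UNIV. integ haar (\<lambda>t. \<mu> (A \<inter> hyperplane \<xi> t)) = haar_vec A)"
proof -
  let ?q = "of_nat (residue_order TYPE('f)) :: rat"
  have q: "?q \<noteq> 0" "?q > 0" using residue_order_gt_1[where 'f='f] by auto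
  define d where "d = CARD('n) - 1"
  have d: "int CARD('n) = int d + 1" unfolding d_def by simp
  \<comment> \<open>The factor balances d\<mu> dt = dx on a ball of radius q^k: the form takes
    values in a ball of measure q^(k + lev \<xi>), and every fibre carries q^((n-1) k - lev
    \<xi>).\<close>
  define \<mu> :: "('f^'n) set \<Rightarrow> rat" where "\<mu> = (\<lambda>A. V.ball_content d A * ?q powi (- V.lev \<xi>))"
  have hom: "V.homogeneous d (hyperplane \<xi> t)" for t
    unfolding d_def by (rule homogeneous_hyperplane[OF \<xi>])
  have cont: "content_on (compact_opens (hyperplane \<xi> t)) \<mu>" for t
    using V.content_on_ball_content[OF hom[of t]] q unfolding content_on_def \<mu>_def
    by (simp add: distrib_right)
  have tr: "\<mu> ((+) a ` A) = \<mu> A" for a A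
    unfolding \<mu>_def V.ball_content_translate ..
  have ball: "\<mu> (V.bl k b \<inter> hyperplane \<xi> t) =
      (if t \<in> F.bl (k + V.lev \<xi>) (scalar_product \<xi> b) then ?q powi (int d * k - V.lev \<xi>) else 0)" for k b t
  proof (cases "t \<in> F.bl (k + V.lev \<xi>) (scalar_product \<xi> b)")
    case True
    then obtain x where "x \<in> V.bl k b" "x \<in> hyperplane \<xi> t" using bl_meets_hyperplane[OF \<xi>] by blast
    then show ?thesis using True V.ball_content_ball[OF hom] q by (simp add: \<mu>_def power_int_diff power_int_minus field_simps)
  next
    case False
    then have "V.bl k b \<inter> hyperplane \<xi> t = {}" using bl_meets_hyperplane[OF \<xi>] by blast
    moreover have "V.ball_content d ({} :: ('f^'n) set) = 0"
      by (rule V.ball_content_eqI[of 0]) (simp add: V.num_balls_def)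
    ultimately show ?thesis using False by (simp add: \<mu>_def)
  qed
  have "integ haar (\<lambda>t. \<mu> (A \<inter> hyperplane \<xi> t)) = haar_vec A" if A: "A \<in> compact_opens UNIV" for A
  proof -
    obtain k N where kN: "V.saturated k UNIV A" "A \<subseteq> V.bl N 0" using V.compact_opens_saturated[OF A] .
    obtain T where T: "finite T" "T \<subseteq> A" "inj_on (V.bl k) T" "V.bl k ` T = V.bl k ` A"
      "\<forall>x\<in>A. \<exists>t\<in>T. x \<in> V.bl k t"
      using V.obtain_transversal[OF kN(2)] .
    have A_eq: "A = (\<Union>t\<in>T. V.bl k t)" using V.UN_bl_transversal[OF kN(1) T(2,5)] by simp
    have 1: "\<mu> (A \<inter> hyperplane \<xi> t) = (\<Sum>b\<in>T. 1 *
      (if t \<in> F.bl (k + V.lev \<xi>) (scalar_product \<xi> b) then ?q powi (int d * k - V.lev \<xi>) else 0))" for t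
    proof -
      have "\<mu> (\<Union>b\<in>T. V.bl k b \<inter> hyperplane \<xi> t) = (\<Sum>b\<in>T. \<mu> (V.bl k b \<inter> hyperplane \<xi> t))"
      proof (rule content_on_Union[OF cont T(1) V.disjoint_bl_transversal[OF T(3)]])
        fix J assume "J \<subseteq> T"
        then have "(\<Union>b\<in>J. V.bl k b \<inter> hyperplane \<xi> t) \<subseteq> V.bl N 0" using A_eq kN(2) by blast
        then show "(\<Union>b\<in>J. V.bl k b \<inter> hyperplane \<xi> t) \<in> compact_opens (hyperplane \<xi> t)"
          by (rule V.saturated_compact_opens[OF closed_hyperplane V.saturated_UN_bl])
      qed
      moreover have "A \<inter> hyperplane \<xi> t = (\<Union>b\<in>T. V.bl k b \<inter> hyperplane \<xi> t)"
        unfolding A_eq Int_UN_distrib2 by simp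
      ultimately show ?thesis by (simp only: ball mult_1)
    qed
    have co: "F.bl j x \<in> compact_opens UNIV" for j and x :: 'f
      using F.bl_compact_opens[of UNIV j x] by simp
    have "integ haar (\<lambda>t. \<mu> (A \<inter> hyperplane \<xi> t)) = (\<Sum>b\<in>T. 1 * integ haar (\<lambda>t.
       if t \<in> F.bl (k + V.lev \<xi>) (scalar_product \<xi> b) then ?q powi (int d * k - V.lev \<xi>) else 0))"
      unfolding 1 by (rule F.integ_sum[OF content_on_haar closed_UNIV T(1) F.indicator_schwartz[OF co]])
    also have "\<dots> = (\<Sum>b\<in>T. ?q powi (int CARD('n) * k))"
    proof (intro sum.cong refl)
      fix b assume "b \<in> T"
      have "1 * integ haar (\<lambda>t. if t \<in> F.bl (k + V.lev \<xi>) (scalar_product \<xi> b) then ?q powi (int d * k - V.lev \<xi>) else 0)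
        = ?q powi (int d * k - V.lev \<xi>) * ?q powi (k + V.lev \<xi>)"
        by (simp add: F.integ_indicator[OF content_on_haar co] haar_ball)
      also have "\<dots> = ?q powi (int CARD('n) * k)"
        using q by (simp add: power_int_add[symmetric] d algebra_simps)
      finally show "1 * integ haar (\<lambda>t. if t \<in> F.bl (k + V.lev \<xi>) (scalar_product \<xi> b) then ?q powi (int d * k - V.lev \<xi>) else 0)
        = ?q powi (int CARD('n) * k)" .
    qed
    also have "\<dots> = of_nat (V.num_balls k A) * ?q powi (int CARD('n) * k)"
      using T(3,4) card_image[of "V.bl k" T] by (simp add: V.num_balls_def)
    also have "\<dots> = haar_vec A"
      by (rule V.content_saturated[OF content_on_haar_vec closed_UNIV kN, symmetric]) (simp add: haar_vec_ball)
    finally show ?thesis .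
  qed
  then show ?thesis using cont tr by blast
qed

text \<open>Determines the chosen measure on balls. All nonempty slices of one ball are translates
  and have a common mass \<open>v\<close>; the disintegration of \<open>haar_vec\<close> over the
  admissible \<open>t\<close> then solves for \<open>v\<close>.\<close>

lemma
  fixes \<xi> :: "'f::nonarch_local_field^'n::finite"
  assumes \<xi>: "\<xi> \<noteq> 0"
  shows content_on_hyperplane_measure: "content_on (compact_opens (hyperplane \<xi> t)) (hyperplane_measure \<xi>)"
    and hyperplane_measure_translate:
      "A \<in> compact_opens (hyperplane \<xi> t) \<Longrightarrow> hyperplane_measure \<xi> ((+) a ` A) = hyperplane_measure \<xi> A"
    and hyperplane_measure_ball: "hyperplane_measure \<xi> (V.bl k b \<inter> hyperplane \<xi> t) =
      (if t \<in> F.bl (k + V.lev \<xi>) (scalar_product \<xi> b)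
       then of_nat (residue_order TYPE('f)) powi ((int CARD('n) - 1) * k - V.lev \<xi>) else 0)"
proof -
  let ?q = "of_nat (residue_order TYPE('f)) :: rat"
  have q: "?q \<noteq> 0" "?q > 0" using residue_order_gt_1[where 'f='f] by auto
  note spec = someI_ex[OF hyperplane_measure_exists[OF \<xi>], folded hyperplane_measure_def]
  show cont: "content_on (compact_opens (hyperplane \<xi> t)) (hyperplane_measure \<xi>)" for t using spec by blast
  show tr: "A \<in> compact_opens (hyperplane \<xi> t) \<Longrightarrow> hyperplane_measure \<xi> ((+) a ` A) = hyperplane_measure \<xi> A" for A a t
    using spec by blast
  have disint: "integ haar (\<lambda>t. hyperplane_measure \<xi> (V.bl k b \<inter> hyperplane \<xi> t)) = haar_vec (V.bl k b)"
    using spec V.bl_compact_opens[of UNIV k b] by simp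
  define v where "v = hyperplane_measure \<xi> (V.bl k b \<inter> hyperplane \<xi> (scalar_product \<xi> b))"
  obtain u where u: "\<And>s. scalar_product \<xi> (u s) = s" "\<And>s k. s \<in> F.bl (k + V.lev \<xi>) 0 \<Longrightarrow> u s \<in> V.bl k 0"
    using ex_scalar_product_shift[OF \<xi>] by blast
  have eq: "hyperplane_measure \<xi> (V.bl k b \<inter> hyperplane \<xi> t) =
      (if t \<in> F.bl (k + V.lev \<xi>) (scalar_product \<xi> b) then v else 0)" for t
  proof (cases "t \<in> F.bl (k + V.lev \<xi>) (scalar_product \<xi> b)")
    case True
    define a where "a = u (t - scalar_product \<xi> b)"
    have "t - scalar_product \<xi> b \<in> F.bl (k + V.lev \<xi>) 0" using True by (simp add: F.bl_def)
    then have "a \<in> V.bl k 0" unfolding a_def by (rule u(2))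
    then have "a + b \<in> V.bl k b" by (simp add: V.bl_def)
    have "(+) a ` (V.bl k b \<inter> hyperplane \<xi> (scalar_product \<xi> b)) = V.bl k b \<inter> hyperplane \<xi> t"
      using V.bl_eq[OF \<open>a + b \<in> V.bl k b\<close>] u(1)
      by (simp add: image_Int V.bl_translate hyperplane_translate a_def)
    moreover have "hyperplane_measure \<xi> ((+) a ` (V.bl k b \<inter> hyperplane \<xi> (scalar_product \<xi> b))) = v"
      unfolding v_def by (rule tr[OF V.bl_compact_opens[OF closed_hyperplane]])
    ultimately show ?thesis using True by simp
  next
    case False
    then have "V.bl k b \<inter> hyperplane \<xi> t = {}" using bl_meets_hyperplane[OF \<xi>] by blast
    moreover have "hyperplane_measure \<xi> {} = 0"
      using content_on_Union[OF cont, of "{}" "\<lambda>_. {}" 0] by (simp add: disjoint_family_on_def compact_opens_def)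
    ultimately show ?thesis using False by simp
  qed
  have co: "F.bl j x \<in> compact_opens UNIV" for j and x :: 'f
    using F.bl_compact_opens[of UNIV j x] by simp
  have "v * ?q powi (k + V.lev \<xi>) = ?q powi (int CARD('n) * k)"
    using disint unfolding eq by (simp add: F.integ_indicator[OF content_on_haar co] haar_ball haar_vec_ball)
  then have "v = ?q powi (int CARD('n) * k) / ?q powi (k + V.lev \<xi>)" using q by (simp add: field_simps)
  also have "\<dots> = ?q powi ((int CARD('n) - 1) * k - V.lev \<xi>)"
    using q by (simp add: power_int_diff[symmetric] algebra_simps)
  finally show "hyperplane_measure \<xi> (V.bl k b \<inter> hyperplane \<xi> t) =
      (if t \<in> F.bl (k + V.lev \<xi>) (scalar_product \<xi> b)
       then ?q powi ((int CARD('n) - 1) * k - V.lev \<xi>) else 0)"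
    using eq by simp
qed

subsection \<open>The distribution of a negative power of the absolute value\<close>

lemma of_rat_powi: "(of_rat (a powi k) :: 'e::field_char_0) = of_rat a powi k"
proof (cases "k \<ge> 0")
  case True
  then show ?thesis by (simp add: power_int_nonneg_exp of_rat_power)
next
  case False
  then show ?thesis by (simp add: power_int_def of_rat_power of_rat_inverse)
qed

context ultranorm begin

lemma restrict_schwartz: "f \<in> schwartz UNIV \<Longrightarrow> (\<lambda>x. if x \<in> S then f x else 0) \<in> schwartz S"
proof -
  assume "f \<in> schwartz UNIV"
  then obtain k N where kN: "step_fun UNIV k N f" by (auto simp: schwartz_def)
  have "step_fun S k N (\<lambda>x. if x \<in> S then f x else 0)"
    unfolding step_fun_def
  proof (intro conjI ballI allI impI)
    fix x y assume "x \<in> S" "y \<in> bl k x \<inter> S"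
    then show "(if y \<in> S then f y else 0) = (if x \<in> S then f x else 0)"
      using step_funD(1)[OF kN, of x y] by simp
  next
    fix x assume "(if x \<in> S then f x else 0) \<noteq> 0"
    then show "x \<in> S \<inter> bl N 0" using step_funD(3)[OF kN, of x] by (auto split: if_splits)
  qed
  then show ?thesis by (auto simp: schwartz_def)
qed

lemma ball_schwartz: "(\<lambda>x. if x \<in> bl k b then c else 0) \<in> schwartz UNIV"
  using indicator_schwartz[OF bl_compact_opens[OF closed_UNIV, of k b]] by simp

lemma sum_transversal:
  fixes c :: "'a \<Rightarrow> 'e::field_char_0"
  assumes "finite T" "inj_on (bl k) T" "t \<in> T" "x \<in> bl k t"
  shows "(\<Sum>b\<in>T. c b * (if x \<in> bl k b then 1 else 0)) = c t"
proof -
  have "x \<in> bl k b \<longleftrightarrow> b = t" if "b \<in> T" for b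
    using bl_eq[OF assms(4)] bl_eq[of x k b] assms that by (auto simp: inj_on_def)
  then have "(\<Sum>b\<in>T. c b * (if x \<in> bl k b then 1 else 0)) = (\<Sum>b\<in>T. if b = t then c b else 0)"
    by (intro sum.cong) simp_all
  then show ?thesis using assms by simp
qed

lemma step_fun_decompose:
  fixes f :: "'a \<Rightarrow> 'e::field_char_0"
  assumes "step_fun UNIV k N f"
  obtains T where "finite T" "T \<subseteq> bl N 0" "inj_on (bl k) T"
    "f = (\<lambda>x. \<Sum>b\<in>T. f b * (if x \<in> bl k b then 1 else 0))"
proof -
  obtain T where T: "finite T" "T \<subseteq> bl N 0" "inj_on (bl k) T" "bl k ` T = bl k ` bl N 0"
    "\<forall>x\<in>bl N 0. \<exists>t\<in>T. x \<in> bl k t"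
    using obtain_transversal[OF order_refl, of N 0 k] .
  have "f x = (\<Sum>b\<in>T. f b * (if x \<in> bl k b then 1 else 0))" for x
  proof (cases "\<exists>t\<in>T. x \<in> bl k t")
    case True
    then obtain t where t: "t \<in> T" "x \<in> bl k t" by blast
    have "(\<Sum>b\<in>T. f b * (if x \<in> bl k b then 1 else 0)) = f t"
      by (rule sum_transversal[OF T(1,3) t])
    also have "\<dots> = f x" using step_funD(1)[OF assms, of t x] t(2) by simp
    finally show ?thesis by simp
  next
    case False
    then have "x \<notin> bl N 0" using T(5) by auto
    then have "f x = 0" using step_funD(3)[OF assms, of x] by auto
    moreover have "(\<Sum>b\<in>T. f b * (if x \<in> bl k b then 1 else 0)) = 0" using False by (intro sum.neutral) auto
    ultimately show ?thesis by simp
  qed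
  then have "f = (\<lambda>x. \<Sum>b\<in>T. f b * (if x \<in> bl k b then 1 else 0))" by (rule ext)
  then show thesis by (rule that[OF T(1-3)])
qed

end

lemma hyperplane_integral_sum:
  fixes \<xi> :: "'f::nonarch_local_field^'n::finite" and f :: "'i \<Rightarrow> 'f^'n \<Rightarrow> 'e::field_char_0"
  assumes "\<xi> \<noteq> 0" "finite I" "\<And>i. i \<in> I \<Longrightarrow> f i \<in> V.schwartz UNIV"
  shows "hyperplane_integral \<xi> t (\<lambda>x. \<Sum>i\<in>I. c i * f i x) = (\<Sum>i\<in>I. c i * hyperplane_integral \<xi> t (f i))"
proof -
  have "(\<lambda>x. if x \<in> hyperplane \<xi> t then \<Sum>i\<in>I. c i * f i x else 0) =
      (\<lambda>x. \<Sum>i\<in>I. c i * (if x \<in> hyperplane \<xi> t then f i x else 0))" by (auto intro!: ext)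
  moreover have "integ (hyperplane_measure \<xi>) (\<lambda>x. \<Sum>i\<in>I. c i * (if x \<in> hyperplane \<xi> t then f i x else 0)) =
      (\<Sum>i\<in>I. c i * integ (hyperplane_measure \<xi>) (\<lambda>x. if x \<in> hyperplane \<xi> t then f i x else 0))"
    by (rule V.integ_sum[OF content_on_hyperplane_measure[OF assms(1)] closed_hyperplane assms(2)])
       (rule V.restrict_schwartz[OF assms(3)])
  ultimately show ?thesis unfolding hyperplane_integral_def by simp
qed

lemma hyperplane_integral_indicator:
  fixes \<xi> :: "'f::nonarch_local_field^'n::finite" and c :: "'e::field_char_0"
  assumes "\<xi> \<noteq> 0" "A \<inter> hyperplane \<xi> t \<in> compact_opens (hyperplane \<xi> t)"
  shows "hyperplane_integral \<xi> t (\<lambda>x. if x \<in> A then c else 0) = c * of_rat (hyperplane_measure \<xi> (A \<inter> hyperplane \<xi> t))"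
proof -
  have "(\<lambda>x. if x \<in> hyperplane \<xi> t then if x \<in> A then c else 0 else 0) =
      (\<lambda>x. if x \<in> A \<inter> hyperplane \<xi> t then c else 0)" by auto
  then show ?thesis unfolding hyperplane_integral_def
    using V.integ_indicator[OF content_on_hyperplane_measure[OF assms(1)] assms(2)] by simp
qed

lemma hyperplane_integral_ball:
  fixes \<xi> :: "'f::nonarch_local_field^'n::finite" and c :: "'e::field_char_0"
  assumes "\<xi> \<noteq> 0"
  shows "hyperplane_integral \<xi> t (\<lambda>x. if x \<in> V.bl k b then c else 0) =
    (if t \<in> F.bl (k + V.lev \<xi>) (scalar_product \<xi> b)
     then c * of_nat (residue_order TYPE('f)) powi ((int CARD('n) - 1) * k - V.lev \<xi>) else 0)"
proof -
  have "V.bl k b \<inter> hyperplane \<xi> t \<in> compact_opens (hyperplane \<xi> t)"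
    by (rule V.bl_compact_opens[OF closed_hyperplane])
  from hyperplane_integral_indicator[OF assms this, of c] show ?thesis
    by (simp add: hyperplane_measure_ball[OF assms] of_rat_powi)
qed

lemma hyperplane_integral_cong:
  "(\<And>x. x \<in> hyperplane \<xi> t \<Longrightarrow> f x = g x) \<Longrightarrow> hyperplane_integral \<xi> t f = hyperplane_integral \<xi> t g"
  unfolding hyperplane_integral_def by (rule arg_cong[where f="integ _"]) auto

lemma distribution_sum:
  fixes \<beta> :: "('f::nonarch_local_field, 'e::field_char_0) functional"
  assumes \<beta>: "distribution \<beta>" and "finite I" "\<And>i. i \<in> I \<Longrightarrow> f i \<in> F.schwartz UNIV"
  shows "\<beta> (\<lambda>s. \<Sum>i\<in>I. c i * f i s) = (\<Sum>i\<in>I. c i * \<beta> (f i))"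
  using assms(2,3)
proof (induction I rule: finite_induct)
  case empty
  have sc: "\<beta> (fun_scale d g) = d * \<beta> g" if "g \<in> F.schwartz UNIV" for d g
    using \<beta> that unfolding distribution_def linear_map_on_def F.test_functions_eq by blast
  have "(\<lambda>x. if x \<in> F.bl 0 0 then 0 else 0 :: 'e) \<in> F.schwartz UNIV" by (rule F.ball_schwartz)
  from sc[OF this, of 0] show ?case by (simp add: fun_scale_def)
next
  case (insert i I)
  have sc: "\<beta> (fun_scale d g) = d * \<beta> g" if "g \<in> F.schwartz UNIV" for d g
    using \<beta> that unfolding distribution_def linear_map_on_def F.test_functions_eq by blast
  have ad: "\<beta> (g + h) = \<beta> g + \<beta> h" if "g \<in> F.schwartz UNIV" "h \<in> F.schwartz UNIV" for g h
    using \<beta> that unfolding distribution_def linear_map_on_def F.test_functions_eq by blast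
  have i: "f i \<in> F.schwartz UNIV" using insert.prems by simp
  have "fun_scale (c i) (f i) \<in> F.schwartz UNIV"
    using F.schwartz_sum[of "{i}" f UNIV c] i by (simp add: fun_scale_def)
  moreover have "(\<lambda>s. \<Sum>i\<in>I. c i * f i s) \<in> F.schwartz UNIV"
    using insert.prems insert.hyps by (intro F.schwartz_sum) auto
  ultimately have "\<beta> (fun_scale (c i) (f i) + (\<lambda>s. \<Sum>i\<in>I. c i * f i s)) = c i * \<beta> (f i) + \<beta> (\<lambda>s. \<Sum>i\<in>I. c i * f i s)"
    using ad sc[OF i] by simp
  moreover have "(\<lambda>s. \<Sum>i\<in>insert i I. c i * f i s) = fun_scale (c i) (f i) + (\<lambda>s. \<Sum>i\<in>I. c i * f i s)"
    using insert.hyps by (auto simp: fun_scale_def plus_fun_def)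
  ultimately show ?case using insert by simp
qed

text \<open>The mass of |s|^-n on |s| > 1: the sum over j \<ge> 1 of q^(-n j) times the measure q^j
  (1 - 1/q) of the sphere |s| = q^j. Stated over any field because rational, real and
  \<open>'e\<close> values of it occur.\<close>

definition tail_const :: "'e::field \<Rightarrow> nat \<Rightarrow> 'e"
  where "tail_const Q n = (1 - inverse Q) / (Q ^ (n - 1) - 1)"

definition norm_power_series :: "nat \<Rightarrow> 'f::nonarch_local_field set \<Rightarrow> int \<Rightarrow> real"
  where "norm_power_series n A k = real (residue_order TYPE('f)) powi (- (int n * k)) *
         of_rat (haar (A \<inter> {s. absval s = real (residue_order TYPE('f)) powi k}))"

text \<open>\<open>norm_power_measure\<close> is a definite description and has no additivity by
  itself. Explicit sums do add, provided the pieces on each sphere are compact open so that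
  \<open>haar\<close> is additive there; hence both facts travel together.\<close>

definition has_norm_power_measure :: "nat \<Rightarrow> 'f::nonarch_local_field set \<Rightarrow> rat \<Rightarrow> bool"
  where "has_norm_power_measure n A r \<longleftrightarrow> (norm_power_series n A has_sum of_rat r) UNIV \<and>
     (\<forall>k. A \<inter> {s. absval s = real (residue_order TYPE('f)) powi k} \<in> compact_opens UNIV)"

lemma has_norm_power_measure_eq: "has_norm_power_measure n A r \<Longrightarrow> norm_power_measure n A = r"
  unfolding norm_power_measure_def has_norm_power_measure_def norm_power_series_def
  by (rule the_equality) (auto dest: has_sum_unique)

lemma compact_opens_Un: "A \<in> compact_opens S \<Longrightarrow> B \<in> compact_opens S \<Longrightarrow> A \<union> B \<in> compact_opens S"
  by (auto simp: compact_opens_def)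

lemma has_norm_power_measure_Union:
  fixes A :: "'i \<Rightarrow> 'f::nonarch_local_field set"
  assumes "finite J" "disjoint_family_on A J" "\<And>i. i \<in> J \<Longrightarrow> has_norm_power_measure n (A i) (r i)"
  shows "has_norm_power_measure n (\<Union>i\<in>J. A i) (\<Sum>i\<in>J. r i)"
  using assms
proof (induction J rule: finite_induct)
  case empty
  have "norm_power_series n ({} :: 'f set) k = 0" for k
    using content_on_Union[OF content_on_haar[where 'f='f], of "{}" "\<lambda>_::unit. {}"]
    by (simp add: norm_power_series_def disjoint_family_on_def compact_opens_def)
  then have "norm_power_series n ({} :: 'f set) = (\<lambda>_. 0)" by auto
  then show ?case by (simp add: has_norm_power_measure_def compact_opens_def)
next
  case (insert i J)
  let ?S = "\<lambda>k. {s :: 'f. absval s = real (residue_order TYPE('f)) powi k}"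
  have "disjoint_family_on A J" using insert.prems by (auto simp: disjoint_family_on_def)
  then have J: "has_norm_power_measure n (\<Union>i\<in>J. A i) (\<Sum>i\<in>J. r i)" using insert by auto
  have i: "has_norm_power_measure n (A i) (r i)" using insert by auto
  have dis: "A i \<inter> (\<Union>i\<in>J. A i) = {}" using insert.prems(1) insert.hyps by (auto simp: disjoint_family_on_def)
  have co: "A i \<inter> ?S k \<in> compact_opens UNIV" "(\<Union>i\<in>J. A i) \<inter> ?S k \<in> compact_opens UNIV" for k
    using i J unfolding has_norm_power_measure_def by auto
  have eq: "(\<Union>i\<in>insert i J. A i) \<inter> ?S k = (A i \<inter> ?S k) \<union> ((\<Union>i\<in>J. A i) \<inter> ?S k)" for k by blast
  have "haar ((A i \<inter> ?S k) \<union> ((\<Union>i\<in>J. A i) \<inter> ?S k)) = haar (A i \<inter> ?S k) + haar ((\<Union>i\<in>J. A i) \<inter> ?S k)" for k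
  proof -
    have "(A i \<inter> ?S k) \<inter> ((\<Union>i\<in>J. A i) \<inter> ?S k) = {}" using dis by blast
    then show ?thesis using co content_on_haar[where 'f='f] unfolding content_on_def by blast
  qed
  then have "norm_power_series n (\<Union>i\<in>insert i J. A i) = (\<lambda>k. norm_power_series n (A i) k + norm_power_series n (\<Union>i\<in>J. A i) k)"
    unfolding norm_power_series_def eq by (auto simp: of_rat_add distrib_left)
  moreover have "((\<lambda>k. norm_power_series n (A i) k + norm_power_series n (\<Union>i\<in>J. A i) k) has_sum
     (of_rat (r i) + of_rat (\<Sum>i\<in>J. r i))) UNIV"
    using i J unfolding has_norm_power_measure_def by (intro has_sum_add) auto
  moreover have "(\<Union>i\<in>insert i J. A i) \<inter> ?S k \<in> compact_opens UNIV" for k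
    unfolding eq using co by (rule compact_opens_Un)
  ultimately show ?case using insert.hyps unfolding has_norm_power_measure_def by (simp add: of_rat_add)
qed

lemma sphere_eq: "{s::'f::nonarch_local_field. absval s = real (residue_order TYPE('f)) powi k} = F.bl k 0 - F.bl (k - 1) 0"
proof (intro equalityI subsetI)
  fix s :: 'f assume s: "s \<in> F.bl k 0 - F.bl (k - 1) 0"
  then have "s \<noteq> 0" "F.lev s = k" by (auto simp: F.mem_bl_0)
  then show "s \<in> {s. absval s = real (residue_order TYPE('f)) powi k}" using F.nrm_lev by auto
qed (auto simp: F.bl_def)

lemma sphere_compact_opens: "F.bl k 0 - F.bl (k - 1) (0::'f::nonarch_local_field) \<in> compact_opens UNIV"
proof (rule F.saturated_compact_opens[OF closed_UNIV _ Diff_subset])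
  have "z \<in> F.bl k 0 - F.bl (k - 1) 0" if "y \<in> F.bl k 0 - F.bl (k - 1) 0" "z \<in> F.bl (k - 1) y" for y z :: 'f
  proof -
    have "z \<in> F.bl k 0" using that F.bl_mono[of "k - 1" k y] F.bl_eq[of y k 0] by auto
    moreover have "z \<notin> F.bl (k - 1) 0"
      using that F.bl_eq[of z "k - 1" y] F.bl_eq[of z "k - 1" 0] F.bl_eq_iff[of "k - 1" y 0] by auto
    ultimately show ?thesis by simp
  qed
  then show "F.saturated (k - 1) UNIV (F.bl k 0 - F.bl (k - 1) (0::'f))"
    unfolding F.saturated_def by blast
qed

lemma haar_sphere: "haar (F.bl k 0 - F.bl (k - 1) (0::'f::nonarch_local_field)) =
   of_nat (residue_order TYPE('f)) powi k * (1 - inverse (of_nat (residue_order TYPE('f))))"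
proof -
  let ?q = "of_nat (residue_order TYPE('f)) :: rat"
  have q: "?q \<noteq> 0" using residue_order_gt_1[where 'f='f] by simp
  have co: "F.bl (k - 1) (0::'f) \<in> compact_opens UNIV" using F.bl_compact_opens[of UNIV "k - 1" 0] by simp
  have "F.bl (k - 1) (0::'f) \<union> (F.bl k 0 - F.bl (k - 1) 0) = F.bl k 0" using F.bl_mono[of "k - 1" k] by auto
  moreover have "haar (F.bl (k - 1) (0::'f) \<union> (F.bl k 0 - F.bl (k - 1) 0)) =
     haar (F.bl (k - 1) (0::'f)) + haar (F.bl k 0 - F.bl (k - 1) (0::'f))"
    using content_on_haar[where 'f='f] co sphere_compact_opens unfolding content_on_def by blast
  ultimately have "haar (F.bl k 0 - F.bl (k - 1) (0::'f)) = ?q powi k - ?q powi (k - 1)"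
    by (simp add: haar_ball)
  then show ?thesis using q by (simp add: power_int_diff field_simps)
qed

text \<open>A ball that avoids 0 lies on a single sphere, so only one term of the series is
  nonzero.\<close>

lemma has_norm_power_measure_ball:
  fixes b :: "'f::nonarch_local_field"
  assumes "b \<notin> F.bl k 0"
  shows "has_norm_power_measure n (F.bl k b) (of_nat (residue_order TYPE('f)) powi (k - int n * F.lev b))"
proof -
  let ?S = "\<lambda>k. {s :: 'f. absval s = real (residue_order TYPE('f)) powi k}"
  let ?q = "real (residue_order TYPE('f))"
  have q: "?q \<noteq> 0" using residue_order_gt_1[where 'f='f] by simp
  have b: "b \<noteq> 0" "F.lev b > k" using assms by (auto simp: F.mem_bl_0)
  have "absval s = ?q powi F.lev b" if "s \<in> F.bl k b" for s
  proof -
    have "absval (s - b) \<le> ?q powi k" using that by (simp add: F.bl_def)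
    also have "\<dots> < absval b" using F.nrm_lev[OF b(1)] b(2) by simp
    finally show ?thesis using F.nrm_eq_if_close F.nrm_lev[OF b(1)] by metis
  qed
  then have int: "F.bl k b \<inter> ?S j = (if j = F.lev b then F.bl k b else {})" for j by auto
  have co: "F.bl k b \<in> compact_opens UNIV" using F.bl_compact_opens[of UNIV k b] by simp
  have e: "haar ({} :: 'f set) = 0"
    using content_on_Union[OF content_on_haar[where 'f='f], of "{}" "\<lambda>_::unit. {}"]
    by (simp add: disjoint_family_on_def compact_opens_def)
  have "(norm_power_series n (F.bl k b) has_sum (?q powi (k - int n * F.lev b))) UNIV"
  proof (rule has_sum_finite_neutralI[of "{F.lev b}"])
    show "?q powi (k - int n * F.lev b) = sum (norm_power_series n (F.bl k b)) {F.lev b}"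
      using q by (simp add: norm_power_series_def int haar_ball of_rat_powi power_int_add[symmetric])
  qed (auto simp: norm_power_series_def int e)
  then show ?thesis unfolding has_norm_power_measure_def using co by (simp add: int of_rat_powi compact_opens_def)
qed

lemma has_norm_power_measure_compl:
  assumes n: "n \<ge> 2"
  shows "has_norm_power_measure n (- F.bl k (0::'f::nonarch_local_field))
    (tail_const (of_nat (residue_order TYPE('f))) n * of_nat (residue_order TYPE('f)) powi (- (int n - 1) * k))"
proof -
  let ?S = "\<lambda>k. {s :: 'f. absval s = real (residue_order TYPE('f)) powi k}"
  let ?q = "real (residue_order TYPE('f))"
  have q: "?q \<noteq> 0" "?q > 1" using residue_order_gt_1[where 'f='f] by auto
  have e: "haar ({} :: 'f set) = 0"
    using content_on_Union[OF content_on_haar[where 'f='f], of "{}" "\<lambda>_::unit. {}"]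
    by (simp add: disjoint_family_on_def compact_opens_def)
  have int: "- F.bl k (0::'f) \<inter> ?S j = (if j > k then F.bl j 0 - F.bl (j - 1) 0 else {})" for j
  proof -
    have "F.bl (j - 1) (0::'f) \<supseteq> F.bl k 0" if "j > k" using that by (intro F.bl_mono) simp
    moreover have "F.bl j (0::'f) \<subseteq> F.bl k 0" if "\<not> j > k" using that by (intro F.bl_mono) simp
    ultimately show ?thesis unfolding sphere_eq by auto
  qed
  \<comment> \<open>Weight q^(-n j) and sphere measure q^j combine to the ratio q^(-(n-1)) of
    consecutive terms, which is below 1 since \<open>n \<ge> 2\<close>.\<close>
  define x where "x = inverse (?q ^ (n - 1))"
  have n1: "1 < ?q ^ (n - 1)" using q n by (intro one_less_power) auto
  have x: "0 \<le> x" "x < 1" unfolding x_def using n1 by (auto simp: inverse_less_1_iff)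
  have ser: "norm_power_series n (- F.bl k (0::'f)) j = (if j > k then (1 - inverse ?q) * ?q powi (- (int n - 1) * j) else 0)" for j
  proof -
    have "?q powi (- (int n * j)) * ?q powi j = ?q powi (- (int n - 1) * j)"
      using q by (simp add: power_int_add[symmetric] algebra_simps)
    then show ?thesis
      by (simp add: norm_power_series_def int e haar_sphere of_rat_mult of_rat_powi of_rat_diff of_rat_inverse)
  qed
  have xq: "x = ?q powi (- (int n - 1))"
    using n by (simp add: x_def power_int_def nat_diff_distrib power_inverse)
  have pw: "?q powi (- (int n - 1) * (k + 1 + int i)) = ?q powi (- (int n - 1) * (k + 1)) * x ^ i" for i
  proof -
    have "?q powi (- (int n - 1) * (k + 1 + int i)) = ?q powi (- (int n - 1) * (k + 1)) * ?q powi (- (int n - 1) * int i)"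
      using q by (simp add: power_int_add[symmetric] algebra_simps)
    also have "?q powi (- (int n - 1) * int i) = x ^ i"
      unfolding xq by (simp add: power_int_mult)
    finally show ?thesis .
  qed
  define c where "c = (1 - inverse ?q) * ?q powi (- (int n - 1) * (k + 1))"
  have "(\<lambda>i. c * x ^ i) sums (c * (1 / (1 - x)))"
    using x by (intro sums_mult geometric_sums) auto
  moreover have "0 \<le> c" unfolding c_def using q by (auto simp: inverse_le_1_iff)
  ultimately have "((\<lambda>i. c * x ^ i) has_sum (c * (1 / (1 - x)))) UNIV"
    using x by (intro sums_nonneg_imp_has_sum) auto
  then have "((\<lambda>i. norm_power_series n (- F.bl k (0::'f)) (k + 1 + int i)) has_sum (c * (1 / (1 - x)))) UNIV"
    unfolding ser pw by (simp add: c_def mult.assoc)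
  then have "(norm_power_series n (- F.bl k (0::'f)) has_sum (c * (1 / (1 - x)))) {k<..}"
    by (subst (asm) has_sum_reindex_bij_betw[of "\<lambda>i. k + 1 + int i" UNIV "{k<..}" "norm_power_series n (- F.bl k 0)"])
       (auto intro!: bij_betwI[where g="\<lambda>j. nat (j - k - 1)"])
  then have hs: "(norm_power_series n (- F.bl k (0::'f)) has_sum (c * (1 / (1 - x)))) UNIV"
    by (rule has_sum_cong_neutral[THEN iffD1, rotated -1]) (auto simp: ser)
  have "c * (1 / (1 - x)) = tail_const ?q n * ?q powi (- (int n - 1) * k)"
  proof -
    have "?q powi (- (int n - 1) * (k + 1)) = ?q powi (- (int n - 1) * k) * x"
      using q unfolding xq by (simp add: power_int_add[symmetric] algebra_simps)
    moreover have "x * (1 / (1 - x)) = 1 / (?q ^ (n - 1) - 1)" using n1 q by (simp add: x_def field_simps)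
    ultimately have "c * (1 / (1 - x)) = (1 - inverse ?q) * ?q powi (- (int n - 1) * k) * (1 / (?q ^ (n - 1) - 1))"
      unfolding c_def by (simp only: mult.assoc)
    then show ?thesis unfolding tail_const_def by simp
  qed
  moreover have "of_rat (tail_const (of_nat (residue_order TYPE('f))) n * of_nat (residue_order TYPE('f)) powi (- (int n - 1) * k)) =
     tail_const ?q n * ?q powi (- (int n - 1) * k)"
    by (simp add: tail_const_def of_rat_mult of_rat_divide of_rat_diff of_rat_inverse of_rat_power of_rat_powi)
  ultimately show ?thesis using hs unfolding has_norm_power_measure_def
    by (simp add: int sphere_compact_opens) (simp add: compact_opens_def)
qed


text \<open>Cuts the field into the ball of radius q^k, where f - f(0) vanishes, finitely many balls
  covering the annulus up to q^N, and the complement, where \<open>f\<close> vanishes and the tail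
  contributes -f(0) times its mass. For a fixed transversal the result is linear in
  \<open>f\<close>, which is how the functional is seen to be a distribution.\<close>

lemma norm_neg_power_eq:
  fixes f :: "'f::nonarch_local_field \<Rightarrow> 'e::field_char_0"
  assumes n: "n \<ge> 2" and f: "F.step_fun UNIV k N f" and "k \<le> N"
    and T: "finite T" "T \<subseteq> F.bl N 0 - F.bl k 0" "inj_on (F.bl k) T"
      "\<forall>x\<in>F.bl N 0 - F.bl k 0. \<exists>t\<in>T. x \<in> F.bl k t"
  shows "norm_neg_power n f = (\<Sum>b\<in>T. (f b - f 0) * of_nat (residue_order TYPE('f)) powi (k - int n * F.lev b))
     - f 0 * (tail_const (of_nat (residue_order TYPE('f))) n * of_nat (residue_order TYPE('f)) powi (- (int n - 1) * N))"
proof -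
  let ?q = "residue_order TYPE('f)"
  define I where "I = insert None (Some ` T)"
  \<comment> \<open>\<open>None\<close> indexes the unbounded piece, the only one whose mass is an
    infinite sum.\<close>
  define A :: "'f option \<Rightarrow> 'f set" where "A = (\<lambda>i. case i of None \<Rightarrow> - F.bl N 0 | Some b \<Rightarrow> F.bl k b)"
  define c :: "'f option \<Rightarrow> 'e" where "c = (\<lambda>i. case i of None \<Rightarrow> - f 0 | Some b \<Rightarrow> f b - f 0)"
  define r :: "'f option \<Rightarrow> rat" where "r = (\<lambda>i. case i of None \<Rightarrow> tail_const (of_nat ?q) n * of_nat ?q powi (- (int n - 1) * N)
     | Some b \<Rightarrow> of_nat ?q powi (k - int n * F.lev b))"
  have finI: "finite I" using T(1) by (simp add: I_def)
  have sub: "F.bl k b \<subseteq> F.bl N 0" if "b \<in> T" for b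
    using that T(2) F.bl_mono[OF \<open>k \<le> N\<close>, of b] F.bl_eq[of b N 0] by auto
  have disj: "disjoint_family_on A I"
    unfolding disjoint_family_on_def
  proof (intro ballI impI)
    fix i j assume ij: "i \<in> I" "j \<in> I" "i \<noteq> j"
    have "A (Some b) \<inter> A (Some b') = {}" if "b \<in> T" "b' \<in> T" "b \<noteq> b'" for b b'
      using F.bl_disjoint[of k b b'] T(3) that unfolding inj_on_def A_def by auto
    moreover have "A (Some b) \<inter> A None = {}" if "b \<in> T" for b
      using sub[OF that] by (auto simp: A_def)
    ultimately show "A i \<inter> A j = {}" using ij unfolding I_def by (cases i; cases j) auto
  qed
  have hn: "has_norm_power_measure n (A i) (r i)" if "i \<in> I" for i
  proof (cases i)
    case None
    then show ?thesis using has_norm_power_measure_compl[OF n] by (simp add: A_def r_def)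
  next
    case (Some b)
    then have "b \<notin> F.bl k 0" using that T(2) by (auto simp: I_def)
    then show ?thesis using Some has_norm_power_measure_ball by (simp add: A_def r_def)
  qed
  have "norm_neg_power n f = (\<Sum>i\<in>I. c i * of_rat (norm_power_measure n (A i)))"
    unfolding norm_neg_power_def
  proof (rule integ_partition[OF finI disj])
    fix i x assume i: "i \<in> I" "x \<in> A i"
    show "f x - f 0 = c i"
    proof (cases i)
      case None
      then have "f x = 0" using i F.step_funD(3)[OF f, of x] by (auto simp: A_def)
      then show ?thesis using None by (simp add: c_def)
    next
      case (Some b)
      then have "f x = f b" using i F.step_funD(1)[OF f, of b x] by (simp add: A_def)
      then show ?thesis using Some by (simp add: c_def)
    qed
  next
    fix x assume x: "x \<notin> (\<Union>i\<in>I. A i)"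
    then have "x \<in> F.bl N 0" by (auto simp: I_def A_def)
    moreover have "x \<notin> F.bl N 0 - F.bl k 0"
    proof
      assume "x \<in> F.bl N 0 - F.bl k 0"
      then obtain t where "t \<in> T" "x \<in> F.bl k t" using T(4) by blast
      then show False using x by (auto simp: I_def A_def)
    qed
    ultimately have "f x = f 0" using F.step_funD(1)[OF f, of 0 x] by simp
    then show "f x - f 0 = 0" by simp
  next
    fix J assume J: "J \<subseteq> I"
    have "has_norm_power_measure n (\<Union>i\<in>J. A i) (\<Sum>i\<in>J. r i)"
      using J finI disj hn by (intro has_norm_power_measure_Union)
        (auto intro: finite_subset simp: disjoint_family_on_def)
    then have "norm_power_measure n (\<Union>i\<in>J. A i) = (\<Sum>i\<in>J. r i)" by (rule has_norm_power_measure_eq)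
    also have "\<dots> = (\<Sum>i\<in>J. norm_power_measure n (A i))"
      using J has_norm_power_measure_eq[OF hn] by (intro sum.cong) auto
    finally show "norm_power_measure n (\<Union>i\<in>J. A i) = (\<Sum>i\<in>J. norm_power_measure n (A i))" .
  qed
  also have "\<dots> = (\<Sum>i\<in>I. c i * of_rat (r i))"
    using has_norm_power_measure_eq[OF hn] by (intro sum.cong) auto
  also have "\<dots> = c None * of_rat (r None) + (\<Sum>i\<in>Some ` T. c i * of_rat (r i))"
    unfolding I_def using T(1) by (subst sum.insert) auto
  also have "(\<Sum>i\<in>Some ` T. c i * of_rat (r i)) = (\<Sum>b\<in>T. (f b - f 0) * of_nat ?q powi (k - int n * F.lev b))"
    by (subst sum.reindex) (auto simp: c_def r_def of_rat_powi)
  also have "c None * of_rat (r None) = - (f 0 * (tail_const (of_nat ?q) n * of_nat ?q powi (- (int n - 1) * N)))"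
    by (simp add: c_def r_def tail_const_def of_rat_mult of_rat_divide of_rat_diff of_rat_inverse of_rat_power of_rat_powi)
  finally show ?thesis by simp
qed

lemma norm_neg_power_transversal:
  assumes "k \<le> N"
  obtains T where "finite T" "T \<subseteq> F.bl N 0 - F.bl k (0::'f::nonarch_local_field)" "inj_on (F.bl k) T"
      "\<forall>x\<in>F.bl N 0 - F.bl k 0. \<exists>t\<in>T. x \<in> F.bl k t"
  using F.obtain_transversal[OF Diff_subset, of N 0 "F.bl k 0" k] by metis

lemma distribution_norm_neg_power:
  assumes n: "n \<ge> 2"
  shows "distribution (norm_neg_power n :: ('f::nonarch_local_field, 'e::field_char_0) functional)"
  unfolding distribution_def linear_map_on_def F.test_functions_eq
proof (intro conjI ballI allI)
  fix f g :: "'f \<Rightarrow> 'e" assume fg: "f \<in> F.schwartz UNIV" "g \<in> F.schwartz UNIV"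
  obtain k N where kN: "F.step_fun UNIV k N f" "F.step_fun UNIV k N g" "k \<le> N"
  proof -
    obtain k N k' N' where "F.step_fun UNIV k N f" "F.step_fun UNIV k' N' g"
      using fg by (auto simp: F.schwartz_def)
    then have "F.step_fun UNIV (min k k') (max N (max N' k)) f" "F.step_fun UNIV (min k k') (max N (max N' k)) g"
      by (auto elim!: F.step_fun_mono)
    then show thesis by (rule that) auto
  qed
  have "F.step_fun UNIV k N (\<lambda>x. \<Sum>i\<in>{True, False}. 1 * (if i then f else g) x)"
    by (rule F.step_fun_sum) (use kN in auto)
  then have sum: "F.step_fun UNIV k N (f + g)" by (simp add: plus_fun_def)
  obtain T where T: "finite T" "T \<subseteq> F.bl N 0 - F.bl k (0::'f)" "inj_on (F.bl k) T"
      "\<forall>x\<in>F.bl N 0 - F.bl k 0. \<exists>t\<in>T. x \<in> F.bl k t"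
    using norm_neg_power_transversal[OF kN(3)] .
  note eq = norm_neg_power_eq[OF n _ kN(3) T]
  show "norm_neg_power n (f + g) = norm_neg_power n f + norm_neg_power n g"
    unfolding eq[OF sum] eq[OF kN(1)] eq[OF kN(2)]
    by (simp add: plus_fun_def sum.distrib[symmetric] algebra_simps sum_subtractf[symmetric])
next
  fix c :: 'e and f :: "'f \<Rightarrow> 'e" assume f: "f \<in> F.schwartz UNIV"
  obtain k N where kN: "F.step_fun UNIV k N f" "k \<le> N"
  proof -
    obtain k N where "F.step_fun UNIV k N f"
      using f by (auto simp: F.schwartz_def)
    then have "F.step_fun UNIV k (max k N) f" by (auto elim!: F.step_fun_mono)
    then show thesis by (rule that) auto
  qed
  have "F.step_fun UNIV k N (\<lambda>x. \<Sum>i\<in>{()}. c * f x)"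
    by (rule F.step_fun_sum) (use kN in auto)
  then have sc: "F.step_fun UNIV k N (fun_scale c f)" by (simp add: fun_scale_def)
  obtain T where T: "finite T" "T \<subseteq> F.bl N 0 - F.bl k (0::'f)" "inj_on (F.bl k) T"
      "\<forall>x\<in>F.bl N 0 - F.bl k 0. \<exists>t\<in>T. x \<in> F.bl k t"
    using norm_neg_power_transversal[OF kN(2)] .
  note eq = norm_neg_power_eq[OF n _ kN(2) T]
  show "norm_neg_power n (fun_scale c f) = c * norm_neg_power n f"
    unfolding eq[OF sc] eq[OF kN(1)]
    by (simp add: fun_scale_def sum_distrib_left algebra_simps)
qed

text \<open>If the ball contains 0, subtracting f(0) = 1 cancels the ball itself and only the tail
  outside it counts, with a minus sign. Otherwise f(0) = 0 and the weight is |u|^-n throughout the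
  ball.\<close>

lemma norm_neg_power_ball:
  fixes u :: "'f::nonarch_local_field"
  assumes n: "n \<ge> 2"
  shows "norm_neg_power n (\<lambda>s. if s \<in> F.bl k u then 1 else 0 :: 'e::field_char_0) =
    (if u \<in> F.bl k 0 then - tail_const (of_nat (residue_order TYPE('f))) n * of_nat (residue_order TYPE('f)) powi (- (int n - 1) * k)
     else of_nat (residue_order TYPE('f)) powi (k - int n * F.lev u))"
proof -
  define f where "f = (\<lambda>s. if s \<in> F.bl k u then 1 else 0 :: 'e)"
  have eqv: "y \<in> F.bl k u \<longleftrightarrow> x \<in> F.bl k u" if "y \<in> F.bl k x" for x y
    using F.bl_eq[OF that] F.bl_eq_iff F.bl_sym by metis
  show ?thesis
  proof (cases "u \<in> F.bl k 0")
    case True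
    then have bl: "F.bl k u = F.bl k 0" by (rule F.bl_eq)
    \<comment> \<open>With \<open>N = k\<close> no annulus is left and the transversal is
      empty.\<close>
    have f: "F.step_fun UNIV k k f"
      unfolding F.step_fun_def f_def using eqv bl by (auto split: if_splits)
    have "norm_neg_power n f = - (tail_const (of_nat (residue_order TYPE('f))) n * of_nat (residue_order TYPE('f)) powi (- (int n - 1) * k))"
      using norm_neg_power_eq[OF n f order_refl, of "{}"] bl by (simp add: f_def)
    then show ?thesis using True by (simp add: f_def)
  next
    case False
    then have u: "u \<noteq> 0" "F.lev u > k" by (auto simp: F.mem_bl_0)
    define N where "N = F.lev u"
    have uN: "u \<in> F.bl N 0" by (simp add: F.mem_bl_0 N_def)
    have sub: "F.bl k u \<subseteq> F.bl N 0" using u F.bl_mono[of k N u] F.bl_eq[OF uN] by (auto simp: N_def)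
    have f: "F.step_fun UNIV k N f"
      unfolding F.step_fun_def f_def
    proof (intro conjI ballI allI impI)
      fix x y :: 'f assume "y \<in> F.bl k x \<inter> UNIV"
      then show "(if y \<in> F.bl k u then 1 else 0 :: 'e) = (if x \<in> F.bl k u then 1 else 0)" using eqv[of y x] by simp
    qed (use sub in \<open>auto split: if_splits\<close>)
    have kN: "k \<le> N" using u by (simp add: N_def)
    obtain T where T: "finite T" "T \<subseteq> F.bl N 0 - F.bl k (0::'f)" "inj_on (F.bl k) T"
      "\<forall>x\<in>F.bl N 0 - F.bl k 0. \<exists>t\<in>T. x \<in> F.bl k t"
      using norm_neg_power_transversal[OF kN] .
    obtain t where t: "t \<in> T" "u \<in> F.bl k t" using T(4) uN False by blast
    have "b \<in> F.bl k u \<longleftrightarrow> b = t" if "b \<in> T" for b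
      using F.bl_eq[OF t(2)] F.bl_eq[of b k u] T(3) t that F.bl_sym[of t k u] by (auto simp: inj_on_def)
    then have "(\<Sum>b\<in>T. (f b - f 0) * of_nat (residue_order TYPE('f)) powi (k - int n * F.lev b)) =
       (\<Sum>b\<in>T. if b = t then of_nat (residue_order TYPE('f)) powi (k - int n * F.lev b) else 0)"
      using False F.bl_sym[of 0 k u] by (intro sum.cong) (auto simp: f_def)
    also have "\<dots> = of_nat (residue_order TYPE('f)) powi (k - int n * F.lev t)" using t T(1) by simp
    also have "F.lev t = F.lev u"
    proof -
      have "absval (t - u) < absval u"
      proof -
        have "absval (t - u) \<le> real (residue_order TYPE('f)) powi k" using t(2) F.bl_sym by (auto simp: F.bl_def)
        also have "\<dots> < absval u" using F.nrm_lev[OF u(1)] u(2) by simp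
        finally show ?thesis .
      qed
      then have "absval t = absval u" by (rule F.nrm_eq_if_close)
      then show ?thesis using F.nrm_lev[OF u(1)] by (intro F.lev_eqI) simp
    qed
    finally have "norm_neg_power n f = of_nat (residue_order TYPE('f)) powi (k - int n * F.lev u)"
      using norm_neg_power_eq[OF n f kN T] False F.bl_sym[of 0 k u] by (simp add: f_def)
    then show ?thesis using False by (simp add: f_def)
  qed
qed

subsection \<open>The distribution of the inversion formula\<close>

lemma of_nat_residue_order:
  shows "(of_nat (residue_order TYPE('f::nonarch_local_field)) :: 'e::field_char_0) \<noteq> 0"
    and "n > 0 \<Longrightarrow> (of_nat (residue_order TYPE('f::nonarch_local_field)) :: 'e::field_char_0) ^ n \<noteq> 1"
proof -
  have q: "residue_order TYPE('f) > 1" by (rule residue_order_gt_1)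
  then show "(of_nat (residue_order TYPE('f::nonarch_local_field)) :: 'e::field_char_0) \<noteq> 0" by simp
  assume "n > 0"
  then have "residue_order TYPE('f) ^ n \<noteq> 1" using one_less_power[OF q, of n] by linarith
  then have "(of_nat (residue_order TYPE('f) ^ n) :: 'e) \<noteq> of_nat 1" unfolding of_nat_eq_iff .
  then show "(of_nat (residue_order TYPE('f::nonarch_local_field)) :: 'e::field_char_0) ^ n \<noteq> 1" by simp
qed

definition beta_dist :: "nat \<Rightarrow> ('f::nonarch_local_field, 'e::field_char_0) functional"
  where "beta_dist n f = (1 - of_nat (residue_order TYPE('f)) ^ (n - 1)) / (1 - of_nat (residue_order TYPE('f)) powi (- int n)) *
           (translate_by_one (norm_neg_power n) f - norm_neg_power n f)"

text \<open>The value of |s|^-n on the indicator of the ball of radius q^k about \<open>u\<close>,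
  divided by the measure q^k; compare \<open>norm_neg_power_ball\<close>. The \<open>itself\<close>
  argument fixes the field of values.\<close>

definition ball_mean :: "'e::field_char_0 itself \<Rightarrow> nat \<Rightarrow> int \<Rightarrow> 'f::nonarch_local_field \<Rightarrow> 'e"
  where "ball_mean _ n k u = (if u \<in> F.bl k 0
     then - tail_const (of_nat (residue_order TYPE('f))) n * of_nat (residue_order TYPE('f)) powi (- (int n * k))
     else of_nat (residue_order TYPE('f)) powi (- (int n * F.lev u)))"

text \<open>The corresponding mean of \<open>beta_dist\<close>: translation by one moves the centre
  \<open>u\<close> of the ball to \<open>u - 1\<close>.\<close>

definition beta_mean :: "nat \<Rightarrow> int \<Rightarrow> 'f::nonarch_local_field \<Rightarrow> 'e::field_char_0"
  where "beta_mean n k u = (1 - of_nat (residue_order TYPE('f)) ^ (n - 1)) / (1 - of_nat (residue_order TYPE('f)) powi (- int n)) *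
     (ball_mean TYPE('e) n k (u - 1) - ball_mean TYPE('e) n k u)"

lemma schwartz_translate:
  fixes f :: "'f::nonarch_local_field \<Rightarrow> 'e::zero"
  assumes "f \<in> F.schwartz UNIV" shows "(\<lambda>s. f (s + a)) \<in> F.schwartz UNIV"
proof -
  obtain k N where f: "F.step_fun UNIV k N f" using assms by (auto simp: F.schwartz_def)
  define M where "M = max N (F.lev a)"
  have "F.step_fun UNIV k M (\<lambda>s. f (s + a))"
    unfolding F.step_fun_def
  proof (intro conjI ballI allI impI)
    fix x y :: 'f assume "y \<in> F.bl k x \<inter> UNIV"
    then show "f (y + a) = f (x + a)" using F.step_funD(1)[OF f, of "x + a" "y + a"] by (simp add: F.bl_def)
  next
    fix x assume "f (x + a) \<noteq> 0"
    then have "x + a \<in> F.bl N 0" using F.step_funD(3)[OF f] by blast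
    then have "x + a \<in> F.bl M 0" using F.bl_mono[of N M 0] by (auto simp: M_def)
    moreover have "a \<in> F.bl M 0" by (simp add: F.mem_bl_0 M_def)
    ultimately show "x \<in> UNIV \<inter> F.bl M 0" using F.nrm_diff_le[of "x + a" _ a] by (simp add: F.bl_def)
  qed
  then show ?thesis by (auto simp: F.schwartz_def)
qed

lemma distribution_beta_dist:
  assumes n: "n \<ge> 2"
  shows "distribution (beta_dist n :: ('f::nonarch_local_field, 'e::field_char_0) functional)"
proof -
  have lin: "linear_map_on (F.schwartz UNIV) (norm_neg_power n :: ('f, 'e) functional) (*)"
    using distribution_norm_neg_power[OF n] unfolding distribution_def F.test_functions_eq .
  have add: "norm_neg_power n (f + g) = norm_neg_power n f + norm_neg_power n g"
    if "f \<in> F.schwartz UNIV" "g \<in> F.schwartz UNIV" for f g :: "'f \<Rightarrow> 'e"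
    using lin that unfolding linear_map_on_def by blast
  have sc: "norm_neg_power n (fun_scale c f) = c * norm_neg_power n f"
    if "f \<in> F.schwartz UNIV" for c and f :: "'f \<Rightarrow> 'e"
    using lin that unfolding linear_map_on_def by blast
  have tr_add: "(\<lambda>s. (f + g) (s + 1)) = (\<lambda>s. f (s + 1)) + (\<lambda>s. g (s + 1))" for f g :: "'f \<Rightarrow> 'e"
    by (simp add: plus_fun_def)
  have tr_sc: "(\<lambda>s. fun_scale c f (s + 1)) = fun_scale c (\<lambda>s. f (s + 1))" for c and f :: "'f \<Rightarrow> 'e"
    by (simp add: fun_scale_def)
  show ?thesis unfolding distribution_def linear_map_on_def F.test_functions_eq beta_dist_def translate_by_one_def
    tr_add tr_sc
  proof (intro conjI ballI allI)
    fix f g :: "'f \<Rightarrow> 'e" assume fg: "f \<in> F.schwartz UNIV" "g \<in> F.schwartz UNIV"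
    show "(1 - of_nat (residue_order TYPE('f)) ^ (n - 1)) / (1 - of_nat (residue_order TYPE('f)) powi (- int n)) *
        (norm_neg_power n ((\<lambda>s. f (s + 1)) + (\<lambda>s. g (s + 1))) - norm_neg_power n (f + g)) =
      (1 - of_nat (residue_order TYPE('f)) ^ (n - 1)) / (1 - of_nat (residue_order TYPE('f)) powi (- int n)) *
        (norm_neg_power n (\<lambda>s. f (s + 1)) - norm_neg_power n f) +
      (1 - of_nat (residue_order TYPE('f)) ^ (n - 1)) / (1 - of_nat (residue_order TYPE('f)) powi (- int n)) *
        (norm_neg_power n (\<lambda>s. g (s + 1)) - norm_neg_power n g)"
      unfolding add[OF fg] add[OF fg[THEN schwartz_translate]] distrib_left[symmetric]
      by (rule arg_cong2[where f="(*)"]) simp_all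
  next
    fix c :: 'e and f :: "'f \<Rightarrow> 'e" assume f: "f \<in> F.schwartz UNIV"
    show "(1 - of_nat (residue_order TYPE('f)) ^ (n - 1)) / (1 - of_nat (residue_order TYPE('f)) powi (- int n)) *
        (norm_neg_power n (fun_scale c (\<lambda>s. f (s + 1))) - norm_neg_power n (fun_scale c f)) =
      c * ((1 - of_nat (residue_order TYPE('f)) ^ (n - 1)) / (1 - of_nat (residue_order TYPE('f)) powi (- int n)) *
        (norm_neg_power n (\<lambda>s. f (s + 1)) - norm_neg_power n f))"
      unfolding sc[OF f] sc[OF f[THEN schwartz_translate]] right_diff_distrib[symmetric] by (rule mult.left_commute)
  qed
qed

section \<open>Cancellation over large balls and membership in \<open>S_b\<close>\<close>

lemma lev_diff_1:
  assumes "u \<notin> F.bl k (0::'f::nonarch_local_field)" "k \<ge> 0"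
  shows "u - 1 \<notin> F.bl k 0" "F.lev (u - 1) = F.lev u"
proof -
  have u: "u \<noteq> 0" "F.lev u > k" using assms(1) by (auto simp: F.mem_bl_0)
  have 1: "absval (1::'f) = real (residue_order TYPE('f)) powi 0" by simp
  also have "\<dots> < absval u" using F.nrm_lev[OF u(1)] u(2) assms(2) by (simp del: power_int_0_right)
  finally have "absval (u - 1) = absval u" using F.nrm_add_dominant[of "- 1" u] by simp
  then show "F.lev (u - 1) = F.lev u" using F.nrm_lev[OF u(1)] by (intro F.lev_eqI) simp
  show "u - 1 \<notin> F.bl k 0" using \<open>absval (u - 1) = absval u\<close> assms(1) by (simp add: F.bl_def)
qed

text \<open>A ball of radius at least 1 about 0 contains 1, so \<open>u\<close> and
  \<open>u - 1\<close> lie in it together; outside it they have equal norm. Either way the two terms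
  cancel. This is what makes the operator of \<beta> locally finite.\<close>

lemma beta_mean_eq_0: "k \<ge> 0 \<Longrightarrow> beta_mean n k (u :: 'f::nonarch_local_field) = (0 :: 'e::field_char_0)"
proof -
  assume k: "k \<ge> 0"
  show ?thesis
  proof (cases "u \<in> F.bl k 0")
    case True
    have "(1::'f) \<in> F.bl k 0" using k by (simp add: F.bl_def) (metis F.powi_le_iff power_int_0_right)
    then have "u - 1 \<in> F.bl k 0" using True F.nrm_diff_le[of u _ 1] by (simp add: F.bl_def)
    then show ?thesis using True by (simp add: beta_mean_def ball_mean_def)
  next
    case False
    then show ?thesis using lev_diff_1[OF False k] by (simp add: beta_mean_def ball_mean_def)
  qed
qed

text \<open>Where |u| > 1 the norms of \<open>u\<close> and \<open>u - 1\<close> agree, so the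
  density of \<beta> is identically 0 there.\<close>

lemma beta_mean_eq_0_far:
  assumes "u \<notin> F.bl 0 0" "k \<le> 0"
  shows "beta_mean n k (u :: 'f::nonarch_local_field) = (0 :: 'e::field_char_0)"
proof -
  have "u - 1 \<notin> F.bl k 0" "u \<notin> F.bl k 0"
    using assms lev_diff_1(1)[OF assms(1) order_refl] F.bl_mono[OF assms(2), of 0] by auto
  then show ?thesis using lev_diff_1(2)[OF assms(1) order_refl] by (simp add: beta_mean_def ball_mean_def)
qed

lemma beta_dist_ball:
  assumes n: "n \<ge> 2"
  shows "beta_dist n (\<lambda>s. if s \<in> F.bl k (u :: 'f::nonarch_local_field) then 1 else 0 :: 'e::field_char_0) =
     of_nat (residue_order TYPE('f)) powi k * beta_mean n k u"
proof -
  let ?q = "residue_order TYPE('f)"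
  have q: "(of_nat ?q :: 'e) \<noteq> 0" using residue_order_gt_1[where 'f='f] by simp
  have *: "norm_neg_power n (\<lambda>s. if s \<in> F.bl k v then 1 else 0 :: 'e) = of_nat ?q powi k * ball_mean TYPE('e) n k v" for v :: 'f
  proof -
    have "(of_nat ?q :: 'e) powi (- (int n - 1) * k) = of_nat ?q powi k * of_nat ?q powi (- (int n * k))"
      "(of_nat ?q :: 'e) powi (k - int n * F.lev v) = of_nat ?q powi k * of_nat ?q powi (- (int n * F.lev v))"
      using q by (simp_all add: power_int_add[symmetric] algebra_simps)
    then show ?thesis unfolding norm_neg_power_ball[OF n] ball_mean_def by simp
  qed
  have "s + 1 \<in> F.bl k u \<longleftrightarrow> s \<in> F.bl k (u - 1)" for s by (simp add: F.bl_def algebra_simps)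
  then have "translate_by_one (norm_neg_power n) (\<lambda>s. if s \<in> F.bl k u then 1 else 0 :: 'e) =
     norm_neg_power n (\<lambda>s. if s \<in> F.bl k (u - 1) then 1 else 0 :: 'e)"
    by (simp add: translate_by_one_def)
  then show ?thesis unfolding beta_dist_def beta_mean_def * right_diff_distrib[symmetric]
    by (simp only: * right_diff_distrib[symmetric] mult.left_commute)
qed

lemma beta_dist_supported:
  assumes n: "n \<ge> 2"
  shows "supported_in (F.bl 0 0) (beta_dist n :: ('f::nonarch_local_field, 'e::field_char_0) functional)"
  unfolding supported_in_def F.test_functions_eq
proof (intro ballI impI)
  fix f :: "'f \<Rightarrow> 'e" assume "f \<in> F.schwartz UNIV" and z: "\<forall>s\<in>F.bl 0 0. f s = 0"
  then obtain k0 N where "F.step_fun UNIV k0 N f" by (auto simp: F.schwartz_def)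
  \<comment> \<open>Radii are capped at 1 so that a ball centred outside the unit ball stays outside
    it and \<open>beta_mean_eq_0_far\<close> applies.\<close>
  then have f: "F.step_fun UNIV (min 0 k0) N f" by (rule F.step_fun_mono) auto
  define k where "k = min 0 k0"
  obtain T where T: "finite T" "T \<subseteq> F.bl N 0" "inj_on (F.bl k) T"
    "f = (\<lambda>x. \<Sum>b\<in>T. f b * (if x \<in> F.bl k b then 1 else 0))"
    using F.step_fun_decompose[OF f, folded k_def] .
  have "beta_dist n f = beta_dist n (\<lambda>x. \<Sum>b\<in>T. f b * (if x \<in> F.bl k b then 1 else 0))"
    using T(4) by simp
  also have "\<dots> = (\<Sum>b\<in>T. f b * beta_dist n (\<lambda>x. if x \<in> F.bl k b then 1 else 0))"
    by (rule distribution_sum[OF distribution_beta_dist[OF n] T(1)]) (rule F.ball_schwartz)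
  also have "\<dots> = 0"
  proof (rule sum.neutral, intro ballI)
    fix b
    show "f b * beta_dist n (\<lambda>x. if x \<in> F.bl k b then 1 else 0) = 0"
      using z beta_mean_eq_0_far[of b k n, where 'e='e] by (cases "b \<in> F.bl 0 0") (auto simp: beta_dist_ball[OF n] k_def)
  qed
  finally show "beta_dist n f = 0" .
qed

lemma beta_dist_big_ball:
  assumes "n \<ge> 2" "N \<ge> 0"
  shows "beta_dist n (\<lambda>s. if s \<in> F.bl N (0::'f::nonarch_local_field) then 1 else 0 :: 'e::field_char_0) = 0"
  by (simp add: beta_dist_ball[OF assms(1)] beta_mean_eq_0[OF assms(2)])

lemma compactly_supported_beta_dist:
  assumes "n \<ge> 2" shows "compactly_supported (beta_dist n :: ('f::nonarch_local_field, 'e::field_char_0) functional)"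
  unfolding compactly_supported_def using beta_dist_supported[OF assms] F.compact_bl by blast

lemma schwartz_unit_scale:
  assumes "f \<in> F.schwartz UNIV" "absval (u::'f::nonarch_local_field) = 1"
  shows "(\<lambda>t. f (t / u)) \<in> F.schwartz UNIV"
proof -
  obtain k N where f: "F.step_fun UNIV k N f" using assms by (auto simp: F.schwartz_def)
  have bl: "x / u \<in> F.bl j (y / u) \<longleftrightarrow> x \<in> F.bl j y" for x y :: 'f and j
  proof -
    have "absval (x / u - y / u) = absval (x - y)"
      using assms(2) by (metis absval_divide diff_divide_distrib div_by_1)
    then show ?thesis by (simp add: F.bl_def)
  qed
  have "F.step_fun UNIV k N (\<lambda>s. f (s / u))"
    unfolding F.step_fun_def
  proof (intro conjI ballI allI impI)
    fix x y :: 'f assume "y \<in> F.bl k x \<inter> UNIV"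
    then show "f (y / u) = f (x / u)" using F.step_funD(1)[OF f, of "x / u" "y / u"] bl by simp
  next
    fix x assume "f (x / u) \<noteq> 0"
    then have "x / u \<in> F.bl N 0" using F.step_funD(3)[OF f] by blast
    then show "x \<in> UNIV \<inter> F.bl N 0" using bl[of x N 0] by simp
  qed
  then show ?thesis by (auto simp: F.schwartz_def)
qed

text \<open>Multiplication by a unit preserves every ball about 0. Hence the support in the unit
  ball and the vanishing on large balls pass to the dilates of \<beta> and to their averages over
  \<open>U\<close>.\<close>

lemma beta_dist_S_b:
  assumes n: "n \<ge> 2"
  shows "(beta_dist n :: ('f::nonarch_local_field, 'e::field_char_0) functional) \<in> S_b"
  unfolding S_b_def
proof (intro CollectI conjI allI impI distribution_beta_dist[OF n])
  fix U :: "'f set" assume "open_unit_subgroup U"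
  then have U: "absval u = 1" if "u \<in> U" for u using that by (auto simp: open_unit_subgroup_def)
  let ?\<beta> = "beta_dist n :: ('f, 'e) functional"
  have \<beta>0: "?\<beta> g = 0" if "g \<in> F.schwartz UNIV" "\<And>s. s \<in> F.bl 0 0 \<Longrightarrow> g s = 0" for g
    using beta_dist_supported[OF n, where 'f='f and 'e='e] that unfolding supported_in_def F.test_functions_eq by blast
  have unit: "t / u \<in> F.bl j 0 \<longleftrightarrow> t \<in> F.bl j 0" if "u \<in> U" for t u j
    using U[OF that] by (simp add: F.bl_def absval_divide)
  have av_ext: "mult_average U ?\<beta> f = mult_average U ?\<beta> g" if "\<And>u. u \<in> U \<Longrightarrow> ?\<beta> (\<lambda>t. f (t / u)) = ?\<beta> (\<lambda>t. g (t / u))" for f g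
    unfolding mult_average_def using that by (metis (mono_tags, lifting))
  have \<beta>_zero: "?\<beta> (\<lambda>t. 0) = 0"
  proof (rule \<beta>0)
    show "(\<lambda>t. 0 :: 'e) \<in> F.schwartz (UNIV :: 'f set)" using F.ball_schwartz[of 0 0 "0::'e"] by simp
  qed simp
  have av0: "mult_average U ?\<beta> (\<lambda>t. 0) = 0"
    unfolding mult_average_def by (simp add: \<beta>_zero integ_zero cong: if_cong)
  have supp: "supported_in (F.bl 0 0) (mult_average U ?\<beta>)"
    unfolding supported_in_def F.test_functions_eq
  proof (intro ballI impI)
    fix f :: "'f \<Rightarrow> 'e" assume f: "f \<in> F.schwartz UNIV" "\<forall>s\<in>F.bl 0 0. f s = 0"
    have "?\<beta> (\<lambda>t. f (t / u)) = 0" if "u \<in> U" for u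
      using f unit[OF that] by (intro \<beta>0 schwartz_unit_scale U[OF that]) auto
    then have "mult_average U ?\<beta> f = mult_average U ?\<beta> (\<lambda>t. 0)"
      by (intro av_ext) (simp add: \<beta>_zero)
    then show "mult_average U ?\<beta> f = 0" using av0 by simp
  qed
  show "compactly_supported (mult_average U ?\<beta>)"
    unfolding compactly_supported_def using supp F.compact_bl by blast
  have ball0: "mult_average U ?\<beta> (\<lambda>s. if s \<in> F.bl N 0 then 1 else 0) = 0" if "N \<ge> 0" for N
  proof -
    have "mult_average U ?\<beta> (\<lambda>s. if s \<in> F.bl N 0 then 1 else 0) = mult_average U ?\<beta> (\<lambda>t. 0)"
      by (intro av_ext) (simp add: unit \<beta>_zero beta_dist_big_ball[OF n that])
    then show ?thesis using av0 by simp
  qed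
  show "pairing_one (mult_average U ?\<beta>) = 0"
    unfolding pairing_one_def F.test_functions_eq
  proof (rule the_equality)
    show "\<forall>C. compact C \<and> open C \<and> supported_in C (mult_average U ?\<beta>) \<longrightarrow>
      (\<forall>f\<in>F.schwartz UNIV. (\<forall>s\<in>C. f s = 1) \<longrightarrow> mult_average U ?\<beta> f = 0)"
    proof (intro allI impI ballI)
      fix C and f :: "'f \<Rightarrow> 'e"
      assume C: "compact C \<and> open C \<and> supported_in C (mult_average U ?\<beta>)"
        and f: "f \<in> F.schwartz UNIV" "\<forall>s\<in>C. f s = 1"
      obtain M where M: "C \<subseteq> F.bl M 0" using F.compact_bounded C by metis
      define N where "N = max 0 M"
      define g :: "'f \<Rightarrow> 'e" where "g = (\<lambda>s. if s \<in> F.bl N 0 then 1 else 0 :: 'e)"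
      have g: "g \<in> F.schwartz UNIV" unfolding g_def by (rule F.ball_schwartz)
      have CN: "C \<subseteq> F.bl N 0" using M F.bl_mono[of M N 0] by (auto simp: N_def)
      have diff: "(\<lambda>x. \<Sum>i\<in>{True,False}. (if i then 1 else - 1) * (if i then h1 else h2) x) = (\<lambda>x. h1 x - h2 x)"
        for h1 h2 :: "'f \<Rightarrow> 'e" by auto
      have fg: "(\<lambda>x. f x - g x) \<in> F.schwartz UNIV"
        unfolding diff[symmetric] by (rule F.schwartz_sum) (use f g in auto)
      have "\<forall>s\<in>C. f s - g s = 0" using f CN by (auto simp: g_def)
      then have z: "mult_average U ?\<beta> (\<lambda>x. f x - g x) = 0"
        using conjunct2[OF conjunct2[OF C]] fg unfolding supported_in_def F.test_functions_eq by simp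
      \<comment> \<open>The dilate of \<open>g\<close> is \<open>g\<close> itself, the indicator of
        a ball of radius at least 1, which \<beta> annihilates. So passing from \<open>f\<close> to
        \<open>f - g\<close>, which vanishes on \<open>C\<close>, does not change the
        average.\<close>
      have "?\<beta> (\<lambda>t. f (t / u)) = ?\<beta> (\<lambda>t. f (t / u) - g (t / u))" if u: "u \<in> U" for u
      proof -
        have sf: "(\<lambda>t. f (t / u)) \<in> F.schwartz UNIV" "(\<lambda>t. g (t / u)) \<in> F.schwartz UNIV"
          using schwartz_unit_scale f g U[OF u] by blast+
        have "?\<beta> (\<lambda>t. g (t / u)) = 0"
          using beta_dist_big_ball[OF n, of N] unit[OF u] by (simp add: g_def N_def)
        moreover have "?\<beta> (\<lambda>t. \<Sum>i\<in>{True,False}. (if i then 1 else - 1) * (if i then \<lambda>t. f (t / u) else (\<lambda>t. g (t / u))) t) =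
          (\<Sum>i\<in>{True,False}. (if i then 1 else - 1) * ?\<beta> (if i then \<lambda>t. f (t / u) else (\<lambda>t. g (t / u))))"
          by (rule distribution_sum[OF distribution_beta_dist[OF n]]) (use sf in auto)
        ultimately show ?thesis unfolding diff by simp
      qed
      then have "mult_average U ?\<beta> f = mult_average U ?\<beta> (\<lambda>x. f x - g x)" by (rule av_ext)
      then show "mult_average U ?\<beta> f = 0" using z by simp
    qed
  next
    fix v assume v: "\<forall>C. compact C \<and> open C \<and> supported_in C (mult_average U ?\<beta>) \<longrightarrow>
      (\<forall>f\<in>F.schwartz UNIV. (\<forall>s\<in>C. f s = 1) \<longrightarrow> mult_average U ?\<beta> f = v)"
    \<comment> \<open>Uniqueness: the unit ball is one admissible \<open>C\<close>, and its
      indicator already forces the value.\<close>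
    have "mult_average U ?\<beta> (\<lambda>s. if s \<in> F.bl 0 0 then 1 else 0) = v"
      using v[rule_format, of "F.bl 0 0" "\<lambda>s. if s \<in> F.bl 0 0 then 1 else 0"] supp F.compact_bl F.open_bl F.ball_schwartz[of 0 0 "1::'e"]
      by auto
    then show "v = 0" using ball0[of 0] by simp
  qed
qed

text \<open>Masses of the spheres in dimension \<open>n - 1\<close>, in units of the unit ball.\<close>

definition shell_mass :: "'e::field \<Rightarrow> nat \<Rightarrow> nat \<Rightarrow> 'e"
  where "shell_mass Q n i = Q powi ((int n - 1) * int i) - (if i = 0 then 0 else Q powi ((int n - 1) * (int i - 1)))"

lemma sum_shell_mass: "(\<Sum>i\<le>I. shell_mass Q n i) = Q powi ((int n - 1) * int I)"
  by (induction I) (auto simp: shell_mass_def)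

text \<open>The geometric sum over shells, for |s|^-n alone. A new ball containing \<open>u\<close>
  adds a difference of consecutive powers of \<open>Q\<close>; if \<open>u\<close> is on the
  outermost sphere, all means equal |u|^-n and the shell masses add up. The resulting main term does
  not depend on \<open>u\<close>, so it will cancel between \<open>u - 1\<close> and
  \<open>u\<close>.\<close>

lemma sum_ball_mean:
  fixes u :: "'f::nonarch_local_field"
  defines "Q \<equiv> of_nat (residue_order TYPE('f)) :: 'e::field_char_0"
  assumes n: "n \<ge> 2" and u: "u \<in> F.bl (a + int I + 1) 0"
  shows "(\<Sum>i\<le>I. shell_mass Q n i * ball_mean TYPE('e) n (a + int i) u) =
    Q powi (- (int n * a) - int n - int I) -
    (if u \<in> F.bl a 0 then Q powi (- (int n * a)) * (tail_const Q n + Q powi (- int n)) else 0)"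
  using u
proof (induction I)
  case 0
  show ?case
  proof (cases "u \<in> F.bl a 0")
    case True
    have "Q \<noteq> 0" using residue_order_gt_1[where 'f='f] by (simp add: Q_def)
    then have "Q powi (- (int n * a) - int n) = Q powi (- (int n * a)) * Q powi (- int n)"
      by (simp add: power_int_add[symmetric])
    then show ?thesis using True by (simp add: shell_mass_def ball_mean_def Q_def[symmetric] algebra_simps)
  next
    case False
    then have "F.lev u = a + 1" using 0 by (auto simp: F.mem_bl_0)
    then have "- (int n * F.lev u) = - (int n * a) - int n" by (simp add: algebra_simps)
    then show ?thesis using False by (simp add: shell_mass_def ball_mean_def Q_def[symmetric])
  qed
next
  case (Suc I)
  have Q: "Q \<noteq> 0" "Q ^ (n - 1) \<noteq> 1"
    using n unfolding Q_def by (intro of_nat_residue_order; simp)+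
  show ?case
  proof (cases "u \<in> F.bl (a + int I + 1) 0")
    case True
    \<comment> \<open>The shell mass contains the factor \<open>Q ^ (n - 1) - 1\<close>, the
      denominator of \<open>tail_const\<close>; what remains is \<open>- (1 - inverse Q)\<close>
      times a power of \<open>Q\<close>, a difference of two consecutive terms.\<close>
    have "shell_mass Q n (Suc I) * ball_mean TYPE('e) n (a + int (Suc I)) u =
       Q powi (- (int n * a) - int n - int (Suc I)) - Q powi (- (int n * a) - int n - int I)"
    proof -
      have "ball_mean TYPE('e) n (a + int (Suc I)) u = - tail_const Q n * Q powi (- (int n * (a + int I + 1)))"
        using True by (simp add: ball_mean_def Q_def algebra_simps)
      moreover have "shell_mass Q n (Suc I) = (Q ^ (n - 1) - 1) * Q powi ((int n - 1) * int I)"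
      proof -
        have "Q ^ (n - 1) = Q powi (int n - 1)" using n by (simp add: power_int_def nat_diff_distrib)
        then show ?thesis using Q(1) by (simp add: shell_mass_def power_int_add[symmetric] algebra_simps)
      qed
      moreover have "(Q ^ (n - 1) - 1) * tail_const Q n = 1 - inverse Q" using Q(2) by (simp add: tail_const_def)
      moreover have "(c * x) * (- d * y) = - (c * d) * (x * y)" for c d x y :: 'e by simp
      ultimately have "shell_mass Q n (Suc I) * ball_mean TYPE('e) n (a + int (Suc I)) u =
         - (1 - inverse Q) * (Q powi ((int n - 1) * int I) * Q powi (- (int n * (a + int I + 1))))"
        by (simp only:)
      also have "Q powi ((int n - 1) * int I) * Q powi (- (int n * (a + int I + 1))) = Q powi (- (int n * a) - int n - int I)"
      proof -
        have "(int n - 1) * int I + - (int n * (a + int I + 1)) = - (int n * a) - int n - int I"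
          by (simp add: algebra_simps)
        then show ?thesis
          using power_int_add[of Q "(int n - 1) * int I" "- (int n * (a + int I + 1))"] Q(1) by simp
      qed
      finally have *: "shell_mass Q n (Suc I) * ball_mean TYPE('e) n (a + int (Suc I)) u =
         - (1 - inverse Q) * Q powi (- (int n * a) - int n - int I)" .
      have "- 1 + (- (int n * a) - int n - int I) = - (int n * a) - int n - int (Suc I)" by simp
      then have "inverse Q * Q powi (- (int n * a) - int n - int I) = Q powi (- (int n * a) - int n - int (Suc I))"
        using Q(1) power_int_add[of Q "-1" "- (int n * a) - int n - int I"]
        by (simp only:) (simp add: power_int_minus)
      then show ?thesis unfolding * by (simp add: left_diff_distrib)
    qed
    then show ?thesis using Suc.IH[OF True] by simp
  next
    case False
    then have lev: "F.lev u = a + int I + 2" and out: "\<And>j. j \<le> a + int I + 1 \<Longrightarrow> u \<notin> F.bl j 0"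
      using Suc.prems F.bl_mono by (auto simp: F.mem_bl_0)
    \<comment> \<open>Every ball about 0 in the sum misses \<open>u\<close>, so all means have the
      value |u|^-n.\<close>
    have "(\<Sum>i\<le>Suc I. shell_mass Q n i * ball_mean TYPE('e) n (a + int i) u) =
      (\<Sum>i\<le>Suc I. shell_mass Q n i * Q powi (- (int n * (a + int I + 2))))"
      using out lev by (intro sum.cong refl) (simp add: ball_mean_def Q_def)
    also have "\<dots> = Q powi ((int n - 1) * int (Suc I)) * Q powi (- (int n * (a + int I + 2)))"
      by (simp only: sum_distrib_right[symmetric] sum_shell_mass)
    also have "\<dots> = Q powi (- (int n * a) - int n - int (Suc I))"
    proof -
      have "(int n - 1) * int (Suc I) + - (int n * (a + int I + 2)) = - (int n * a) - int n - int (Suc I)"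
        by (simp add: algebra_simps)
      then show ?thesis
        using power_int_add[of Q "(int n - 1) * int (Suc I)" "- (int n * (a + int I + 2))"] Q(1) by simp
    qed
    finally show ?thesis using out[of a] by simp
  qed
qed

text \<open>The starting radius q^(lev u - m) is below |u|, so the correction term of
  \<open>sum_ball_mean\<close> can only come from \<open>u - 1\<close>, and then \<open>u\<close> is
  within q^-m of 1. The bounds on \<open>I\<close> put both \<open>u\<close> and 1 into the
  outermost ball.\<close>

lemma sum_beta_mean:
  fixes u :: "'f::nonarch_local_field"
  defines "Q \<equiv> of_nat (residue_order TYPE('f)) :: 'e::field_char_0"
  assumes n: "n \<ge> 2" and u: "u \<noteq> 0" and m: "m \<ge> 1" and I: "int I \<ge> m - 1" "int I \<ge> m - 1 - F.lev u"
  shows "(\<Sum>i\<le>I. shell_mass Q n i * beta_mean n (F.lev u - m + int i) u) =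
    (if u \<in> F.bl (- m) 1 then Q powi (int n * m) else 0)"
proof -
  define a where "a = F.lev u - m"
  define C where "C = (1 - Q ^ (n - 1)) / (1 - Q powi (- int n))"
  have Q: "Q \<noteq> 0" "Q ^ (n - 1) \<noteq> 1" "Q ^ n \<noteq> 1"
    using n unfolding Q_def by (intro of_nat_residue_order; simp)+
  have 1: "u \<in> F.bl (a + int I + 1) 0" using I by (simp add: F.mem_bl_0 a_def)
  have 2: "u - 1 \<in> F.bl (a + int I + 1) 0"
  proof -
    have "F.lev (1::'f) = 0" by (rule F.lev_eqI) simp
    then have "(1::'f) \<in> F.bl (a + int I + 1) 0" using I by (simp add: F.mem_bl_0 a_def)
    then show ?thesis using \<open>u \<in> F.bl (a + int I + 1) 0\<close> F.nrm_diff_le[of u _ 1] by (simp add: F.bl_def)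
  qed
  have "u \<notin> F.bl a 0" using u m by (simp add: F.mem_bl_0 a_def)
  then have "(\<Sum>i\<le>I. shell_mass Q n i * ball_mean TYPE('e) n (a + int i) (u - 1)) -
     (\<Sum>i\<le>I. shell_mass Q n i * ball_mean TYPE('e) n (a + int i) u) =
     - (if u - 1 \<in> F.bl a 0 then Q powi (- (int n * a)) * (tail_const Q n + Q powi (- int n)) else 0)"
    using sum_ball_mean[OF n 1, where 'e='e] sum_ball_mean[OF n 2, where 'e='e] unfolding Q_def by simp
  moreover have "(\<Sum>i\<le>I. shell_mass Q n i * beta_mean n (a + int i) u) = C * ((\<Sum>i\<le>I. shell_mass Q n i * ball_mean TYPE('e) n (a + int i) (u - 1)) -
     (\<Sum>i\<le>I. shell_mass Q n i * ball_mean TYPE('e) n (a + int i) u))"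
    unfolding beta_mean_def Q_def[symmetric] C_def[symmetric]
    by (simp only: sum_distrib_left sum_subtractf[symmetric] right_diff_distrib mult.left_commute)
  ultimately have "(\<Sum>i\<le>I. shell_mass Q n i * beta_mean n (a + int i) u) =
     (if u - 1 \<in> F.bl a 0 then Q powi (- (int n * a)) * (- C * (tail_const Q n + Q powi (- int n))) else 0)"
    by simp
  \<comment> \<open>This identity is the origin of the constant in \<beta>: \<open>C\<close> is
    minus the inverse of the factor left over by the geometric sum.\<close>
  also have "- C * (tail_const Q n + Q powi (- int n)) = 1"
  proof -
    define X where "X = Q ^ (n - 1)"
    define Y where "Y = Q powi (- int n)"
    have "Q ^ n = Q * X" using n by (simp add: X_def power_eq_if)
    then have Y: "Y = inverse (Q * X)" "Y \<noteq> 1" "X \<noteq> 0" using Q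
      by (auto simp: Y_def X_def power_int_minus simp del: inverse_mult_distrib)
    have "(tail_const Q n + Y) * (X - 1) = (1 - inverse Q) + Y * (X - 1)"
      using Q(2) by (simp add: tail_const_def X_def distrib_right)
    also have "\<dots> = 1 - Y" using Q(1) Y(3) unfolding Y(1) by (simp add: field_simps)
    finally have *: "(tail_const Q n + Y) * (X - 1) = 1 - Y" .
    have "- C * (tail_const Q n + Y) = (tail_const Q n + Y) * (X - 1) / (1 - Y)"
      unfolding C_def X_def[symmetric] Y_def[symmetric] by (simp add: minus_divide_left mult.commute)
    then show ?thesis unfolding * using Y(2) by (simp add: Y_def)
  qed
  \<comment> \<open>Either condition forces |u| = 1; then \<open>a = - m\<close> and the two
    coincide.\<close>
  also have "(if u - 1 \<in> F.bl a 0 then Q powi (- (int n * a)) * 1 else 0) = (if u \<in> F.bl (- m) 1 then Q powi (int n * m) else 0)"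
  proof -
    have l1: "F.lev u = 0" if "absval u = 1" using that by (intro F.lev_eqI) simp
    have "F.lev u = 0" if *: "u - 1 \<in> F.bl a 0"
    proof -
      have "absval (1 - u) < absval u"
        using * m F.nrm_lev[OF u] F.nrm_diff_commute[of 1 u] by (simp add: F.bl_def a_def order_le_less_trans)
      then show ?thesis using F.nrm_eq_if_close[of 1 u] l1 by simp
    qed
    moreover have "F.lev u = 0" if *: "u \<in> F.bl (- m) 1"
    proof -
      have "absval (u - 1) \<le> real (residue_order TYPE('f)) powi (- m)" using * by (simp add: F.bl_def)
      also have "\<dots> < real (residue_order TYPE('f)) powi 0" using m by (simp only: F.powi_less_iff)
      finally show ?thesis using F.nrm_eq_if_close[of u 1] l1 by simp
    qed
    moreover have "u - 1 \<in> F.bl (- m) 0 \<longleftrightarrow> u \<in> F.bl (- m) 1" by (simp add: F.bl_def)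
    ultimately show ?thesis by (auto simp: a_def)
  qed
  finally show ?thesis by (simp add: a_def)
qed

subsection \<open>Functions of class C are invariant under small homotheties\<close>

text \<open>The scale of constancy is proportional to |x|, because a matrix whose entries are within
  q^-m of the identity moves \<open>x\<close> by at most q^-m |x|.\<close>

definition homothety_invariant :: "int \<Rightarrow> ('f::nonarch_local_field^'n::finite \<Rightarrow> 'e) \<Rightarrow> bool"
  where "homothety_invariant m f \<longleftrightarrow> (\<forall>x y. x \<noteq> 0 \<longrightarrow> y \<in> V.bl (V.lev x - m) x \<longrightarrow> f y = f x)"

lemma homothety_invariantD: "homothety_invariant m f \<Longrightarrow> x \<noteq> 0 \<Longrightarrow> y \<in> V.bl (V.lev x - m) x \<Longrightarrow> f y = f x"
  unfolding homothety_invariant_def by blast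

lemma homothety_invariant_mono:
  fixes f :: "'f::nonarch_local_field^'n::finite \<Rightarrow> 'e"
  shows "homothety_invariant m f \<Longrightarrow> m \<le> l \<Longrightarrow> homothety_invariant l f"
  unfolding homothety_invariant_def
proof (intro allI impI)
  fix x y :: "'f^'n" assume f: "\<forall>x y. x \<noteq> 0 \<longrightarrow> y \<in> V.bl (V.lev x - m) x \<longrightarrow> f y = f x" and "m \<le> l" "x \<noteq> 0" "y \<in> V.bl (V.lev x - l) x"
  then have "y \<in> V.bl (V.lev x - m) x" using V.bl_mono[of "V.lev x - l" "V.lev x - m" x] by auto
  then show "f y = f x" using f \<open>x \<noteq> 0\<close> by blast
qed

lemma lev_in_small_ball:
  assumes "x \<noteq> 0" "m \<ge> 1" "y \<in> V.bl (V.lev x - m) (x :: 'f::nonarch_local_field^'n::finite)"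
  shows "y \<noteq> 0" "V.lev y = V.lev x"
proof -
  have "vec_norm (y - x) \<le> real (residue_order TYPE('f)) powi (V.lev x - m)" using assms(3) by (simp add: V.bl_def)
  also have "\<dots> < vec_norm x" using V.nrm_lev[OF assms(1)] assms(2) by simp
  finally have "vec_norm y = vec_norm x" by (rule V.nrm_eq_if_close)
  then show "y \<noteq> 0" using assms(1) V.nrm_eq_0[of x] V.nrm_eq_0[of y] by auto
  show "V.lev y = V.lev x" using \<open>vec_norm y = vec_norm x\<close> V.nrm_lev[OF assms(1)] by (intro V.lev_eqI) simp
qed

global_interpretation FS: vector_space "fun_scale :: 'e::field \<Rightarrow> ('a \<Rightarrow> 'e) \<Rightarrow> 'a \<Rightarrow> 'e"
  by unfold_locales (auto simp: fun_scale_def algebra_simps)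

text \<open>Induction on the generators: a nonzero element that vanishes on the old points spans all
  such elements, so one further point at which it is nonzero suffices.\<close>

lemma finite_span_separating_points:
  fixes B :: "('a \<Rightarrow> 'e::field) set"
  assumes "finite B"
  shows "\<exists>P. finite P \<and> (\<forall>v\<in>FS.span B. (\<forall>p\<in>P. v p = 0) \<longrightarrow> v = 0)"
  using assms
proof (induction B rule: finite_induct)
  case empty
  then show ?case by (intro exI[of _ "{}"]) auto
next
  case (insert b B)
  then obtain P where P: "finite P" "\<And>v. v \<in> FS.span B \<Longrightarrow> (\<forall>p\<in>P. v p = 0) \<Longrightarrow> v = 0" by blast
  show ?case
  proof (cases "\<exists>v\<in>FS.span (insert b B). (\<forall>p\<in>P. v p = 0) \<and> v \<noteq> 0")
    case False
    then show ?thesis using P(1) by blast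
  next
    case True
    then obtain v where v: "v \<in> FS.span (insert b B)" "\<forall>p\<in>P. v p = 0" "v \<noteq> 0" by blast
    then obtain c where c: "v - fun_scale c b \<in> FS.span B" by (auto simp: FS.span_insert)
    have "c \<noteq> 0"
    proof
      assume "c = 0"
      then have "v \<in> FS.span B" using c by simp
      then show False using P(2) v by blast
    qed
    obtain p where p: "v p \<noteq> 0" using v(3) by (auto simp: fun_eq_iff)
    have "u = 0" if u: "u \<in> FS.span (insert b B)" "\<forall>x\<in>insert p P. u x = 0" for u
    proof -
      obtain d where d: "u - fun_scale d b \<in> FS.span B" using u by (auto simp: FS.span_insert)
      define w where "w = u - fun_scale (d / c) v"
      have "w = (u - fun_scale d b) - fun_scale (d / c) (v - fun_scale c b)"
        using \<open>c \<noteq> 0\<close> by (auto simp: w_def fun_scale_def fun_eq_iff field_simps)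
      then have "w \<in> FS.span B" using c d by (simp add: FS.span_diff FS.span_scale)
      moreover have "\<forall>x\<in>P. w x = 0" using u(2) v(2) by (simp add: w_def fun_scale_def)
      ultimately have "w = 0" using P(2) by blast
      then have u_eq: "u = fun_scale (d / c) v" by (simp add: w_def)
      have "d / c * v p = u p" by (subst u_eq) (simp add: fun_scale_def)
      then have "d / c * v p = 0" using u(2) by simp
      then have "d / c = 0" using p by simp
      then show ?thesis unfolding u_eq by (simp only: FS.scale_zero_left)
    qed
    then show ?thesis using P(1) by (intro exI[of _ "insert p P"]) blast
  qed
qed

lemma absval_le_1_iff: "x \<in> ring_of_integers \<longleftrightarrow> absval x \<le> 1"
  by (simp add: ring_of_integers_def)

lemma vec_norm_integral_mult:
  assumes "\<And>i j. A $ i $ j \<in> ring_of_integers"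
  shows "vec_norm (A *v x) \<le> vec_norm (x :: 'f::nonarch_local_field^'n::finite)"
  unfolding vec_norm_le_iff
proof
  fix i
  have "absval (A $ i $ j * x $ j) \<le> vec_norm x" for j
    using assms[of i j] vec_norm_nth[of x j] mult_mono[of "absval (A $ i $ j)" 1 "absval (x $ j)" "vec_norm x"]
    by (simp add: absval_mult absval_le_1_iff)
  then show "absval ((A *v x) $ i) \<le> vec_norm x"
    unfolding matrix_vector_mult_def by (simp add: absval_sum_le)
qed

lemma matrix_inv_unique:
  fixes A B :: "'a::semiring_1^'n::finite^'n"
  assumes "A ** B = mat 1" "B ** A = mat 1" shows "matrix_inv A = B"
  unfolding matrix_inv_def
proof (rule some_equality)
  show "A ** B = mat 1 \<and> B ** A = mat 1" using assms by simp
  fix C assume "A ** C = mat 1 \<and> C ** A = mat 1"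
  then have "C = (B ** A) ** C" using assms by (simp add: matrix_mul_lid)
  also have "\<dots> = B ** (A ** C)" by (simp add: matrix_mul_assoc)
  finally show "C = B" using \<open>A ** C = mat 1 \<and> C ** A = mat 1\<close> by (simp add: matrix_mul_rid)
qed

lemma GL_integers_inv:
  assumes "g \<in> (GL_integers :: ('f::nonarch_local_field^'n::finite^'n) set)"
  shows "matrix_inv g $ i $ j \<in> ring_of_integers" "vec_norm (matrix_inv g *v x) = vec_norm x"
proof -
  obtain B where B: "\<And>i j. B $ i $ j \<in> ring_of_integers" "g ** B = mat 1" "B ** g = mat 1"
    and g: "\<And>i j. g $ i $ j \<in> ring_of_integers" using assms unfolding GL_integers_def by blast
  have inv: "matrix_inv g = B" using matrix_inv_unique B by blast
  then show "matrix_inv g $ i $ j \<in> ring_of_integers" using B by simp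
  have "vec_norm (g *v (B *v x)) \<le> vec_norm (B *v x)" using g by (rule vec_norm_integral_mult)
  then have "vec_norm x \<le> vec_norm (B *v x)" using B by (simp add: matrix_vector_mul_assoc matrix_vector_mul_lid)
  then show "vec_norm (matrix_inv g *v x) = vec_norm x" using vec_norm_integral_mult[OF B(1), of x] inv by simp
qed

text \<open>A translate of \<open>f\<close> by \<open>g\<close> depends only on the entries of the
  inverse of \<open>g\<close> up to q^-m, and integral entries fall into finitely many such balls.
  So the orbit itself is finite, not only its span finite-dimensional.\<close>

lemma homothety_invariant_K_finite:
  fixes f :: "'f::nonarch_local_field^'n::finite \<Rightarrow> 'e::field_char_0"
  assumes inv: "homothety_invariant m f"
  shows "K_finite f"
proof -
  define \<Phi> where "\<Phi> = (\<lambda>(g :: 'f^'n^'n) x. f (matrix_inv g *v x))"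
  define \<Psi> where "\<Psi> = (\<lambda>g :: 'f^'n^'n. (\<chi> i. \<chi> j. F.bl (- m) (matrix_inv g $ i $ j)) :: ('f set)^'n^'n)"
  have "finite (F.bl (- m) ` F.bl 0 (0::'f))" by (rule F.finite_bl_image[OF order_refl])
  then have "finite {v. \<forall>i. v $ i \<in> {w :: ('f set)^'n. \<forall>j. w $ j \<in> F.bl (- m) ` F.bl 0 (0::'f)}}" 
    by (intro finite_vec_components)
  moreover have "\<Psi> ` GL_integers \<subseteq> {v. \<forall>i. v $ i \<in> {w :: ('f set)^'n. \<forall>j. w $ j \<in> F.bl (- m) ` F.bl 0 (0::'f)}}"
  proof -
    have "matrix_inv g $ i $ j \<in> F.bl 0 0" if "g \<in> GL_integers" for g :: "'f^'n^'n" and i j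
      using GL_integers_inv(1)[OF that, of i j] by (simp add: F.bl_def absval_le_1_iff)
    then show ?thesis by (auto simp: \<Psi>_def)
  qed
  ultimately have fin: "finite (\<Psi> ` GL_integers)" using finite_subset by blast
  have eq: "\<Phi> g = \<Phi> h" if gh: "g \<in> GL_integers" "h \<in> GL_integers" "\<Psi> g = \<Psi> h" for g h
  proof
    fix x
    show "\<Phi> g x = \<Phi> h x"
    proof (cases "x = 0")
      case True
      then show ?thesis by (simp add: \<Phi>_def)
    next
      case False
      let ?g = "matrix_inv g" and ?h = "matrix_inv h"
      have n: "vec_norm (?h *v x) = vec_norm x" using GL_integers_inv(2)[OF gh(2)] .
      then have ne: "?h *v x \<noteq> 0" using False V.nrm_eq_0 by metis
      have lev: "V.lev (?h *v x) = V.lev x" using n V.nrm_lev[OF False] by (intro V.lev_eqI) simp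
      have "absval (?g $ i $ j - ?h $ i $ j) \<le> real (residue_order TYPE('f)) powi (- m)" for i j
      proof -
        have "F.bl (- m) (?g $ i $ j) = F.bl (- m) (?h $ i $ j)"
          using gh(3) unfolding \<Psi>_def by (simp add: vec_eq_iff)
        then have "?g $ i $ j \<in> F.bl (- m) (?h $ i $ j)" using F.bl_refl by blast
        then show ?thesis by (simp add: F.bl_def)
      qed
      then have "absval ((?g $ i $ j - ?h $ i $ j) * x $ j) \<le> real (residue_order TYPE('f)) powi (- m) * vec_norm x" for i j
        unfolding absval_mult by (intro mult_mono vec_norm_nth) auto
      moreover have "real (residue_order TYPE('f)) powi (- m) * vec_norm x = real (residue_order TYPE('f)) powi (V.lev x - m)"
        using V.nrm_lev[OF False] residue_order_gt_1[where 'f='f] by (simp add: power_int_add[symmetric])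
      ultimately have "absval ((?g *v x - ?h *v x) $ i) \<le> real (residue_order TYPE('f)) powi (V.lev x - m)" for i
        unfolding matrix_vector_mult_def
        by (simp add: sum_subtractf[symmetric] left_diff_distrib[symmetric] absval_sum_le)
      then have "?g *v x \<in> V.bl (V.lev (?h *v x) - m) (?h *v x)"
        unfolding lev V.bl_def by (simp add: vec_norm_le_iff)
      then show ?thesis unfolding \<Phi>_def using homothety_invariantD[OF inv ne] by blast
    qed
  qed
  have "\<Phi> ` GL_integers \<subseteq> (\<lambda>p. \<Phi> (SOME g. g \<in> GL_integers \<and> \<Psi> g = p)) ` (\<Psi> ` GL_integers)"
  proof
    fix v assume "v \<in> \<Phi> ` GL_integers"
    then obtain g where g: "g \<in> GL_integers" "v = \<Phi> g" by auto
    have s: "(SOME h. h \<in> GL_integers \<and> \<Psi> h = \<Psi> g) \<in> GL_integers \<and> \<Psi> (SOME h. h \<in> GL_integers \<and> \<Psi> h = \<Psi> g) = \<Psi> g"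
      using someI[of "\<lambda>h. h \<in> GL_integers \<and> \<Psi> h = \<Psi> g" g] g(1) by blast
    then have "v = \<Phi> (SOME h. h \<in> GL_integers \<and> \<Psi> h = \<Psi> g)" using eq[OF g(1) conjunct1[OF s] conjunct2[OF s, symmetric]] g(2) by simp
    then show "v \<in> (\<lambda>p. \<Phi> (SOME g. g \<in> GL_integers \<and> \<Psi> g = p)) ` (\<Psi> ` GL_integers)" using g(1) by blast
  qed
  then have "finite (\<Phi> ` GL_integers)" using fin finite_surj by blast
  then show ?thesis unfolding K_finite_def \<Phi>_def by blast
qed

text \<open>The inverse of \<open>g\<close> is the identity plus u e_i^T. With u = (y - x) / x_i it
  carries \<open>x\<close> to \<open>y\<close>, so these matrices connect the points of one
  class.\<close>

lemma rank_one_GL_integers: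
  fixes u :: "'f::nonarch_local_field^'n::finite"
  assumes u: "vec_norm u < 1"
  obtains g where "g \<in> GL_integers" "\<And>p. matrix_inv g *v p = p + p $ i *s u"
proof -
  define E where "E = (\<lambda>c :: 'f. (\<chi> a b. (if a = b then 1 else 0) + (if b = i then c * u $ a else 0)) :: 'f^'n^'n)"
  have E_mult: "E c *v p = p + (c * p $ i) *s u" for c p
  proof -
    have "(\<Sum>j\<in>UNIV. ((if a = j then 1 else 0) + (if j = i then c * u $ a else 0)) * p $ j) = p $ a + c * u $ a * p $ i" for a
      by (simp add: distrib_right sum.distrib if_distrib[of "\<lambda>x. x * _"] cong: if_cong)
    then show ?thesis by (simp add: E_def matrix_vector_mult_def vec_eq_iff algebra_simps)
  qed
  have ui: "absval (u $ i) < 1" using vec_norm_nth[of u i] u by linarith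
  have abs1: "absval (1 + u $ i) = 1" using F.nrm_add_dominant[of "u $ i" 1] ui by simp
  then have ne: "1 + u $ i \<noteq> 0" by auto
  \<comment> \<open>The Sherman-Morrison formula: the identity plus c u e_i^T inverts the identity
    plus u e_i^T. As |u_i| < 1, the number 1 + u_i is a unit, so \<open>c\<close> is
    integral.\<close>
  define c where "c = - inverse (1 + u $ i)"
  have c1: "absval c = 1" using abs1 by (simp add: c_def absval_inverse)
  have c: "c * (1 + u $ i) = - 1" using ne by (simp add: c_def)
  have integral: "E d $ a $ b \<in> ring_of_integers" if d: "absval d = 1" for d a b
  proof -
    have "absval (d * u $ a) \<le> 1" using d vec_norm_nth[of u a] u by (simp add: absval_mult)
    then show ?thesis unfolding E_def absval_le_1_iff by (auto intro!: F.nrm_add_le)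
  qed
  have cu: "c + 1 + c * u $ i = 0" using c by (simp add: algebra_simps)
  have "(E c ** E 1) *v p = mat 1 *v p" "(E 1 ** E c) *v p = mat 1 *v p" for p
  proof -
    have "E c *v (E 1 *v p) = p + ((c + 1 + c * u $ i) * p $ i) *s u"
      unfolding E_mult by (simp add: vec_eq_iff algebra_simps)
    then show "(E c ** E 1) *v p = mat 1 *v p" unfolding cu by (simp add: matrix_vector_mul_assoc matrix_vector_mul_lid)
    have "E 1 *v (E c *v p) = p + ((c + 1 + c * u $ i) * p $ i) *s u"
      unfolding E_mult by (simp add: vec_eq_iff algebra_simps)
    then show "(E 1 ** E c) *v p = mat 1 *v p" unfolding cu by (simp add: matrix_vector_mul_assoc matrix_vector_mul_lid)
  qed
  then have inv: "E c ** E 1 = mat 1" "E 1 ** E c = mat 1" unfolding matrix_eq by blast+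
  have "E c \<in> GL_integers" unfolding GL_integers_def using integral[OF c1] integral[of 1] inv by auto
  moreover have "matrix_inv (E c) *v p = p + p $ i *s u" for p
    using matrix_inv_unique[OF inv] E_mult[of 1 p] by simp
  ultimately show thesis using that by blast
qed

text \<open>For \<open>x\<close> and \<open>y\<close> in one class there is a \<open>g\<close> whose
  inverse takes \<open>x\<close> to \<open>y\<close> and moves every separating point so little that
  \<open>f\<close> does not change there. The translate minus \<open>f\<close> lies in the span and
  vanishes at the separating points, hence everywhere, in particular at \<open>x\<close>.\<close>

lemma K_finite_homothety_invariant:
  fixes f :: "'f::nonarch_local_field^'n::finite \<Rightarrow> 'e::field_char_0"
  assumes "K_finite f" and lc: "locally_constant_on (- {0}) f"
  obtains m where "m \<ge> 1" "homothety_invariant m f"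
proof -
  define V where "V = FS.span ((\<lambda>g x. f (matrix_inv g *v x)) ` GL_integers)"
  obtain B where B: "finite B" "V = FS.span B"
    using assms(1) unfolding K_finite_def V_def by blast
  obtain P where P: "finite P" "\<And>v. v \<in> V \<Longrightarrow> (\<forall>p\<in>P. v p = 0) \<Longrightarrow> v = 0"
    using finite_span_separating_points[OF B(1)] B(2) by blast
  have "\<exists>k. \<forall>y\<in>V.bl k p. f y = f p" if p: "p \<noteq> 0" for p
  proof -
    obtain U where U: "openin (top_of_set (- {0})) U" "p \<in> U" "f constant_on U"
      using lc p unfolding locally_constant_on_def by auto
    then have "open U" using openin_open_trans[OF U(1)] by auto
    then obtain k where k: "\<forall>y. vec_norm (y - p) \<le> real (residue_order TYPE('f)) powi k \<longrightarrow> y \<in> U"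
      using U(2) V.open_iff by blast
    obtain c where c: "\<And>y. y \<in> U \<Longrightarrow> f y = c" using U(3) unfolding constant_on_def by blast
    have "f y = f p" if "y \<in> V.bl k p" for y
      using that k c[of y] c[OF U(2)] by (simp add: V.bl_def)
    then show ?thesis by blast
  qed
  then obtain k where k: "\<And>p y. p \<noteq> 0 \<Longrightarrow> y \<in> V.bl (k p) p \<Longrightarrow> f y = f p" by metis
  \<comment> \<open>\<open>k p\<close> gives a radius of constancy of \<open>f\<close> at
    \<open>p\<close>; the entry 1 ensures \<open>m \<ge> 1\<close>, which keeps the rank one
    perturbation in \<open>GL_integers\<close>.\<close>
  define m where "m = Max (insert 1 ((\<lambda>p. V.lev p - k p) ` P))"
  have m1: "m \<ge> 1" and mP: "V.lev p - m \<le> k p" if "p \<in> P" for p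
    using P(1) that Max_ge[of "insert 1 ((\<lambda>p. V.lev p - k p) ` P)" "V.lev p - k p"] unfolding m_def by (auto simp: algebra_simps)
  have m1: "m \<ge> 1" unfolding m_def using P(1) by simp
  have "homothety_invariant m f"
    unfolding homothety_invariant_def
  proof (intro allI impI)
    fix x y :: "'f^'n" assume x: "x \<noteq> 0" and y: "y \<in> V.bl (V.lev x - m) x"
    let ?q = "real (residue_order TYPE('f))"
    have q: "?q > 1" using residue_order_gt_1[where 'f='f] by simp
    obtain i where i: "x $ i \<noteq> 0" "absval (x $ i) = vec_norm x" using ex_max_coordinate[OF x] by metis
    define u where "u = inverse (x $ i) *s (y - x)"
    have un: "vec_norm u \<le> ?q powi (- m)"
    proof -
      have "vec_norm u = inverse (vec_norm x) * vec_norm (y - x)"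
        unfolding u_def vec_norm_scale absval_inverse i(2) ..
      also have "\<dots> \<le> inverse (vec_norm x) * ?q powi (V.lev x - m)"
        using y by (intro mult_left_mono) (auto simp: V.bl_def)
      also have "\<dots> = ?q powi (- m)" using q by (simp add: V.nrm_lev[OF x] power_int_diff power_int_minus field_simps)
      finally show ?thesis .
    qed
    also have "\<dots> < ?q powi 0" using m1 by (simp only: V.powi_less_iff)
    finally have "vec_norm u < 1" by simp
    then obtain g where g: "g \<in> GL_integers" "\<And>p. matrix_inv g *v p = p + p $ i *s u"
      using rank_one_GL_integers by blast
    have "mat 1 \<in> (GL_integers :: ('f^'n^'n) set)"
    proof -
      have "\<forall>i j. (mat 1 :: 'f^'n^'n) $ i $ j \<in> ring_of_integers" by (simp add: mat_def ring_of_integers_def)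
      then show ?thesis unfolding GL_integers_def using matrix_mul_lid[of "mat 1 :: 'f^'n^'n"] by blast
    qed
    moreover have "matrix_inv (mat 1) = (mat 1 :: 'f^'n^'n)" by (rule matrix_inv_unique) simp_all
    ultimately have "f \<in> V" unfolding V_def
      by (intro FS.span_base image_eqI[of _ _ "mat 1"]) (simp_all add: matrix_vector_mul_lid)
    moreover have "(\<lambda>x. f (matrix_inv g *v x)) \<in> V" unfolding V_def using g(1) by (intro FS.span_base imageI)
    ultimately have "(\<lambda>x. f (matrix_inv g *v x)) - f \<in> V" unfolding V_def by (intro FS.span_diff)
    moreover have "f (matrix_inv g *v p) = f p" if "p \<in> P" for p
    proof (cases "p = 0")
      case True
      then show ?thesis by simp
    next
      case False
      have "vec_norm (matrix_inv g *v p - p) = absval (p $ i) * vec_norm u" by (simp add: g(2) vec_norm_scale)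
      also have "\<dots> \<le> ?q powi V.lev p * ?q powi (- m)"
        using vec_norm_nth[of p i] un V.nrm_lev[OF False] by (intro mult_mono) auto
      also have "\<dots> = ?q powi (V.lev p - m)" using q by (simp add: power_int_add[symmetric])
      finally have "matrix_inv g *v p \<in> V.bl (V.lev p - m) p" by (simp add: V.bl_def)
      then show ?thesis using k[OF False] V.bl_mono[OF mP[OF that], of p] by blast
    qed
    ultimately have "(\<lambda>x. f (matrix_inv g *v x)) - f = 0" by (intro P(2)) simp_all
    then have "f (matrix_inv g *v x) = f x" by (metis minus_apply right_minus_eq zero_fun_apply)
    moreover have "matrix_inv g *v x = y"
      unfolding g(2) u_def using i(1) by (simp add: vec_eq_iff)
    ultimately show "f y = f x" by simp
  qed
  then show thesis using that m1 by blast
qed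

text \<open>The access to \<open>C_space\<close> used from here on: the group action is replaced by
  a metric condition.\<close>

lemma C_space_iff: "f \<in> C_space \<longleftrightarrow> f 0 = 0 \<and> (\<exists>m\<ge>1. homothety_invariant m f)"
  for f :: "'f::nonarch_local_field^'n::finite \<Rightarrow> 'e::field_char_0"
proof
  assume "f \<in> C_space"
  then show "f 0 = 0 \<and> (\<exists>m\<ge>1. homothety_invariant m f)"
    unfolding C_space_def using K_finite_homothety_invariant[of f] by blast
next
  assume f: "f 0 = 0 \<and> (\<exists>m\<ge>1. homothety_invariant m f)"
  then obtain m where m: "m \<ge> 1" "homothety_invariant m f" by blast
  have "locally_constant_on (- {0}) f"
    unfolding locally_constant_on_def
  proof
    fix x :: "'f^'n" assume "x \<in> - {0}"
    then have x: "x \<noteq> 0" by simp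
    have sub: "V.bl (V.lev x - m) x \<subseteq> - {0}" using lev_in_small_ball(1)[OF x m(1)] by auto
    have "openin (top_of_set (- {0})) (V.bl (V.lev x - m) x)"
      using sub V.open_bl by (auto simp: openin_open intro!: exI[of _ "V.bl (V.lev x - m) x"])
    moreover have "f constant_on V.bl (V.lev x - m) x"
      unfolding constant_on_def using homothety_invariantD[OF m(2) x] by blast
    ultimately show "\<exists>U. openin (top_of_set (- {0})) U \<and> x \<in> U \<and> f constant_on U" using V.bl_refl by blast
  qed
  then show "f \<in> C_space" unfolding C_space_def using f homothety_invariant_K_finite[OF m(2)] by simp
qed

lemma vec_val_eq: "x \<noteq> 0 \<Longrightarrow> vec_val x = - of_int (V.lev (x :: 'f::nonarch_local_field^'n::finite))"
proof -
  assume x: "x \<noteq> 0"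
  have q: "real (residue_order TYPE('f)) > 1" using residue_order_gt_1[where 'f='f] by simp
  have "real (residue_order TYPE('f)) powi V.lev x = real (residue_order TYPE('f)) powr of_int (V.lev x)"
    using q by (simp add: powr_real_of_int')
  then have "log (real (residue_order TYPE('f))) (vec_norm x) = of_int (V.lev x)"
    using q by (simp add: V.nrm_lev[OF x])
  then show ?thesis by (simp add: vec_val_def)
qed

lemma C_plus_iff: "f \<in> C_plus \<longleftrightarrow> f 0 = 0 \<and> (\<exists>m\<ge>1. homothety_invariant m f) \<and> (\<exists>N. \<forall>x. f x \<noteq> 0 \<longrightarrow> V.lev x \<le> N)"
  for f :: "'f::nonarch_local_field^'n::finite \<Rightarrow> 'e::field_char_0"
proof -
  have "(\<exists>R. \<forall>x. f x \<noteq> 0 \<longrightarrow> vec_val x \<ge> R) \<longleftrightarrow> (\<exists>N. \<forall>x. f x \<noteq> 0 \<longrightarrow> V.lev x \<le> N)" if f0: "f 0 = 0"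
  proof
    assume "\<exists>R. \<forall>x. f x \<noteq> 0 \<longrightarrow> vec_val x \<ge> R"
    then obtain R where R: "\<And>x. f x \<noteq> 0 \<Longrightarrow> vec_val x \<ge> R" by blast
    have "V.lev x \<le> \<lfloor>- R\<rfloor>" if "f x \<noteq> 0" for x
      using R[OF that] vec_val_eq[of x] that f0 by (cases "x = 0") (auto simp: le_floor_iff)
    then show "\<exists>N. \<forall>x. f x \<noteq> 0 \<longrightarrow> V.lev x \<le> N" by blast
  next
    assume "\<exists>N. \<forall>x. f x \<noteq> 0 \<longrightarrow> V.lev x \<le> N"
    then obtain N where N: "\<And>x. f x \<noteq> 0 \<Longrightarrow> V.lev x \<le> N" by blast
    have "vec_val x \<ge> - of_int N" if "f x \<noteq> 0" for x
      using N[OF that] vec_val_eq[of x] that f0 by (cases "x = 0") auto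
    then show "\<exists>R. \<forall>x. f x \<noteq> 0 \<longrightarrow> vec_val x \<ge> R" by blast
  qed
  then show ?thesis unfolding C_plus_def mem_Collect_eq C_space_iff by blast
qed

lemma C_minus_iff: "f \<in> C_minus \<longleftrightarrow> f 0 = 0 \<and> (\<exists>m\<ge>1. homothety_invariant m f) \<and> (\<exists>N. \<forall>x. f x \<noteq> 0 \<longrightarrow> N \<le> V.lev x)"
  for f :: "'f::nonarch_local_field^'n::finite \<Rightarrow> 'e::field_char_0"
proof -
  have "(\<exists>R. \<forall>x. f x \<noteq> 0 \<longrightarrow> vec_val x \<le> R) \<longleftrightarrow> (\<exists>N. \<forall>x. f x \<noteq> 0 \<longrightarrow> N \<le> V.lev x)" if f0: "f 0 = 0"
  proof
    assume "\<exists>R. \<forall>x. f x \<noteq> 0 \<longrightarrow> vec_val x \<le> R"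
    then obtain R where R: "\<And>x. f x \<noteq> 0 \<Longrightarrow> vec_val x \<le> R" by blast
    have "\<lceil>- R\<rceil> \<le> V.lev x" if "f x \<noteq> 0" for x
      using R[OF that] vec_val_eq[of x] that f0 by (cases "x = 0") (auto simp: ceiling_le_iff)
    then show "\<exists>N. \<forall>x. f x \<noteq> 0 \<longrightarrow> N \<le> V.lev x" by blast
  next
    assume "\<exists>N. \<forall>x. f x \<noteq> 0 \<longrightarrow> N \<le> V.lev x"
    then obtain N where N: "\<And>x. f x \<noteq> 0 \<Longrightarrow> N \<le> V.lev x" by blast
    have "vec_val x \<le> - of_int N" if "f x \<noteq> 0" for x
      using N[OF that] vec_val_eq[of x] that f0 by (cases "x = 0") auto
    then show "\<exists>R. \<forall>x. f x \<noteq> 0 \<longrightarrow> vec_val x \<le> R" by blast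
  qed
  then show ?thesis unfolding C_minus_def mem_Collect_eq C_space_iff by blast
qed

subsection \<open>Kernels of the Radon transform and of its inverse\<close>

text \<open>Division by the measure q^k of the ball absorbs the factor q^(-lev x) that the
  hyperplane measure of \<open>x\<close> puts in front; with it \<open>pairing_kernel\<close>
  becomes symmetric.\<close>

definition functional_mean :: "('f::nonarch_local_field, 'e::field_char_0) functional \<Rightarrow> int \<Rightarrow> 'f \<Rightarrow> 'e"
  where "functional_mean \<gamma> k u = of_nat (residue_order TYPE('f)) powi (- k) * \<gamma> (\<lambda>s. if s \<in> F.bl k u then 1 else 0)"

definition pairing_kernel :: "('f::nonarch_local_field, 'e::field_char_0) functional \<Rightarrow> int \<Rightarrow> 'f^'n::finite \<Rightarrow> 'f^'n \<Rightarrow> 'e"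
  where "pairing_kernel \<gamma> m b x = functional_mean \<gamma> (V.lev b + V.lev x - m) (scalar_product b x)"

lemma pairing_kernel_commute: "pairing_kernel \<gamma> m b x = pairing_kernel \<gamma> m x b"
  by (simp add: pairing_kernel_def add.commute scalar_product_commute)

lemma functional_mean_beta_dist: "n \<ge> 2 \<Longrightarrow> functional_mean (beta_dist n) k u = (beta_mean n k (u :: 'f::nonarch_local_field) :: 'e::field_char_0)"
  using of_nat_residue_order(1)[where 'f='f and 'e='e]
  by (simp add: functional_mean_def beta_dist_ball power_int_minus)

lemma functional_mean_cong: "u \<in> F.bl k v \<Longrightarrow> functional_mean \<gamma> k u = functional_mean \<gamma> k v"
  unfolding functional_mean_def by (simp add: F.bl_eq)

lemma hyperplane_integral_schwartz:
  fixes x :: "'f::nonarch_local_field^'n::finite" and f :: "'f^'n \<Rightarrow> 'e::field_char_0"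
  assumes x: "x \<noteq> 0" and f: "f \<in> V.schwartz UNIV"
  shows "(\<lambda>s. hyperplane_integral x s f) \<in> F.schwartz UNIV"
proof -
  obtain k N where kN: "V.step_fun UNIV k N f" using f by (auto simp: V.schwartz_def)
  obtain T where T: "finite T" "T \<subseteq> V.bl N 0" "inj_on (V.bl k) T"
    "f = (\<lambda>x. \<Sum>b\<in>T. f b * (if x \<in> V.bl k b then 1 else 0))"
    using V.step_fun_decompose[OF kN] .
  have "hyperplane_integral x s f = (\<Sum>b\<in>T. f b * (if s \<in> F.bl (k + V.lev x) (scalar_product x b)
     then 1 * of_nat (residue_order TYPE('f)) powi ((int CARD('n) - 1) * k - V.lev x) else 0))" for s
  proof -
    have "hyperplane_integral x s f = hyperplane_integral x s (\<lambda>x. \<Sum>b\<in>T. f b * (if x \<in> V.bl k b then 1 else 0))"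
      using T(4) by simp
    also have "\<dots> = (\<Sum>b\<in>T. f b * hyperplane_integral x s (\<lambda>x. if x \<in> V.bl k b then 1 else 0))"
      by (rule hyperplane_integral_sum[OF x T(1)]) (rule V.ball_schwartz)
    finally show ?thesis unfolding hyperplane_integral_ball[OF x] .
  qed
  then show ?thesis by (simp only:) (intro F.schwartz_sum T(1) F.ball_schwartz)
qed

lemma functional_sum:
  fixes \<gamma> :: "('f::nonarch_local_field, 'e::field_char_0) functional" and f :: "'i \<Rightarrow> 'f^'n::finite \<Rightarrow> 'e"
  assumes \<gamma>: "distribution \<gamma>" and x: "x \<noteq> 0" and I: "finite I" "\<And>i. i \<in> I \<Longrightarrow> f i \<in> V.schwartz UNIV"
  shows "\<gamma> (\<lambda>s. hyperplane_integral x s (\<lambda>\<xi>. \<Sum>i\<in>I. c i * f i \<xi>)) = (\<Sum>i\<in>I. c i * \<gamma> (\<lambda>s. hyperplane_integral x s (f i)))"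
proof -
  have "hyperplane_integral x s (\<lambda>\<xi>. \<Sum>i\<in>I. c i * f i \<xi>) = (\<Sum>i\<in>I. c i * hyperplane_integral x s (f i))" for s
    by (rule hyperplane_integral_sum[OF x I])
  then have "\<gamma> (\<lambda>s. hyperplane_integral x s (\<lambda>\<xi>. \<Sum>i\<in>I. c i * f i \<xi>)) = \<gamma> (\<lambda>s. \<Sum>i\<in>I. c i * hyperplane_integral x s (f i))"
    by simp
  also have "\<dots> = (\<Sum>i\<in>I. c i * \<gamma> (\<lambda>s. hyperplane_integral x s (f i)))"
    by (rule distribution_sum[OF \<gamma> I(1)]) (rule hyperplane_integral_schwartz[OF x I(2)])
  finally show ?thesis .
qed

text \<open>Pushed forward along \<xi> \<mapsto> \<xi> \<cdot> x, the indicator of a ball becomes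
  its volume q^(n k) times the normalized indicator of the image ball, of radius q^(k + lev
  x).\<close>

lemma functional_ball:
  fixes \<gamma> :: "('f::nonarch_local_field, 'e::field_char_0) functional" and x :: "'f^'n::finite"
  assumes \<gamma>: "distribution \<gamma>" and x: "x \<noteq> 0"
  shows "\<gamma> (\<lambda>s. hyperplane_integral x s (\<lambda>\<xi>. if \<xi> \<in> V.bl k b then 1 else 0)) =
    of_nat (residue_order TYPE('f)) powi (int CARD('n) * k) * functional_mean \<gamma> (k + V.lev x) (scalar_product b x)"
proof -
  let ?Q = "of_nat (residue_order TYPE('f)) :: 'e"
  have Q: "?Q \<noteq> 0" by (rule of_nat_residue_order)
  define c where "c = ?Q powi ((int CARD('n) - 1) * k - V.lev x)"
  define g where "g = (\<lambda>s. if s \<in> F.bl (k + V.lev x) (scalar_product b x) then 1 else 0 :: 'e)"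
  have "(\<lambda>s. hyperplane_integral x s (\<lambda>\<xi>. if \<xi> \<in> V.bl k b then 1 else 0 :: 'e)) = (\<lambda>s. \<Sum>i\<in>{()}. c * g s)"
    unfolding hyperplane_integral_ball[OF x] by (auto simp: c_def g_def scalar_product_commute)
  then have "\<gamma> (\<lambda>s. hyperplane_integral x s (\<lambda>\<xi>. if \<xi> \<in> V.bl k b then 1 else 0)) = \<gamma> (\<lambda>s. \<Sum>i\<in>{()}. c * g s)"
    by (rule arg_cong)
  also have "\<dots> = (\<Sum>i\<in>{()}. c * \<gamma> g)"
    by (rule distribution_sum[OF \<gamma>]) (simp_all add: g_def F.ball_schwartz)
  also have "\<dots> = ?Q powi (int CARD('n) * k) * functional_mean \<gamma> (k + V.lev x) (scalar_product b x)"
  proof -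
    have e: "(int CARD('n) - 1) * k - V.lev x = int CARD('n) * k + - (k + V.lev x)" by (simp add: algebra_simps)
    have "c = ?Q powi (int CARD('n) * k) * ?Q powi (- (k + V.lev x))"
      unfolding c_def e using Q by (intro power_int_add) simp
    then show ?thesis by (simp add: functional_mean_def g_def)
  qed
  finally show ?thesis .
qed

section \<open>Homothety classes and sums over their representatives\<close>

definition hom_class :: "int \<Rightarrow> 'f::nonarch_local_field^'n::finite \<Rightarrow> ('f^'n) set"
  where "hom_class m x = V.bl (V.lev x - m) x"

text \<open>The volume of \<open>hom_class m x\<close>, taken in \<open>'e\<close>.\<close>

definition class_vol :: "int \<Rightarrow> 'f::nonarch_local_field^'n::finite \<Rightarrow> 'e::field_char_0"
  where "class_vol m x = of_nat (residue_order TYPE('f)) powi (int CARD('n) * (V.lev x - m))"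

definition annulus :: "int \<Rightarrow> int \<Rightarrow> ('f::nonarch_local_field^'n::finite) set"
  where "annulus L J = {x. x \<noteq> 0 \<and> L \<le> V.lev x \<and> V.lev x \<le> J}"

definition class_reps :: "int \<Rightarrow> int \<Rightarrow> int \<Rightarrow> ('f::nonarch_local_field^'n::finite) set \<Rightarrow> bool"
  where "class_reps m L J T \<longleftrightarrow> finite T \<and> T \<subseteq> annulus L J \<and> inj_on (hom_class m) T \<and>
     (\<forall>x\<in>annulus L J. \<exists>t\<in>T. x \<in> hom_class m t)"

lemma hom_class_refl [simp]: "x \<in> hom_class m x"
  by (simp add: hom_class_def)

lemma hom_class_lev:
  assumes "m \<ge> 1" "x \<noteq> 0" "y \<in> hom_class m x"
  shows "y \<noteq> 0" "V.lev y = V.lev x" "hom_class m y = hom_class m x"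
proof -
  show "y \<noteq> 0" "V.lev y = V.lev x"
    by (rule lev_in_small_ball[OF assms(2,1) assms(3)[unfolded hom_class_def]])+
  then show "hom_class m y = hom_class m x"
    using V.bl_eq[of y "V.lev x - m" x] assms(3) unfolding hom_class_def by simp
qed

lemma hom_class_annulus:
  assumes "m \<ge> 1" "y \<in> hom_class m x" "x \<in> annulus L J" shows "y \<in> annulus L J"
  using hom_class_lev[OF assms(1) _ assms(2)] assms(3) by (auto simp: annulus_def)

text \<open>The radius of a class is proportional to the norm of its points, so the smallest in the
  annulus is q^(L - m). Balls of that radius refine all classes, and only finitely many of them meet
  the bounded annulus.\<close>

lemma ex_class_reps:
  assumes m: "m \<ge> 1"
  shows "\<exists>T :: ('f::nonarch_local_field^'n::finite) set. class_reps m L J T"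
proof -
  let ?A = "annulus L J :: ('f^'n) set"
  have sub: "?A \<subseteq> V.bl J 0" by (auto simp: annulus_def V.mem_bl_0)
  have "hom_class m ` ?A \<subseteq> (\<lambda>B. \<Union>y\<in>B \<inter> ?A. hom_class m y) ` (V.bl (L - m) ` ?A)"
  proof
    fix C assume "C \<in> hom_class m ` ?A"
    then obtain x where x: "x \<in> ?A" "C = hom_class m x" by auto
    have eq: "hom_class m y = C" if "y \<in> V.bl (L - m) x \<inter> ?A" for y
    proof -
      have "y \<in> hom_class m x"
        using that x(1) V.bl_mono[of "L - m" "V.lev x - m" x] by (auto simp: hom_class_def annulus_def)
      then show ?thesis using hom_class_lev(3)[OF m] x by (auto simp: annulus_def)
    qed
    have "hom_class m ` (V.bl (L - m) x \<inter> ?A) = (\<lambda>_. C) ` (V.bl (L - m) x \<inter> ?A)"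
      using eq by (rule image_cong[OF refl])
    also have "\<dots> = {C}" by (rule image_constant[of x]) (use x(1) in simp)
    finally have "C = (\<Union>y\<in>V.bl (L - m) x \<inter> ?A. hom_class m y)" by simp
    then show "C \<in> (\<lambda>B. \<Union>y\<in>B \<inter> ?A. hom_class m y) ` (V.bl (L - m) ` ?A)" using x(1) by blast
  qed
  then have fin: "finite (hom_class m ` ?A)"
    by (rule finite_subset[OF _ finite_imageI[OF V.finite_bl_image[OF sub]]])
  obtain T where T: "T \<subseteq> ?A" "inj_on (hom_class m) T" "hom_class m ` ?A = hom_class m ` T"
    using subset_image_inj[of "hom_class m ` ?A" "hom_class m" ?A] by auto
  have "finite T" using fin T by (metis finite_imageD)
  moreover have "\<exists>t\<in>T. x \<in> hom_class m t" if "x \<in> ?A" for x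
    using that T(3) hom_class_refl by (metis imageE image_eqI)
  ultimately show ?thesis unfolding class_reps_def using T by blast
qed

lemma class_decompose:
  fixes f :: "'f::nonarch_local_field^'n::finite \<Rightarrow> 'e::field_char_0"
  assumes m: "m \<ge> 1" and f: "homothety_invariant m f" and T: "class_reps m L J T"
  shows "(if x \<in> annulus L J then f x else 0) = (\<Sum>t\<in>T. f t * (if x \<in> hom_class m t then 1 else 0))"
proof (cases "x \<in> annulus L J")
  case True
  then obtain t where t: "t \<in> T" "x \<in> hom_class m t" using T unfolding class_reps_def by blast
  then have t0: "t \<noteq> 0" using T unfolding class_reps_def annulus_def by blast
  have "x \<in> hom_class m b \<longleftrightarrow> b = t" if b: "b \<in> T" for b
  proof
    assume "x \<in> hom_class m b"
    moreover have "b \<noteq> 0" using T b unfolding class_reps_def annulus_def by blast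
    ultimately have "hom_class m b = hom_class m t"
      using hom_class_lev(3)[OF m _ t(2)] hom_class_lev(3)[OF m, of b x] t0 by auto
    then show "b = t" using T t(1) b unfolding class_reps_def inj_on_def by blast
  qed (use t in simp)
  then have "(\<Sum>b\<in>T. f b * (if x \<in> hom_class m b then 1 else 0)) = (\<Sum>b\<in>T. if b = t then f b else 0)"
    by (intro sum.cong) simp_all
  also have "\<dots> = f t" using t(1) T by (simp add: class_reps_def)
  also have "\<dots> = f x" using homothety_invariantD[OF f t0 t(2)[unfolded hom_class_def]] by simp
  finally show ?thesis using True by simp
next
  case False
  have "x \<notin> hom_class m t" if "t \<in> T" for t
    using hom_class_annulus[OF m, of x t L J] T that False unfolding class_reps_def by blast
  then have "(\<Sum>t\<in>T. f t * (if x \<in> hom_class m t then 1 else 0)) = 0" by (intro sum.neutral) simp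
  then show ?thesis using False by simp
qed

text \<open>The matrix form of both operators: \<open>eval_one\<close> in place of
  \<open>\<gamma>\<close> gives the Radon transform, \<open>beta_dist\<close> its inverse, with
  classes weighted by their volumes.\<close>

lemma functional_class_sum:
  fixes \<gamma> :: "('f::nonarch_local_field, 'e::field_char_0) functional" and f :: "'f^'n::finite \<Rightarrow> 'e"
  assumes \<gamma>: "distribution \<gamma>" and x: "x \<noteq> 0" and m: "m \<ge> 1" and f: "homothety_invariant m f" and T: "class_reps m L J T"
  shows "\<gamma> (\<lambda>s. hyperplane_integral x s (\<lambda>\<xi>. if \<xi> \<in> annulus L J then f \<xi> else 0)) =
    (\<Sum>t\<in>T. class_vol m t * f t * pairing_kernel \<gamma> m t x)"
proof -
  have "\<gamma> (\<lambda>s. hyperplane_integral x s (\<lambda>\<xi>. if \<xi> \<in> annulus L J then f \<xi> else 0)) =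
    \<gamma> (\<lambda>s. hyperplane_integral x s (\<lambda>\<xi>. \<Sum>t\<in>T. f t * (if \<xi> \<in> hom_class m t then 1 else 0)))"
    by (simp only: class_decompose[OF m f T])
  also have "\<dots> = (\<Sum>t\<in>T. f t * \<gamma> (\<lambda>s. hyperplane_integral x s (\<lambda>\<xi>. if \<xi> \<in> hom_class m t then 1 else 0)))"
    using T unfolding class_reps_def hom_class_def by (intro functional_sum[OF \<gamma> x]) (auto intro: V.ball_schwartz)
  also have "\<dots> = (\<Sum>t\<in>T. class_vol m t * f t * pairing_kernel \<gamma> m t x)"
    unfolding hom_class_def functional_ball[OF \<gamma> x] pairing_kernel_def class_vol_def
    by (intro sum.cong) (simp_all add: algebra_simps)
  finally show ?thesis .
qed

definition eval_one :: "('f::nonarch_local_field, 'e::field_char_0) functional"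
  where "eval_one g = g 1"

lemma distribution_eval_one: "distribution eval_one"
  by (simp add: distribution_def linear_map_on_def eval_one_def fun_scale_def)

lemma lev_on_hyperplane:
  assumes "x \<in> hyperplane \<xi> 1" "\<xi> \<noteq> (0 :: 'f::nonarch_local_field^'n::finite)"
  shows "x \<noteq> 0" "- V.lev \<xi> \<le> V.lev x"
proof -
  show x: "x \<noteq> 0" using assms(1) by (auto simp: hyperplane_def)
  have "real (residue_order TYPE('f)) powi 0 = absval (scalar_product \<xi> x)" using assms(1) by (simp add: hyperplane_def)
  also have "\<dots> \<le> vec_norm \<xi> * vec_norm x" by (rule absval_scalar_product)
  also have "\<dots> = real (residue_order TYPE('f)) powi (V.lev \<xi> + V.lev x)"
    using V.nrm_lev[OF assms(2)] V.nrm_lev[OF x] residue_order_gt_1[where 'f='f] by (simp add: power_int_add)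
  finally show "- V.lev \<xi> \<le> V.lev x" by (simp only: V.powi_le_iff)
qed

text \<open>The cut-off at \<open>L\<close> loses nothing, since 1 = |\<xi> \<cdot> x| \<le> |\<xi>|
  |x| on the hyperplane; the one at \<open>J\<close> is the bounded support.\<close>

lemma radon_class_sum:
  fixes f :: "'f::nonarch_local_field^'n::finite \<Rightarrow> 'e::field_char_0"
  assumes \<xi>: "\<xi> \<noteq> 0" and m: "m \<ge> 1" and f: "homothety_invariant m f" "\<And>x. f x \<noteq> 0 \<Longrightarrow> V.lev x \<le> J"
    and L: "L \<le> - V.lev \<xi>" and T: "class_reps m L J T"
  shows "radon f \<xi> = (\<Sum>t\<in>T. class_vol m t * f t * pairing_kernel eval_one m t \<xi>)"
proof -
  have "hyperplane_integral \<xi> 1 f = hyperplane_integral \<xi> 1 (\<lambda>x. if x \<in> annulus L J then f x else 0)"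
  proof (rule hyperplane_integral_cong)
    fix x assume "x \<in> hyperplane \<xi> 1"
    then show "f x = (if x \<in> annulus L J then f x else 0)"
      using lev_on_hyperplane[of x \<xi>] \<xi> L f(2)[of x] by (auto simp: annulus_def)
  qed
  then show ?thesis
    using functional_class_sum[OF distribution_eval_one \<xi> m f(1) T] \<xi> by (simp add: radon_def eval_one_def)
qed

lemma pairing_kernel_homothety_invariant:
  fixes b :: "'f::nonarch_local_field^'n::finite"
  assumes "m \<ge> 1" "b \<noteq> 0"
  shows "homothety_invariant m (pairing_kernel \<gamma> m b)"
  unfolding homothety_invariant_def
proof (intro allI impI)
  fix x y :: "'f^'n" assume x: "x \<noteq> 0" "y \<in> V.bl (V.lev x - m) x"
  have "scalar_product b y \<in> F.bl (V.lev b + V.lev x - m) (scalar_product b x)"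
    using scalar_product_bl[OF assms(2) x(2)] by (simp add: algebra_simps)
  then show "pairing_kernel \<gamma> m b y = pairing_kernel \<gamma> m b x"
    unfolding pairing_kernel_def lev_in_small_ball(2)[OF x(1) assms(1) x(2)] by (rule functional_mean_cong)
qed

text \<open>The form given by \<open>x\<close> maps each ball of constancy onto a ball of radius at
  least 1, and \<beta> has mean 0 there.\<close>

lemma functional_beta_coarse:
  fixes \<psi> :: "'f::nonarch_local_field^'n::finite \<Rightarrow> 'e::field_char_0"
  assumes n: "CARD('n) \<ge> 2" and x: "x \<noteq> 0" and \<psi>: "V.step_fun UNIV k N \<psi>" and k: "k + V.lev x \<ge> 0"
  shows "beta_dist CARD('n) (\<lambda>s. hyperplane_integral x s \<psi>) = 0"
proof -
  obtain T where T: "finite T" "T \<subseteq> V.bl N 0" "inj_on (V.bl k) T"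
    "\<psi> = (\<lambda>x. \<Sum>b\<in>T. \<psi> b * (if x \<in> V.bl k b then 1 else 0))"
    using V.step_fun_decompose[OF \<psi>] .
  have "beta_dist CARD('n) (\<lambda>s. hyperplane_integral x s \<psi>) =
     beta_dist CARD('n) (\<lambda>s. hyperplane_integral x s (\<lambda>x. \<Sum>b\<in>T. \<psi> b * (if x \<in> V.bl k b then 1 else 0)))"
    using T(4) by simp
  also have "\<dots> = (\<Sum>b\<in>T. \<psi> b * beta_dist CARD('n) (\<lambda>s. hyperplane_integral x s (\<lambda>x. if x \<in> V.bl k b then 1 else 0)))"
    by (rule functional_sum[OF distribution_beta_dist[OF n] x T(1)]) (rule V.ball_schwartz)
  also have "\<dots> = 0"
    unfolding functional_ball[OF distribution_beta_dist[OF n] x] functional_mean_beta_dist[OF n] by (simp add: beta_mean_eq_0[OF k])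
  finally show ?thesis .
qed

text \<open>Splits \<Lambda> into the ball of radius q^J and the rest. On the rest |\<xi>| \<ge>
  q^(J+1), so \<open>\<phi>\<close> is constant on balls of radius q^(J+1-m), and by the hypothesis
  on \<open>J\<close> this part contributes 0. The value is therefore the same for all larger
  subgroups.\<close>

lemma A_partial_class_sum:
  fixes \<phi> :: "'f::nonarch_local_field^'n::finite \<Rightarrow> 'e::field_char_0"
  assumes n: "CARD('n) \<ge> 2" and x: "x \<noteq> 0" and m: "m \<ge> 1"
    and \<phi>: "\<phi> 0 = 0" "homothety_invariant m \<phi>" "\<And>\<xi>. \<phi> \<xi> \<noteq> 0 \<Longrightarrow> L \<le> V.lev \<xi>"
    and J: "J + 1 - m + V.lev x \<ge> 0" and T: "class_reps m L J T"
    and \<Lambda>: "open_compact_subgroup \<Lambda>" "V.bl J 0 \<subseteq> \<Lambda>"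
  shows "A_partial (beta_dist CARD('n)) \<phi> x \<Lambda> = (\<Sum>t\<in>T. class_vol m t * \<phi> t * pairing_kernel (beta_dist CARD('n)) m t x)"
proof -
  define k where "k = J + 1 - m"
  define \<psi> where "\<psi> = (\<lambda>\<xi>. if \<xi> \<in> \<Lambda> - V.bl J 0 then \<phi> \<xi> else 0)"
  define \<theta> where "\<theta> = (\<lambda>\<xi>. if \<xi> \<in> annulus L J then \<phi> \<xi> else 0)"
  have add: "a + b \<in> \<Lambda>" "- a \<in> \<Lambda>" if "a \<in> \<Lambda>" "b \<in> \<Lambda>" for a b using \<Lambda>(1) that unfolding open_compact_subgroup_def by auto
  have kJ: "V.bl k 0 \<subseteq> V.bl J 0" using m by (intro V.bl_mono) (simp add: k_def)
  \<comment> \<open>The rest is a union of cosets of the ball of radius q^J, hence stable under the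
    smaller shifts in question.\<close>
  have mem: "y \<in> \<Lambda> - V.bl J 0" if "y' \<in> \<Lambda> - V.bl J 0" "y \<in> V.bl k y'" for y y'
  proof -
    have "y - y' \<in> V.bl J 0" using that(2) kJ by (auto simp: V.bl_def)
    moreover then have "y' + (y - y') \<in> \<Lambda>" using that(1) \<Lambda>(2) add by blast
    moreover have "y \<notin> V.bl J 0"
    proof
      assume "y \<in> V.bl J 0"
      then have "y - (y - y') \<in> V.bl J 0" using \<open>y - y' \<in> V.bl J 0\<close> V.nrm_diff_le[of y _ "y - y'"] by (simp add: V.bl_def)
      then show False using that(1) by simp
    qed
    ultimately show ?thesis by simp
  qed
  obtain N where N: "\<Lambda> \<subseteq> V.bl N 0" using V.compact_bounded \<Lambda>(1) unfolding open_compact_subgroup_def by metis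
  have \<psi>: "V.step_fun UNIV k N \<psi>"
    unfolding V.step_fun_def
  proof (intro conjI ballI allI impI)
    fix y y' :: "'f^'n" assume "y \<in> V.bl k y' \<inter> UNIV"
    then have y: "y \<in> V.bl k y'" "y' \<in> V.bl k y" using V.bl_sym by auto
    show "\<psi> y = \<psi> y'"
    proof (cases "y' \<in> \<Lambda> - V.bl J 0")
      case True
      then have y': "y' \<noteq> 0" "V.lev y' > J" by (auto simp: V.mem_bl_0)
      then have "y \<in> V.bl (V.lev y' - m) y'" using y(1) V.bl_mono[of k "V.lev y' - m" y'] by (auto simp: k_def)
      then have "\<phi> y = \<phi> y'" by (rule homothety_invariantD[OF \<phi>(2) y'(1)])
      then show ?thesis using True mem[OF True y(1)] by (simp add: \<psi>_def)
    next
      case False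
      then have "y \<notin> \<Lambda> - V.bl J 0" using mem[OF _ y(2)] by blast
      then show ?thesis using False by (simp only: \<psi>_def if_False)
    qed
  next
    fix y assume "\<psi> y \<noteq> 0"
    then show "y \<in> UNIV \<inter> V.bl N 0" using N by (auto simp: \<psi>_def split: if_splits)
  qed
  have \<theta>: "\<theta> \<in> V.schwartz UNIV"
    unfolding \<theta>_def class_decompose[OF m \<phi>(2) T] using T unfolding class_reps_def hom_class_def
    by (intro V.schwartz_sum V.ball_schwartz) auto
  have "(if \<xi> \<in> \<Lambda> then \<phi> \<xi> else 0) = (\<Sum>i\<in>{True,False}. 1 * (if i then \<theta> else \<psi>) \<xi>)" for \<xi>
  proof (cases "\<phi> \<xi> = 0")
    case False
    then have "\<xi> \<noteq> 0" "L \<le> V.lev \<xi>" using \<phi> by auto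
    then show ?thesis using \<Lambda>(2) by (auto simp: \<theta>_def \<psi>_def annulus_def V.mem_bl_0)
  qed (simp add: \<theta>_def \<psi>_def)
  then have "A_partial (beta_dist CARD('n)) \<phi> x \<Lambda> =
     beta_dist CARD('n) (\<lambda>s. hyperplane_integral x s (\<lambda>\<xi>. \<Sum>i\<in>{True,False}. 1 * (if i then \<theta> else \<psi>) \<xi>))"
    by (simp only: A_partial_def)
  also have "\<dots> = (\<Sum>i\<in>{True,False}. 1 * beta_dist CARD('n) (\<lambda>s. hyperplane_integral x s (if i then \<theta> else \<psi>)))"
    using \<theta> \<psi> by (intro functional_sum[OF distribution_beta_dist[OF n] x]) (auto simp: V.schwartz_def)
  also have "\<dots> = beta_dist CARD('n) (\<lambda>s. hyperplane_integral x s \<theta>)"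
    using functional_beta_coarse[OF n x \<psi>] J by (simp add: k_def)
  also have "\<dots> = (\<Sum>t\<in>T. class_vol m t * \<phi> t * pairing_kernel (beta_dist CARD('n)) m t x)"
    unfolding \<theta>_def by (rule functional_class_sum[OF distribution_beta_dist[OF n] x m \<phi>(2) T])
  finally show ?thesis .
qed

lemma ball_open_compact_subgroup: "open_compact_subgroup (V.bl J (0 :: 'f::nonarch_local_field^'n::finite))"
  unfolding open_compact_subgroup_def using V.open_bl[of J 0] V.compact_bl[of J 0] V.nrm_add_le by (auto simp: V.bl_def)

lemma open_compact_subgroup_hull:
  assumes "open_compact_subgroup (L :: ('f::nonarch_local_field^'n::finite) set)"
  obtains N where "J \<le> N" "L \<subseteq> V.bl N 0"
proof -
  obtain N where N: "L \<subseteq> V.bl N 0" using V.compact_bounded assms unfolding open_compact_subgroup_def by metis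
  then have "L \<subseteq> V.bl (max J N) 0" using V.bl_mono[of N "max J N" 0] by auto
  then show thesis using that[of "max J N"] by simp
qed

lemma A_op_class_sum:
  fixes \<phi> :: "'f::nonarch_local_field^'n::finite \<Rightarrow> 'e::field_char_0"
  assumes n: "CARD('n) \<ge> 2" and x: "x \<noteq> 0" and m: "m \<ge> 1"
    and \<phi>: "\<phi> 0 = 0" "homothety_invariant m \<phi>" "\<And>\<xi>. \<phi> \<xi> \<noteq> 0 \<Longrightarrow> L \<le> V.lev \<xi>"
    and J: "J + 1 - m + V.lev x \<ge> 0" and T: "class_reps m L J T"
  shows "A_op (beta_dist CARD('n)) \<phi> x = (\<Sum>t\<in>T. class_vol m t * \<phi> t * pairing_kernel (beta_dist CARD('n)) m t x)"
proof -
  define v where "v = (\<Sum>t\<in>T. class_vol m t * \<phi> t * pairing_kernel (beta_dist CARD('n)) m t x)"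
  have stab: "A_partial (beta_dist CARD('n)) \<phi> x \<Lambda> = v" if "open_compact_subgroup \<Lambda>" "V.bl J 0 \<subseteq> \<Lambda>" for \<Lambda>
    unfolding v_def by (rule A_partial_class_sum[OF n x m \<phi> J T that]) 
  have "(THE v. \<exists>L. open_compact_subgroup L \<and>
        (\<forall>L'. open_compact_subgroup L' \<and> L \<subseteq> L' \<longrightarrow> A_partial (beta_dist CARD('n)) \<phi> x L' = v)) = v"
  proof (rule the_equality)
    show "\<exists>L. open_compact_subgroup L \<and>
        (\<forall>L'. open_compact_subgroup L' \<and> L \<subseteq> L' \<longrightarrow> A_partial (beta_dist CARD('n)) \<phi> x L' = v)"
      using stab ball_open_compact_subgroup by blast
  next
    fix w assume "\<exists>L. open_compact_subgroup L \<and>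
        (\<forall>L'. open_compact_subgroup L' \<and> L \<subseteq> L' \<longrightarrow> A_partial (beta_dist CARD('n)) \<phi> x L' = w)"
    then obtain L where L: "open_compact_subgroup L"
      "\<And>L'. open_compact_subgroup L' \<Longrightarrow> L \<subseteq> L' \<Longrightarrow> A_partial (beta_dist CARD('n)) \<phi> x L' = w" by blast
    \<comment> \<open>Two stabilizing values are compared on one ball that contains both
      subgroups.\<close>
    obtain N where N: "J \<le> N" "L \<subseteq> V.bl N 0" using open_compact_subgroup_hull[OF L(1)] .
    have "A_partial (beta_dist CARD('n)) \<phi> x (V.bl N 0) = w" by (rule L(2)[OF ball_open_compact_subgroup N(2)])
    moreover have "A_partial (beta_dist CARD('n)) \<phi> x (V.bl N 0) = v"
      by (rule stab[OF ball_open_compact_subgroup V.bl_mono[OF N(1)]])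
    ultimately show "w = v" by simp
  qed
  then show ?thesis using x by (simp add: A_op_def v_def)
qed

section \<open>Averages over balls in a hyperplane\<close>

lemma scalar_product_slice_schwartz:
  fixes \<xi> :: "'f::nonarch_local_field^'n::finite" and g :: "'f \<Rightarrow> 'e::zero"
  assumes \<xi>: "\<xi> \<noteq> 0" and g: "\<And>u v. u \<in> F.bl r v \<Longrightarrow> g u = g v"
  shows "(\<lambda>x. if x \<in> V.bl j 0 then g (scalar_product \<xi> x) else 0) \<in> V.schwartz UNIV"
proof -
  define k where "k = min j (r - V.lev \<xi>)"
  have "V.step_fun UNIV k j (\<lambda>x. if x \<in> V.bl j 0 then g (scalar_product \<xi> x) else 0)"
    unfolding V.step_fun_def
  proof (intro conjI ballI allI impI)
    fix x y :: "'f^'n" assume "y \<in> V.bl k x \<inter> UNIV"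
    then have y: "y \<in> V.bl j x" "y \<in> V.bl (r - V.lev \<xi>) x"
      using V.bl_mono[of k j x] V.bl_mono[of k "r - V.lev \<xi>" x] by (auto simp: k_def)
    have "x \<in> V.bl j 0 \<longleftrightarrow> y \<in> V.bl j 0"
      using V.bl_eq[OF y(1)] V.bl_eq_iff V.bl_sym by metis
    moreover have "g (scalar_product \<xi> y) = g (scalar_product \<xi> x)"
      using scalar_product_bl[OF \<xi> y(2)] by (intro g) simp
    ultimately show "(if y \<in> V.bl j 0 then g (scalar_product \<xi> y) else 0) =
       (if x \<in> V.bl j 0 then g (scalar_product \<xi> x) else 0)" by simp
  qed (auto split: if_splits)
  then show ?thesis by (auto simp: V.schwartz_def)
qed

lemma hyperplane_integral_ball_0:
  fixes \<eta> :: "'f::nonarch_local_field^'n::finite" and c :: "'e::field_char_0"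
  assumes "\<eta> \<noteq> 0" "j \<ge> - V.lev \<eta>"
  shows "hyperplane_integral \<eta> 1 (\<lambda>x. if x \<in> V.bl j 0 then c else 0) =
    c * of_nat (residue_order TYPE('f)) powi ((int CARD('n) - 1) * j - V.lev \<eta>)"
proof -
  have "F.lev (1::'f) = 0" by (rule F.lev_eqI) simp
  then have "(1::'f) \<in> F.bl (j + V.lev \<eta>) (scalar_product \<eta> 0)" using assms(2) by (simp add: F.mem_bl_0)
  then show ?thesis by (simp add: hyperplane_integral_ball[OF assms(1)])
qed

text \<open>
  Splitting \<open>\<xi> = \<lambda>\<eta> + \<zeta>\<close> with \<open>\<zeta>\<^sub>i = 0\<close> at a coordinate where \<open>\<bar>\<eta>\<^sub>i\<bar>\<close> is maximal: on the hyperplane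
  \<open>\<eta> \<cdot> x = 1\<close>, \<open>\<bar>x\<bar> \<le> q\<^sup>j\<close>, the values \<open>\<xi> \<cdot> x\<close> are equidistributed in the ball about \<open>\<lambda>\<close> of radius \<open>\<bar>\<zeta>\<bar> q\<^sup>j\<close>.
\<close>

lemma hyperplane_average:
  fixes \<eta> \<xi> :: "'f::nonarch_local_field^'n::finite" and \<gamma> :: "('f, 'e::field_char_0) functional"
  assumes \<gamma>: "distribution \<gamma>" and \<eta>: "\<eta> \<noteq> 0" and i: "\<eta> $ i \<noteq> 0" "absval (\<eta> $ i) = vec_norm \<eta>"
    and j: "j \<ge> - V.lev \<eta>" and \<zeta>: "\<zeta> = \<xi> - l *s \<eta>" and l: "l = \<xi> $ i / \<eta> $ i"
  shows "hyperplane_integral \<eta> 1 (\<lambda>x. if x \<in> V.bl j 0 then functional_mean \<gamma> r (scalar_product \<xi> x) else 0) =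
    functional_mean \<gamma> (if \<zeta> = 0 then r else max r (j + V.lev \<zeta>)) l *
    of_nat (residue_order TYPE('f)) powi ((int CARD('n) - 1) * j - V.lev \<eta>)"
proof -
  let ?Q = "of_nat (residue_order TYPE('f)) :: 'e"
  let ?H = "hyperplane \<eta> 1"
  have Q: "?Q \<noteq> 0" by (rule of_nat_residue_order)
  have sp: "scalar_product \<xi> x = l + scalar_product \<zeta> x" if "x \<in> ?H" for x
    using that by (simp add: \<zeta> scalar_product_diff_left scalar_product_scale_left hyperplane_def)
  have spH: "scalar_product \<xi> x \<in> F.bl (j + V.lev \<zeta>) l" if "x \<in> ?H" "x \<in> V.bl j 0" "\<zeta> \<noteq> 0" for x
    using scalar_product_bl[OF that(3,2)] sp[OF that(1)] by (simp add: F.bl_def)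
  \<comment> \<open>Either the spread of \<xi> \<cdot> x on the ball is within the resolution
    \<open>r\<close> of the mean and the integrand is constant, or the spread is larger and
    averaging the means gives the mean over the larger ball.\<close>
  show ?thesis
  proof (cases "\<zeta> = 0 \<or> j + V.lev \<zeta> \<le> r")
    case True
    have "functional_mean \<gamma> r (scalar_product \<xi> x) = functional_mean \<gamma> r l" if "x \<in> ?H" "x \<in> V.bl j 0" for x
    proof (rule functional_mean_cong)
      show "scalar_product \<xi> x \<in> F.bl r l"
      proof (cases "\<zeta> = 0")
        case True
        then show ?thesis using sp[OF that(1)] by simp
      next
        case False
        then show ?thesis using spH[OF that] F.bl_mono[of "j + V.lev \<zeta>" r l] \<open>\<zeta> = 0 \<or> j + V.lev \<zeta> \<le> r\<close> by blast
      qed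
    qed
    then have "hyperplane_integral \<eta> 1 (\<lambda>x. if x \<in> V.bl j 0 then functional_mean \<gamma> r (scalar_product \<xi> x) else 0) =
      hyperplane_integral \<eta> 1 (\<lambda>x. if x \<in> V.bl j 0 then functional_mean \<gamma> r l else 0)"
      by (intro hyperplane_integral_cong) simp
    also have "(if \<zeta> = 0 then r else max r (j + V.lev \<zeta>)) = r" using True by auto
    ultimately show ?thesis by (simp add: hyperplane_integral_ball_0[OF \<eta> j])
  next
    case False
    then have z: "\<zeta> \<noteq> 0" and sr: "r < j + V.lev \<zeta>" by auto
    define s where "s = j + V.lev \<zeta>"
    have \<xi>0: "\<xi> \<noteq> 0"
    proof
      assume "\<xi> = 0"
      then have "\<zeta> = 0" by (simp add: \<zeta> l vec_eq_iff)
      then show False using z by simp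
    qed
    obtain T where T: "finite T" "T \<subseteq> F.bl s l" "inj_on (F.bl r) T"
      "F.bl r ` T = F.bl r ` F.bl s l" "\<forall>x\<in>F.bl s l. \<exists>t\<in>T. x \<in> F.bl r t"
      using F.obtain_transversal[OF order_refl, of s l r] .
    have cardT: "of_nat (card T) = ?Q powi (s - r)"
    proof -
      let ?q = "of_nat (residue_order TYPE('f)) :: rat"
      have q: "?q \<noteq> 0" by (rule of_nat_residue_order)
      have "r \<le> s" using sr by (simp add: s_def)
      then have "F.saturated r UNIV (F.bl s l)" using F.bl_saturated[of r s UNIV l] by simp
      then have "haar (F.bl s l) = of_nat (F.num_balls r (F.bl s l)) * ?q powi r"
        by (rule haar_saturated[OF _ order_refl])
      moreover have "F.num_balls r (F.bl s l) = card T"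
        using T(3,4) card_image[of "F.bl r" T] by (simp add: F.num_balls_def)
      ultimately have "of_nat (card T) = ?q powi s / ?q powi r" using q by (simp add: haar_ball field_simps)
      also have "\<dots> = ?q powi (s - r)" using q by (simp add: power_int_diff)
      finally have "of_nat (card T) = ?q powi (s - r)" .
      from arg_cong[OF this, of "of_rat :: rat \<Rightarrow> 'e"] show ?thesis by (simp add: of_rat_powi)
    qed
    \<comment> \<open>The part of the ball on which \<xi> \<cdot> x stays in one ball of radius q^r.
      Equidistribution means that all of these, for \<open>t\<close> in \<open>F.bl s l\<close>,
      have the same measure on the hyperplane.\<close>
    define Y where "Y = (\<lambda>t. {x \<in> V.bl j 0. scalar_product \<xi> x \<in> F.bl r t})"
    have Y_schwartz: "(\<lambda>x. if x \<in> Y t then 1 else 0 :: 'e) \<in> V.schwartz UNIV" for t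
    proof -
      have "(\<lambda>x. if x \<in> Y t then 1 else 0 :: 'e) =
        (\<lambda>x. if x \<in> V.bl j 0 then (\<lambda>u. if u \<in> F.bl r t then 1 else 0) (scalar_product \<xi> x) else 0)"
        by (auto simp: Y_def)
      also have "\<dots> \<in> V.schwartz UNIV"
      proof (rule scalar_product_slice_schwartz[OF \<xi>0])
        fix u v :: 'f assume "u \<in> F.bl r v"
        then have "u \<in> F.bl r t \<longleftrightarrow> v \<in> F.bl r t" using F.bl_eq_iff F.bl_sym by metis
        then show "(if u \<in> F.bl r t then 1 else 0 :: 'e) = (if v \<in> F.bl r t then 1 else 0)" by simp
      qed
      finally show ?thesis .
    qed
    have Y_co: "Y t \<inter> ?H \<in> compact_opens ?H" for t
    proof -
      define k where "k = min j (r - V.lev \<xi>)"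
      have "y \<in> Y t" if "x \<in> Y t" "y \<in> V.bl k x" for x y
      proof -
        have y: "y \<in> V.bl j x" "y \<in> V.bl (r - V.lev \<xi>) x"
          using that(2) V.bl_mono[of k j x] V.bl_mono[of k "r - V.lev \<xi>" x] by (auto simp: k_def)
        have "y \<in> V.bl j 0" using V.bl_eq[of x j 0] y(1) that(1) by (auto simp: Y_def)
        moreover have "scalar_product \<xi> y \<in> F.bl r t"
          using scalar_product_bl[OF \<xi>0 y(2)] F.bl_eq[of "scalar_product \<xi> x" r t] that(1) by (auto simp: Y_def)
        ultimately show ?thesis by (simp add: Y_def)
      qed
      then have "V.saturated k UNIV (Y t)" unfolding V.saturated_def by blast
      then have "V.saturated k ?H (Y t \<inter> ?H)" by (rule saturated_Int)
      moreover have "Y t \<inter> ?H \<subseteq> V.bl j 0" by (auto simp: Y_def)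
      ultimately show ?thesis by (rule V.saturated_compact_opens[OF closed_hyperplane])
    qed
    define y where "y = (of_rat (hyperplane_measure \<eta> (Y l \<inter> ?H)) :: 'e)"
    obtain i' where i': "\<zeta> $ i' \<noteq> 0" "absval (\<zeta> $ i') = vec_norm \<zeta>" using ex_max_coordinate[OF z] by metis
    have zi: "\<zeta> $ i = 0" using i by (simp add: \<zeta> l)
    have shift: "hyperplane_measure \<eta> (Y t \<inter> ?H) = hyperplane_measure \<eta> (Y l \<inter> ?H)" if t: "t \<in> F.bl s l" for t
    proof -
      define e where "e = (t - l) / \<zeta> $ i'"
      \<comment> \<open>A vector tangent to the hyperplanes of \<open>\<eta>\<close> that raises
        \<xi> \<cdot> x by \<open>t - l\<close>. The step is taken where \<open>\<zeta>\<close> is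
        largest, to keep |w| \<le> q^j, and is corrected in coordinate \<open>i\<close>: this leaves
        \<zeta> \<cdot> w alone since \<open>\<zeta> $ i = 0\<close>, and is small since
        \<open>\<eta>\<close> is largest there.\<close>
      define w :: "'f^'n" where "w = axis i' e - axis i (e * (\<eta> $ i' / \<eta> $ i))"
      have w\<eta>: "scalar_product \<eta> w = 0" using i(1) by (simp add: w_def scalar_product_diff scalar_product_axis)
      have w\<zeta>: "scalar_product \<zeta> w = t - l" using i'(1) zi by (simp add: w_def scalar_product_diff scalar_product_axis e_def)
      have w\<xi>: "scalar_product \<xi> w = t - l"
      proof -
        have "\<xi> = l *s \<eta> + \<zeta>" by (simp add: \<zeta>)
        then show ?thesis using w\<eta> w\<zeta> by (simp only: scalar_product_add_left scalar_product_scale_left) simp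
      qed
      have e: "absval e \<le> real (residue_order TYPE('f)) powi j"
      proof -
        have "absval (t - l) \<le> real (residue_order TYPE('f)) powi j * vec_norm \<zeta>"
          using t V.nrm_lev[OF z] residue_order_gt_1[where 'f='f] by (simp add: F.bl_def s_def power_int_add)
        then show ?thesis using z by (simp add: e_def absval_divide i'(2) divide_le_eq order.strict_iff_order)
      qed
      have "absval (\<eta> $ i') \<le> absval (\<eta> $ i)" unfolding i(2) by (rule vec_norm_nth)
      then have "absval (\<eta> $ i' / \<eta> $ i) \<le> 1" using i(1) by (simp add: absval_divide divide_le_eq order.strict_iff_order)
      then have "absval (e * (\<eta> $ i' / \<eta> $ i)) \<le> absval e"
        unfolding absval_mult by (intro mult_left_le) simp_all
      then have "absval (e * (\<eta> $ i' / \<eta> $ i)) \<le> real (residue_order TYPE('f)) powi j" using e by linarith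
      then have w: "vec_norm w \<le> real (residue_order TYPE('f)) powi j"
        unfolding w_def using e by (intro V.nrm_diff_le) (simp_all only: vec_norm_axis)
      have "(+) w ` (Y l \<inter> ?H) = Y t \<inter> ?H"
      proof (intro equalityI subsetI)
        fix x assume "x \<in> (+) w ` (Y l \<inter> ?H)"
        then obtain v where v: "x = w + v" "v \<in> V.bl j 0" "scalar_product \<xi> v \<in> F.bl r l" "v \<in> ?H" by (auto simp: Y_def)
        have "x \<in> V.bl j 0" using v w by (auto simp: V.bl_def intro: V.nrm_add_le)
        moreover have "scalar_product \<xi> x \<in> F.bl r t" using v(3) by (simp add: v(1) scalar_product_add w\<xi> F.bl_def)
        moreover have "x \<in> ?H" using v(4) by (simp add: v(1) hyperplane_def scalar_product_add w\<eta>)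
        ultimately show "x \<in> Y t \<inter> ?H" by (simp add: Y_def)
      next
        fix x assume "x \<in> Y t \<inter> ?H"
        then have v: "x \<in> V.bl j 0" "scalar_product \<xi> x \<in> F.bl r t" "x \<in> ?H" by (auto simp: Y_def)
        have "x - w \<in> V.bl j 0" using v w by (auto simp: V.bl_def intro: V.nrm_diff_le)
        moreover have "scalar_product \<xi> (x - w) \<in> F.bl r l" using v(2) by (simp add: scalar_product_diff w\<xi> F.bl_def algebra_simps)
        moreover have "x - w \<in> ?H" using v(3) by (simp add: hyperplane_def scalar_product_diff w\<eta>)
        ultimately have "x - w \<in> Y l \<inter> ?H" by (simp add: Y_def)
        moreover have "x = w + (x - w)" by simp
        ultimately show "x \<in> (+) w ` (Y l \<inter> ?H)" by (rule rev_image_eqI)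
      qed
      then show ?thesis using hyperplane_measure_translate[OF \<eta> Y_co[of l], of w] by simp
    qed
    have slice: "hyperplane_integral \<eta> 1 (\<lambda>x. if x \<in> V.bl j 0 then g (scalar_product \<xi> x) else 0) = (\<Sum>t\<in>T. g t) * y"
      if g: "\<And>u v. u \<in> F.bl r v \<Longrightarrow> g u = g v" for g :: "'f \<Rightarrow> 'e"
    proof -
      have "hyperplane_integral \<eta> 1 (\<lambda>x. if x \<in> V.bl j 0 then g (scalar_product \<xi> x) else 0) =
        hyperplane_integral \<eta> 1 (\<lambda>x. \<Sum>t\<in>T. g t * (if x \<in> Y t then 1 else 0))"
      proof (rule hyperplane_integral_cong)
        fix x assume x: "x \<in> ?H"
        show "(if x \<in> V.bl j 0 then g (scalar_product \<xi> x) else 0) = (\<Sum>t\<in>T. g t * (if x \<in> Y t then 1 else 0))"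
        proof (cases "x \<in> V.bl j 0")
          case True
          then have "scalar_product \<xi> x \<in> F.bl s l" using spH[OF x _ z] by (simp add: s_def)
          then obtain t where t: "t \<in> T" "scalar_product \<xi> x \<in> F.bl r t" using T(5) by blast
          then show ?thesis using F.sum_transversal[OF T(1,3) t, of g] g[OF t(2)] True by (simp add: Y_def)
        next
          case False
          then have "(\<Sum>t\<in>T. g t * (if x \<in> Y t then 1 else 0)) = 0" by (intro sum.neutral) (simp add: Y_def)
          then show ?thesis using False by simp
        qed
      qed
      also have "\<dots> = (\<Sum>t\<in>T. g t * hyperplane_integral \<eta> 1 (\<lambda>x. if x \<in> Y t then 1 else 0))"
        by (rule hyperplane_integral_sum[OF \<eta> T(1) Y_schwartz])
      also have "\<dots> = (\<Sum>t\<in>T. g t * y)"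
      proof (rule sum.cong[OF refl])
        fix t assume "t \<in> T"
        then have "t \<in> F.bl s l" using T(2) by blast
        then show "g t * hyperplane_integral \<eta> 1 (\<lambda>x. if x \<in> Y t then 1 else 0) = g t * y"
          by (simp only: hyperplane_integral_indicator[OF \<eta> Y_co] shift y_def mult_1)
      qed
      finally show ?thesis by (simp add: sum_distrib_right)
    qed
    \<comment> \<open>The common measure \<open>y\<close> is never computed; integrating the
      constant 1 expresses the total mass through it.\<close>
    have mass: "?Q powi ((int CARD('n) - 1) * j - V.lev \<eta>) = ?Q powi (s - r) * y"
    proof -
      have "hyperplane_integral \<eta> 1 (\<lambda>x. if x \<in> V.bl j 0 then 1 else 0 :: 'e) = (\<Sum>t\<in>T. 1) * y"
        by (rule slice) simp
      then show ?thesis using cardT by (simp add: hyperplane_integral_ball_0[OF \<eta> j])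
    qed
    \<comment> \<open>The mean over the large ball is the average of the means over its
      \<open>card T\<close> subballs.\<close>
    have "(\<Sum>t\<in>T. functional_mean \<gamma> r t) = ?Q powi (s - r) * functional_mean \<gamma> s l"
    proof -
      have "(if u \<in> F.bl s l then 1 else 0) = (\<Sum>t\<in>T. 1 * (if u \<in> F.bl r t then 1 else 0 :: 'e))" for u
      proof (cases "u \<in> F.bl s l")
        case True
        then obtain t where t: "t \<in> T" "u \<in> F.bl r t" using T(5) by blast
        then show ?thesis using F.sum_transversal[OF T(1,3) t, of "\<lambda>_. 1::'e"] True by simp
      next
        case False
        have "u \<notin> F.bl r t" if "t \<in> T" for t
        proof
          assume "u \<in> F.bl r t"
          then have "u \<in> F.bl s t" using F.bl_mono[of r s t] sr by (auto simp: s_def)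
          then show False using F.bl_eq[of t s l] T(2) that False by auto
        qed
        then have "(\<Sum>t\<in>T. 1 * (if u \<in> F.bl r t then 1 else 0 :: 'e)) = 0" by (intro sum.neutral) simp
        then show ?thesis using False by simp
      qed
      then have "\<gamma> (\<lambda>u. if u \<in> F.bl s l then 1 else 0) = \<gamma> (\<lambda>u. \<Sum>t\<in>T. 1 * (if u \<in> F.bl r t then 1 else 0))" by simp
      also have "\<dots> = (\<Sum>t\<in>T. 1 * \<gamma> (\<lambda>u. if u \<in> F.bl r t then 1 else 0))"
        by (rule distribution_sum[OF \<gamma> T(1)]) (rule F.ball_schwartz)
      finally have *: "\<gamma> (\<lambda>u. if u \<in> F.bl s l then 1 else 0) = (\<Sum>t\<in>T. \<gamma> (\<lambda>u. if u \<in> F.bl r t then 1 else 0))" by simp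
      have "?Q powi (s - r) * ?Q powi (- s) = ?Q powi (- r)" using Q by (simp add: power_int_add[symmetric])
      then show ?thesis unfolding functional_mean_def * sum_distrib_left[symmetric] mult.assoc[symmetric] by simp
    qed
    then have "hyperplane_integral \<eta> 1 (\<lambda>x. if x \<in> V.bl j 0 then functional_mean \<gamma> r (scalar_product \<xi> x) else 0) =
      ?Q powi (s - r) * functional_mean \<gamma> s l * y"
      using slice[of "functional_mean \<gamma> r"] functional_mean_cong by metis
    moreover have "(if \<zeta> = 0 then r else max r (j + V.lev \<zeta>)) = s" using z sr by (simp add: s_def)
    ultimately show ?thesis unfolding mass by simp
  qed
qed


section \<open>The product of the two kernels\<close>

lemma pairing_kernel_beta_eq_0:
  assumes "CARD('n) \<ge> 2" "V.lev b + V.lev x \<ge> m"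
  shows "pairing_kernel (beta_dist CARD('n)) m b (x :: 'f::nonarch_local_field^'n::finite) = (0 :: 'e::field_char_0)"
  using beta_mean_eq_0[of "V.lev b + V.lev x - m"] assms by (simp add: pairing_kernel_def functional_mean_beta_dist)

text \<open>A sphere is a difference of two concentric balls, the form to which
  \<open>hyperplane_average\<close> applies. The innermost term has no subtraction because |x| \<ge>
  q^L.\<close>

lemma shell_decomposition:
  fixes x :: "'f::nonarch_local_field^'n::finite" and g :: "int \<Rightarrow> 'e::field_char_0"
  assumes x: "x \<noteq> 0" "L \<le> V.lev x"
  shows "(\<Sum>i\<le>I. (if x \<in> V.bl (L + int i) 0 then g (L + int i) else 0) -
      (if i = 0 then 0 else if x \<in> V.bl (L + int i - 1) 0 then g (L + int i) else 0)) =
    (if V.lev x \<le> L + int I then g (V.lev x) else 0)"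
proof -
  define k where "k = nat (V.lev x - L)"
  have lev: "V.lev x = L + int k" using x by (simp add: k_def)
  have "(\<Sum>i\<le>I. (if x \<in> V.bl (L + int i) 0 then g (L + int i) else 0) -
      (if i = 0 then 0 else if x \<in> V.bl (L + int i - 1) 0 then g (L + int i) else 0)) =
    (\<Sum>i\<le>I. if i = k then g (L + int i) else 0)"
    by (rule sum.cong) (use x(1) lev in \<open>auto simp: V.mem_bl_0\<close>)
  also have "\<dots> = (if k \<le> I then g (L + int k) else 0)" by simp
  finally show ?thesis using lev by simp
qed

text \<open>The resolution of the kernel varies with |x|, while \<open>hyperplane_average\<close>
  handles a fixed one; so each sphere becomes a difference of balls with its own resolution. Points
  with |x| < 1/|\<eta>| are not on the hyperplane, so the sum starts at level
  \<open>- V.lev \<eta>\<close>.\<close>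

lemma hyperplane_shell_sum:
  fixes \<eta> \<xi> :: "'f::nonarch_local_field^'n::finite" and \<gamma> :: "('f, 'e::field_char_0) functional"
  assumes \<gamma>: "distribution \<gamma>" and \<eta>: "\<eta> \<noteq> 0" and \<xi>: "\<xi> \<noteq> 0" and i: "\<eta> $ i \<noteq> 0" "absval (\<eta> $ i) = vec_norm \<eta>"
    and \<zeta>: "\<zeta> = \<xi> - l *s \<eta>" and l: "l = \<xi> $ i / \<eta> $ i"
    and L: "L \<le> - V.lev \<eta>" and J: "J = - V.lev \<eta> + int I"
  shows "hyperplane_integral \<eta> 1 (\<lambda>x. if x \<in> annulus L J then pairing_kernel \<gamma> m \<xi> x else 0) =
    (\<Sum>k\<le>I. let r = V.lev \<xi> - V.lev \<eta> + int k - m; j = - V.lev \<eta> + int k in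
      functional_mean \<gamma> (if \<zeta> = 0 then r else max r (j + V.lev \<zeta>)) l * of_nat (residue_order TYPE('f)) powi ((int CARD('n) - 1) * j - V.lev \<eta>) -
      (if k = 0 then 0 else functional_mean \<gamma> (if \<zeta> = 0 then r else max r (j - 1 + V.lev \<zeta>)) l *
         of_nat (residue_order TYPE('f)) powi ((int CARD('n) - 1) * (j - 1) - V.lev \<eta>)))"
proof -
  define r where "r = (\<lambda>k. V.lev \<xi> - V.lev \<eta> + int k - m)"
  define j where "j = (\<lambda>k. - V.lev \<eta> + int k)"
  \<comment> \<open>\<open>True\<close> stands for the outer ball of the \<open>k\<close>-th sphere
    and \<open>False\<close> for the inner one, both with the resolution belonging to that
    sphere.\<close>
  define W where "W = (\<lambda>k b x. if x \<in> V.bl (if b then j k else j k - 1) 0 then functional_mean \<gamma> (r k) (scalar_product \<xi> x) else 0)"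
  define c :: "nat \<Rightarrow> bool \<Rightarrow> 'e" where "c = (\<lambda>k b. if b then 1 else if k = 0 then 0 else - 1 :: 'e)"
  have W_schwartz: "W k b \<in> V.schwartz UNIV" for k b
    unfolding W_def by (rule scalar_product_slice_schwartz[OF \<xi> functional_mean_cong])
  have "hyperplane_integral \<eta> 1 (\<lambda>x. if x \<in> annulus L J then pairing_kernel \<gamma> m \<xi> x else 0) =
    hyperplane_integral \<eta> 1 (\<lambda>x. \<Sum>p\<in>{..I} \<times> (UNIV :: bool set). c (fst p) (snd p) * W (fst p) (snd p) x)"
  proof (rule hyperplane_integral_cong)
    fix x assume "x \<in> hyperplane \<eta> 1"
    then have x: "x \<noteq> 0" "- V.lev \<eta> \<le> V.lev x" using lev_on_hyperplane \<eta> by blast+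
    have "(\<Sum>p\<in>{..I} \<times> (UNIV :: bool set). c (fst p) (snd p) * W (fst p) (snd p) x) = (\<Sum>k\<le>I. \<Sum>b\<in>UNIV. c k b * W k b x)"
      by (simp add: sum.cartesian_product case_prod_beta)
    also have "\<dots> = (\<Sum>k\<le>I. (if x \<in> V.bl (j k) 0 then functional_mean \<gamma> (V.lev \<xi> + j k - m) (scalar_product \<xi> x) else 0) -
      (if k = 0 then 0 else if x \<in> V.bl (j k - 1) 0 then functional_mean \<gamma> (V.lev \<xi> + j k - m) (scalar_product \<xi> x) else 0))"
      by (intro sum.cong refl) (auto simp: UNIV_bool c_def W_def r_def j_def algebra_simps)
    also have "\<dots> = (if V.lev x \<le> - V.lev \<eta> + int I then functional_mean \<gamma> (V.lev \<xi> + V.lev x - m) (scalar_product \<xi> x) else 0)"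
      unfolding j_def by (rule shell_decomposition[OF x])
    also have "\<dots> = (if x \<in> annulus L J then pairing_kernel \<gamma> m \<xi> x else 0)"
      using x L J by (auto simp: annulus_def pairing_kernel_def)
    finally show "(if x \<in> annulus L J then pairing_kernel \<gamma> m \<xi> x else 0) =
      (\<Sum>p\<in>{..I} \<times> (UNIV :: bool set). c (fst p) (snd p) * W (fst p) (snd p) x)" by simp
  qed
  also have "\<dots> = (\<Sum>p\<in>{..I} \<times> (UNIV :: bool set). c (fst p) (snd p) * hyperplane_integral \<eta> 1 (W (fst p) (snd p)))"
    by (rule hyperplane_integral_sum[OF \<eta>]) (auto simp: W_schwartz)
  also have "\<dots> = (\<Sum>k\<le>I. \<Sum>b\<in>UNIV. c k b * hyperplane_integral \<eta> 1 (W k b))"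
    by (simp add: sum.cartesian_product case_prod_beta)
  also have "\<dots> = (\<Sum>k\<le>I. hyperplane_integral \<eta> 1 (W k True) - (if k = 0 then 0 else hyperplane_integral \<eta> 1 (W k False)))"
    by (intro sum.cong refl) (auto simp: UNIV_bool c_def)
  also have "\<dots> = (\<Sum>k\<le>I.
      functional_mean \<gamma> (if \<zeta> = 0 then r k else max (r k) (j k + V.lev \<zeta>)) l * of_nat (residue_order TYPE('f)) powi ((int CARD('n) - 1) * j k - V.lev \<eta>) -
      (if k = 0 then 0 else functional_mean \<gamma> (if \<zeta> = 0 then r k else max (r k) (j k - 1 + V.lev \<zeta>)) l *
         of_nat (residue_order TYPE('f)) powi ((int CARD('n) - 1) * (j k - 1) - V.lev \<eta>)))"
  proof (intro sum.cong refl arg_cong2[where f="(-)"])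
    fix k
    show "hyperplane_integral \<eta> 1 (W k True) = functional_mean \<gamma> (if \<zeta> = 0 then r k else max (r k) (j k + V.lev \<zeta>)) l *
       of_nat (residue_order TYPE('f)) powi ((int CARD('n) - 1) * j k - V.lev \<eta>)"
      unfolding W_def if_True by (rule hyperplane_average[OF \<gamma> \<eta> i _ \<zeta> l]) (simp add: j_def)
    have "hyperplane_integral \<eta> 1 (W k False) = functional_mean \<gamma> (if \<zeta> = 0 then r k else max (r k) (j k - 1 + V.lev \<zeta>)) l *
         of_nat (residue_order TYPE('f)) powi ((int CARD('n) - 1) * (j k - 1) - V.lev \<eta>)" if "k \<noteq> 0"
      unfolding W_def if_False by (rule hyperplane_average[OF \<gamma> \<eta> i _ \<zeta> l]) (use that in \<open>simp add: j_def\<close>)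
    then show "(if k = 0 then 0 else hyperplane_integral \<eta> 1 (W k False)) =
      (if k = 0 then 0 else functional_mean \<gamma> (if \<zeta> = 0 then r k else max (r k) (j k - 1 + V.lev \<zeta>)) l *
         of_nat (residue_order TYPE('f)) powi ((int CARD('n) - 1) * (j k - 1) - V.lev \<eta>))" by simp
  qed
  finally show ?thesis unfolding Let_def r_def j_def .
qed

lemma telescope_shells:
  fixes Z :: "nat \<Rightarrow> 'e::ab_group_add"
  shows "(\<Sum>k\<le>I. Z k - (if k = 0 then 0 else Z (k - 1))) = Z I"
  by (induction I) auto

text \<open>The distance \<open>\<zeta>\<close> of \<open>\<xi>\<close> from the line of
  \<open>\<eta>\<close> is compared with q^-m |\<xi>|. The bounds on \<open>J\<close> let the shells
  run far enough: for \<open>sum_beta_mean\<close> in the near case, and in the far case for the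
  last mean to be over a ball of radius at least 1.\<close>

lemma hyperplane_integral_beta_kernel:
  fixes \<eta> \<xi> :: "'f::nonarch_local_field^'n::finite"
  assumes n: "CARD('n) \<ge> 2" and m: "m \<ge> 1" and \<eta>: "\<eta> \<noteq> 0" and \<xi>: "\<xi> \<noteq> 0"
    and L: "L \<le> - V.lev \<eta>" and J: "J \<ge> m - 1 - V.lev \<eta>" "J \<ge> m - 1 - V.lev \<xi>"
  shows "hyperplane_integral \<eta> 1 (\<lambda>x. if x \<in> annulus L J then pairing_kernel (beta_dist CARD('n)) m \<xi> x else 0 :: 'e::field_char_0) =
    (if \<xi> \<in> hom_class m \<eta> then of_nat (residue_order TYPE('f)) powi (int CARD('n) * (m - V.lev \<eta>)) else 0)"
proof -
  let ?Q = "of_nat (residue_order TYPE('f)) :: 'e"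
  let ?q = "real (residue_order TYPE('f))"
  let ?n = "CARD('n)"
  have Q: "?Q \<noteq> 0" by (rule of_nat_residue_order)
  have q: "?q > 1" using residue_order_gt_1[where 'f='f] by simp
  note \<gamma> = distribution_beta_dist[OF n, where 'f='f and 'e='e]
  obtain i where i: "\<eta> $ i \<noteq> 0" "absval (\<eta> $ i) = vec_norm \<eta>" using ex_max_coordinate[OF \<eta>] by metis
  define l where "l = \<xi> $ i / \<eta> $ i"
  define \<zeta> where "\<zeta> = \<xi> - l *s \<eta>"
  define I where "I = nat (J + V.lev \<eta>)"
  have JI: "J = - V.lev \<eta> + int I" using J m by (simp add: I_def)
  note sum = hyperplane_shell_sum[OF \<gamma> \<eta> \<xi> i \<zeta>_def l_def L JI, of m]
  have diff: "\<xi> - \<eta> = (l - 1) *s \<eta> + \<zeta>" by (simp add: \<zeta>_def vec_eq_iff algebra_simps)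
  have l1: "absval (l - 1) * vec_norm \<eta> = absval ((\<xi> - \<eta>) $ i)"
  proof -
    have "l - 1 = (\<xi> - \<eta>) $ i / \<eta> $ i" using i(1) by (simp add: l_def diff_divide_distrib)
    then show ?thesis using i \<eta> by (simp add: absval_divide)
  qed
  have class_iff: "\<xi> \<in> hom_class m \<eta> \<longleftrightarrow> vec_norm (\<xi> - \<eta>) \<le> ?q powi (V.lev \<eta> - m)"
    by (simp add: hom_class_def V.bl_def)
  show ?thesis
  proof (cases "\<zeta> = 0 \<or> V.lev \<zeta> \<le> V.lev \<xi> - m")
    case True
    have \<zeta>_le: "vec_norm \<zeta> \<le> ?q powi (V.lev \<xi> - m)"
      using True V.nrm_lev[of \<zeta>] by (cases "\<zeta> = 0") (auto simp: less_imp_le)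
    also have "\<dots> < vec_norm \<xi>" using V.nrm_lev[OF \<xi>] m by simp
    finally have "vec_norm (l *s \<eta>) = vec_norm \<xi>"
      using V.nrm_eq_if_close[of "l *s \<eta>" \<xi>] V.nrm_diff_commute[of "l *s \<eta>" \<xi>] by (simp add: \<zeta>_def)
    then have "absval l * ?q powi V.lev \<eta> = ?q powi V.lev \<xi>"
      by (simp add: vec_norm_scale V.nrm_lev[OF \<eta>] V.nrm_lev[OF \<xi>])
    then have absl: "absval l = ?q powi (V.lev \<xi> - V.lev \<eta>)" using q by (simp add: power_int_diff field_simps)
    then have l0: "l \<noteq> 0" using q by auto
    have levl: "F.lev l = V.lev \<xi> - V.lev \<eta>" using absl by (rule F.lev_eqI)
    \<comment> \<open>\<open>\<zeta>\<close> never exceeds the resolution, so both balls of a sphere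
      give the same mean, centred at \<open>l\<close>; only the masses differ, and their difference
      is a shell mass.\<close>
    have "hyperplane_integral \<eta> 1 (\<lambda>x. if x \<in> annulus L J then pairing_kernel (beta_dist ?n) m \<xi> x else 0) =
      (\<Sum>k\<le>I. ?Q powi (- (int ?n * V.lev \<eta>)) * (shell_mass ?Q ?n k * beta_mean ?n (F.lev l - m + int k) l))"
      unfolding sum Let_def
    proof (rule sum.cong[OF refl])
      fix k
      define r where "r = V.lev \<xi> - V.lev \<eta> + int k - m"
      have "(if \<zeta> = 0 then r else max r (- V.lev \<eta> + int k + V.lev \<zeta>)) = r"
        "(if \<zeta> = 0 then r else max r (- V.lev \<eta> + int k - 1 + V.lev \<zeta>)) = r"
        using True by (auto simp: r_def)
      moreover have "functional_mean (beta_dist ?n) r l = (beta_mean ?n (F.lev l - m + int k) l :: 'e)"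
        by (simp add: functional_mean_beta_dist[OF n] levl r_def algebra_simps)
      moreover have "?Q powi ((int ?n - 1) * (- V.lev \<eta> + k') - V.lev \<eta>) = ?Q powi (- (int ?n * V.lev \<eta>)) * ?Q powi ((int ?n - 1) * k')" for k'
      proof -
        have e: "(int ?n - 1) * (- V.lev \<eta> + k') - V.lev \<eta> = - (int ?n * V.lev \<eta>) + (int ?n - 1) * k'" by (simp add: algebra_simps)
        show ?thesis unfolding e using Q by (intro power_int_add) simp
      qed
      from this[of "int k"] this[of "int k - 1"]
      have "?Q powi ((int ?n - 1) * (- V.lev \<eta> + int k) - V.lev \<eta>) = ?Q powi (- (int ?n * V.lev \<eta>)) * ?Q powi ((int ?n - 1) * int k)"
        "?Q powi ((int ?n - 1) * (- V.lev \<eta> + int k - 1) - V.lev \<eta>) = ?Q powi (- (int ?n * V.lev \<eta>)) * ?Q powi ((int ?n - 1) * (int k - 1))"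
        by (simp_all only: add_diff_eq)
      ultimately show "functional_mean (beta_dist ?n) (if \<zeta> = 0 then V.lev \<xi> - V.lev \<eta> + int k - m else max (V.lev \<xi> - V.lev \<eta> + int k - m) (- V.lev \<eta> + int k + V.lev \<zeta>)) l *
          ?Q powi ((int ?n - 1) * (- V.lev \<eta> + int k) - V.lev \<eta>) -
        (if k = 0 then 0 else functional_mean (beta_dist ?n) (if \<zeta> = 0 then V.lev \<xi> - V.lev \<eta> + int k - m else max (V.lev \<xi> - V.lev \<eta> + int k - m) (- V.lev \<eta> + int k - 1 + V.lev \<zeta>)) l *
          ?Q powi ((int ?n - 1) * (- V.lev \<eta> + int k - 1) - V.lev \<eta>)) =
        ?Q powi (- (int ?n * V.lev \<eta>)) * (shell_mass ?Q ?n k * beta_mean ?n (F.lev l - m + int k) l)"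
        unfolding r_def[symmetric] shell_mass_def by (simp add: left_diff_distrib right_diff_distrib mult_ac)
    qed
    also have "\<dots> = ?Q powi (- (int ?n * V.lev \<eta>)) * (if l \<in> F.bl (- m) 1 then ?Q powi (int ?n * m) else 0)"
      using JI J levl by (subst sum_distrib_left[symmetric], subst sum_beta_mean[OF n l0 m]) auto
    also have "\<dots> = (if l \<in> F.bl (- m) 1 then ?Q powi (int ?n * (m - V.lev \<eta>)) else 0)"
      using Q by (simp add: power_int_add[symmetric] algebra_simps)
    \<comment> \<open>As \<open>\<zeta>\<close> is below the resolution, only the component of
      \<open>\<xi>\<close> along \<open>\<eta>\<close> decides.\<close>
    also have "l \<in> F.bl (- m) 1 \<longleftrightarrow> \<xi> \<in> hom_class m \<eta>"
    proof
      assume "l \<in> F.bl (- m) 1"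
      then have l1': "absval (l - 1) \<le> ?q powi (- m)" by (simp add: F.bl_def)
      also have "\<dots> < ?q powi 0" using m by (simp only: F.powi_less_iff)
      finally have "absval l = 1" using F.nrm_eq_if_close[of l 1] by simp
      then have "?q powi (V.lev \<xi> - V.lev \<eta>) = ?q powi 0" using absl by simp
      then have lev: "V.lev \<xi> = V.lev \<eta>" by (simp only: F.powi_eq_iff)
      have "vec_norm ((l - 1) *s \<eta>) \<le> ?q powi (- m) * ?q powi V.lev \<eta>"
        unfolding vec_norm_scale V.nrm_lev[OF \<eta>] using l1' by (intro mult_right_mono) simp_all
      also have "\<dots> = ?q powi (V.lev \<eta> - m)" using q by (simp add: power_int_add[symmetric])
      finally show "\<xi> \<in> hom_class m \<eta>" unfolding class_iff diff using \<zeta>_le lev by (intro V.nrm_add_le) auto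
    next
      assume c: "\<xi> \<in> hom_class m \<eta>"
      then have "absval (l - 1) * vec_norm \<eta> \<le> ?q powi (V.lev \<eta> - m)"
        unfolding l1 class_iff using vec_norm_nth[of "\<xi> - \<eta>" i] by linarith
      also have "\<dots> = ?q powi (- m) * vec_norm \<eta>" using q by (simp add: V.nrm_lev[OF \<eta>] power_int_add[symmetric])
      finally have "absval (l - 1) \<le> ?q powi (- m)" using V.nrm_lev[OF \<eta>] q by simp
      then show "l \<in> F.bl (- m) 1" by (simp add: F.bl_def)
    qed
    finally show ?thesis .
  next
    case False
    then have z: "\<zeta> \<noteq> 0" "V.lev \<zeta> \<ge> V.lev \<xi> - m + 1" by auto
    \<comment> \<open>Now the spread always dominates: as the level of \<open>\<zeta>\<close> is at
      least one above the resolution, the inner ball of each sphere gives exactly the term of the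
      outer ball of the preceding one.\<close>
    define Z where "Z = (\<lambda>k. functional_mean (beta_dist ?n) (- V.lev \<eta> + int k + V.lev \<zeta>) l * ?Q powi ((int ?n - 1) * (- V.lev \<eta> + int k) - V.lev \<eta>))"
    have "hyperplane_integral \<eta> 1 (\<lambda>x. if x \<in> annulus L J then pairing_kernel (beta_dist ?n) m \<xi> x else 0) =
      (\<Sum>k\<le>I. Z k - (if k = 0 then 0 else Z (k - 1)))"
      unfolding sum Let_def Z_def using z by (intro sum.cong refl) (auto simp: max_def of_nat_diff algebra_simps)
    also have "\<dots> = Z I" by (rule telescope_shells)
    \<comment> \<open>The last radius exponent is J + lev \<zeta> \<ge> (m - 1 - lev \<xi>) + (lev
      \<xi> - m + 1) = 0.\<close>
    also have "Z I = 0"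
      using beta_mean_eq_0[of "- V.lev \<eta> + int I + V.lev \<zeta>" ?n l, where 'e='e] J(2) z(2) unfolding JI Z_def functional_mean_beta_dist[OF n] by simp
    finally have "hyperplane_integral \<eta> 1 (\<lambda>x. if x \<in> annulus L J then pairing_kernel (beta_dist ?n) m \<xi> x else 0 :: 'e) = 0" .
    moreover have "\<xi> \<notin> hom_class m \<eta>"
    proof
      assume c: "\<xi> \<in> hom_class m \<eta>"
      then have lev: "V.lev \<xi> = V.lev \<eta>" using hom_class_lev(2)[OF m \<eta>] by blast
      have "vec_norm ((l - 1) *s \<eta>) \<le> ?q powi (V.lev \<eta> - m)"
        using c vec_norm_nth[of "\<xi> - \<eta>" i] unfolding class_iff vec_norm_scale l1 by linarith
      moreover have "\<zeta> = (\<xi> - \<eta>) - (l - 1) *s \<eta>" unfolding diff by simp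
      ultimately have "vec_norm \<zeta> \<le> ?q powi (V.lev \<eta> - m)" using c unfolding class_iff by (simp only:) (rule V.nrm_diff_le)
      then show False using z lev by (simp add: V.nrm_lev[OF z(1)])
    qed
    ultimately show ?thesis by simp
  qed
qed

lemma pairing_kernel_product:
  fixes \<eta> \<xi> :: "'f::nonarch_local_field^'n::finite"
  assumes n: "CARD('n) \<ge> 2" and m: "m \<ge> 1" and \<eta>: "\<eta> \<noteq> 0" and \<xi>: "\<xi> \<noteq> 0"
    and L: "L \<le> - V.lev \<eta>" and J: "J \<ge> m - 1 - V.lev \<xi>" and T: "class_reps m L J T"
  shows "(\<Sum>x\<in>T. class_vol m x * pairing_kernel eval_one m x \<eta> * pairing_kernel (beta_dist CARD('n)) m \<xi> x) =
    (if \<xi> \<in> hom_class m \<eta> then of_nat (residue_order TYPE('f)) powi (int CARD('n) * (m - V.lev \<eta>)) else 0 :: 'e::field_char_0)"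
proof -
  \<comment> \<open>Beyond \<open>J\<close> the kernel of \<beta> at \<open>\<xi>\<close> vanishes,
    so the annulus may be enlarged until the bound in terms of \<open>\<eta>\<close> holds as
    well.\<close>
  define J' where "J' = max J (m - 1 - V.lev \<eta>)"
  have "(\<Sum>x\<in>T. class_vol m x * pairing_kernel eval_one m x \<eta> * pairing_kernel (beta_dist CARD('n)) m \<xi> x) =
     (\<Sum>x\<in>T. class_vol m x * pairing_kernel (beta_dist CARD('n)) m \<xi> x * pairing_kernel eval_one m x \<eta> :: 'e)"
    by (intro sum.cong) (simp_all add: mult_ac)
  also have "\<dots> = eval_one (\<lambda>s. hyperplane_integral \<eta> s (\<lambda>x. if x \<in> annulus L J then pairing_kernel (beta_dist CARD('n)) m \<xi> x else 0))"
    by (rule functional_class_sum[OF distribution_eval_one \<eta> m pairing_kernel_homothety_invariant[OF m \<xi>] T, symmetric])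
  also have "\<dots> = hyperplane_integral \<eta> 1 (\<lambda>x. if x \<in> annulus L J' then pairing_kernel (beta_dist CARD('n)) m \<xi> x else 0)"
    unfolding eval_one_def
  proof (rule hyperplane_integral_cong)
    fix x
    show "(if x \<in> annulus L J then pairing_kernel (beta_dist CARD('n)) m \<xi> x else 0) =
      (if x \<in> annulus L J' then pairing_kernel (beta_dist CARD('n)) m \<xi> x else 0 :: 'e)"
    proof (cases "V.lev x \<le> J")
      case True
      then show ?thesis by (auto simp: annulus_def J'_def le_max_iff_disj)
    next
      case False
      then have "pairing_kernel (beta_dist CARD('n)) m \<xi> x = (0 :: 'e)" using J by (intro pairing_kernel_beta_eq_0[OF n]) simp
      then show ?thesis by simp
    qed
  qed
  also have "\<dots> = (if \<xi> \<in> hom_class m \<eta> then of_nat (residue_order TYPE('f)) powi (int CARD('n) * (m - V.lev \<eta>)) else 0)"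
    using J by (intro hyperplane_integral_beta_kernel[OF n m \<eta> \<xi> L]) (simp_all add: J'_def)
  finally show ?thesis .
qed

subsection \<open>The inversion formula\<close>

lemma pairing_kernel_class_cong:
  assumes "m \<ge> 1" "b \<noteq> 0" "x \<noteq> 0" "y \<in> hom_class m x"
  shows "pairing_kernel \<gamma> m b y = pairing_kernel \<gamma> m b x"
  using homothety_invariantD[OF pairing_kernel_homothety_invariant[OF assms(1,2)] assms(3) assms(4)[unfolded hom_class_def]] .

lemma class_reps_ne_0: "class_reps m L J T \<Longrightarrow> t \<in> T \<Longrightarrow> t \<noteq> 0"
  and class_reps_lev: "class_reps m L J T \<Longrightarrow> t \<in> T \<Longrightarrow> L \<le> V.lev t \<and> V.lev t \<le> J"
  by (auto simp: class_reps_def annulus_def)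

lemma class_reps_empty: "class_reps m L J T \<Longrightarrow> J < L \<Longrightarrow> T = {}"
  using class_reps_lev by force

lemma radon_0: "radon f 0 = 0"
  by (simp add: radon_def)

lemma radon_homothety_invariant:
  fixes f :: "'f::nonarch_local_field^'n::finite \<Rightarrow> 'e::field_char_0"
  assumes m: "m \<ge> 1" and f: "homothety_invariant m f" "\<And>x. f x \<noteq> 0 \<Longrightarrow> V.lev x \<le> J"
  shows "homothety_invariant m (radon f)"
  unfolding homothety_invariant_def
proof (intro allI impI)
  fix \<xi> \<xi>' :: "'f^'n" assume \<xi>: "\<xi> \<noteq> 0" and "\<xi>' \<in> V.bl (V.lev \<xi> - m) \<xi>"
  then have c: "\<xi>' \<in> hom_class m \<xi>" by (simp add: hom_class_def)
  note h = hom_class_lev[OF m \<xi> c]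
  obtain T :: "('f^'n) set" where T: "class_reps m (- V.lev \<xi>) J T" using ex_class_reps[OF m] by blast
  have "radon f \<xi>' = (\<Sum>t\<in>T. class_vol m t * f t * pairing_kernel eval_one m t \<xi>')"
    by (rule radon_class_sum[OF h(1) m f _ T]) (use h(2) in auto)
  also have "\<dots> = (\<Sum>t\<in>T. class_vol m t * f t * pairing_kernel eval_one m t \<xi>)"
    by (intro sum.cong refl) (simp add: pairing_kernel_class_cong[OF m class_reps_ne_0[OF T] \<xi> c])
  also have "\<dots> = radon f \<xi>"
    by (rule radon_class_sum[OF \<xi> m f _ T, symmetric]) auto
  finally show "radon f \<xi>' = radon f \<xi>" .
qed

text \<open>If |\<xi>| < q^-J, every point of the hyperplane has norm above q^J, outside the support
  of \<open>f\<close>; the annulus of representatives is empty.\<close>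

lemma radon_support:
  fixes f :: "'f::nonarch_local_field^'n::finite \<Rightarrow> 'e::field_char_0"
  assumes m: "m \<ge> 1" and f: "homothety_invariant m f" "\<And>x. f x \<noteq> 0 \<Longrightarrow> V.lev x \<le> J"
    and "radon f \<xi> \<noteq> 0"
  shows "- J \<le> V.lev \<xi>"
proof (rule ccontr)
  assume "\<not> - J \<le> V.lev \<xi>"
  then have J: "J < - V.lev \<xi>" by simp
  have \<xi>: "\<xi> \<noteq> 0" using assms(4) radon_0 by metis
  obtain T :: "('f^'n) set" where T: "class_reps m (- V.lev \<xi>) J T" using ex_class_reps[OF m] by blast
  have "radon f \<xi> = 0"
    using radon_class_sum[OF \<xi> m f _ T] class_reps_empty[OF T J] by simp
  then show False using assms(4) by simp
qed

lemma A_op_homothety_invariant: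
  fixes \<phi> :: "'f::nonarch_local_field^'n::finite \<Rightarrow> 'e::field_char_0"
  assumes n: "CARD('n) \<ge> 2" and m: "m \<ge> 1"
    and \<phi>: "\<phi> 0 = 0" "homothety_invariant m \<phi>" "\<And>\<xi>. \<phi> \<xi> \<noteq> 0 \<Longrightarrow> L \<le> V.lev \<xi>"
  shows "homothety_invariant m (A_op (beta_dist CARD('n)) \<phi>)"
  unfolding homothety_invariant_def
proof (intro allI impI)
  fix x y :: "'f^'n" assume x: "x \<noteq> 0" and "y \<in> V.bl (V.lev x - m) x"
  then have c: "y \<in> hom_class m x" by (simp add: hom_class_def)
  note h = hom_class_lev[OF m x c]
  define J where "J = m - 1 - V.lev x"
  obtain T :: "('f^'n) set" where T: "class_reps m L J T" using ex_class_reps[OF m] by blast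
  have "A_op (beta_dist CARD('n)) \<phi> y = (\<Sum>t\<in>T. class_vol m t * \<phi> t * pairing_kernel (beta_dist CARD('n)) m t y)"
    by (rule A_op_class_sum[OF n h(1) m \<phi> _ T]) (use h(2) in \<open>auto simp: J_def\<close>)
  also have "\<dots> = (\<Sum>t\<in>T. class_vol m t * \<phi> t * pairing_kernel (beta_dist CARD('n)) m t x)"
    by (intro sum.cong refl) (simp add: pairing_kernel_class_cong[OF m class_reps_ne_0[OF T] x c])
  also have "\<dots> = A_op (beta_dist CARD('n)) \<phi> x"
    by (rule A_op_class_sum[OF n x m \<phi> _ T, symmetric]) (auto simp: J_def)
  finally show "A_op (beta_dist CARD('n)) \<phi> y = A_op (beta_dist CARD('n)) \<phi> x" .
qed

lemma A_op_0: "A_op \<beta> \<phi> 0 = 0"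
  by (simp add: A_op_def)

text \<open>For |x| > q^(m-1-L) the cut-off m - 1 - lev x, which suffices in
  \<open>A_op_class_sum\<close>, is already below \<open>L\<close>, so no class remains.\<close>

lemma A_op_support:
  fixes \<phi> :: "'f::nonarch_local_field^'n::finite \<Rightarrow> 'e::field_char_0"
  assumes n: "CARD('n) \<ge> 2" and m: "m \<ge> 1"
    and \<phi>: "\<phi> 0 = 0" "homothety_invariant m \<phi>" "\<And>\<xi>. \<phi> \<xi> \<noteq> 0 \<Longrightarrow> L \<le> V.lev \<xi>"
    and "A_op (beta_dist CARD('n)) \<phi> x \<noteq> 0"
  shows "V.lev x \<le> m - 1 - L"
proof (rule ccontr)
  assume "\<not> V.lev x \<le> m - 1 - L"
  then have J: "m - 1 - V.lev x < L" by simp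
  have x: "x \<noteq> 0" using assms(6) A_op_0 by metis
  obtain T :: "('f^'n) set" where T: "class_reps m L (m - 1 - V.lev x) T" using ex_class_reps[OF m] by blast
  have "A_op (beta_dist CARD('n)) \<phi> x = 0"
    using A_op_class_sum[OF n x m \<phi> _ T] class_reps_empty[OF T J] by simp
  then show False using assms(6) by simp
qed

text \<open>The power of q is the inverse of \<open>class_vol m t\<close>, so this kernel acts as
  the identity on functions constant on classes.\<close>

lemma class_delta_sum:
  fixes f :: "'f::nonarch_local_field^'n::finite \<Rightarrow> 'e::field_char_0"
  assumes m: "m \<ge> 1" and f: "homothety_invariant m f" and T: "class_reps m L J T" and x: "x \<in> annulus L J"
  shows "(\<Sum>t\<in>T. class_vol m t * f t *
    (if x \<in> hom_class m t then of_nat (residue_order TYPE('f)) powi (int CARD('n) * (m - V.lev t)) else 0)) = f x"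
proof -
  have vol: "class_vol m t * of_nat (residue_order TYPE('f)) powi (int CARD('n) * (m - V.lev t)) = (1 :: 'e)" for t :: "'f^'n"
    using of_nat_residue_order(1)[where 'f='f and 'e='e]
    by (simp add: class_vol_def power_int_add[symmetric] algebra_simps)
  have "(\<Sum>t\<in>T. class_vol m t * f t *
    (if x \<in> hom_class m t then of_nat (residue_order TYPE('f)) powi (int CARD('n) * (m - V.lev t)) else 0)) =
    (\<Sum>t\<in>T. f t * (if x \<in> hom_class m t then 1 else 0))"
  proof (rule sum.cong[OF refl])
    fix t :: "'f^'n"
    have "class_vol m t * f t * of_nat (residue_order TYPE('f)) powi (int CARD('n) * (m - V.lev t)) =
      f t * (class_vol m t * of_nat (residue_order TYPE('f)) powi (int CARD('n) * (m - V.lev t)))" by (simp only: mult_ac)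
    then show "class_vol m t * f t *
      (if x \<in> hom_class m t then of_nat (residue_order TYPE('f)) powi (int CARD('n) * (m - V.lev t)) else 0) =
      f t * (if x \<in> hom_class m t then 1 else 0)" unfolding vol by simp
  qed
  also have "\<dots> = f x" using class_decompose[OF m f T, of x] x by simp
  finally show ?thesis .
qed

lemma hom_class_sym:
  assumes "m \<ge> 1" "x \<noteq> 0" "y \<noteq> 0" shows "x \<in> hom_class m y \<longleftrightarrow> y \<in> hom_class m x"
  using hom_class_lev(3)[OF assms(1)] assms(2,3) hom_class_refl by metis

lemma radon_A_op:
  fixes \<phi> :: "'f::nonarch_local_field^'n::finite \<Rightarrow> 'e::field_char_0"
  assumes n: "CARD('n) \<ge> 2" and m: "m \<ge> 1"
    and \<phi>: "\<phi> 0 = 0" "homothety_invariant m \<phi>" "\<And>\<xi>. \<phi> \<xi> \<noteq> 0 \<Longrightarrow> L \<le> V.lev \<xi>"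
  shows "radon (A_op (beta_dist CARD('n)) \<phi>) \<eta> = \<phi> \<eta>"
proof (cases "\<eta> = 0")
  case True
  then show ?thesis by (simp add: radon_0 \<phi>(1))
next
  case \<eta>: False
  let ?A = "A_op (beta_dist CARD('n)) \<phi>"
  \<comment> \<open>\<open>J\<close> bounds the support of the inner function, by
    \<open>A_op_support\<close>; \<open>J'\<close> suffices for \<open>A_op_class_sum\<close> at
    every \<open>x\<close> in \<open>T\<close>, where lev x \<ge> - lev \<eta>.\<close>
  define J where "J = m - 1 - L"
  define J' where "J' = m - 1 + V.lev \<eta>"
  obtain T :: "('f^'n) set" where T: "class_reps m (- V.lev \<eta>) J T" using ex_class_reps[OF m] by blast
  obtain T' :: "('f^'n) set" where T': "class_reps m L J' T'" using ex_class_reps[OF m] by blast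
  have "radon ?A \<eta> = (\<Sum>x\<in>T. class_vol m x * ?A x * pairing_kernel eval_one m x \<eta>)"
  proof (rule radon_class_sum[OF \<eta> m _ _ order_refl T])
    show "homothety_invariant m ?A" by (rule A_op_homothety_invariant[OF n m \<phi>])
    show "V.lev x \<le> J" if "?A x \<noteq> 0" for x unfolding J_def by (rule A_op_support[OF n m \<phi> that])
  qed
  also have "\<dots> = (\<Sum>x\<in>T. \<Sum>\<xi>\<in>T'. class_vol m \<xi> * \<phi> \<xi> * (class_vol m x * pairing_kernel eval_one m x \<eta> * pairing_kernel (beta_dist CARD('n)) m \<xi> x))"
  proof (rule sum.cong[OF refl])
    fix x assume x: "x \<in> T"
    have "?A x = (\<Sum>\<xi>\<in>T'. class_vol m \<xi> * \<phi> \<xi> * pairing_kernel (beta_dist CARD('n)) m \<xi> x)"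
      by (rule A_op_class_sum[OF n class_reps_ne_0[OF T x] m \<phi> _ T']) (use class_reps_lev[OF T x] in \<open>simp_all add: J'_def\<close>)
    then show "class_vol m x * ?A x * pairing_kernel eval_one m x \<eta> =
      (\<Sum>\<xi>\<in>T'. class_vol m \<xi> * \<phi> \<xi> * (class_vol m x * pairing_kernel eval_one m x \<eta> * pairing_kernel (beta_dist CARD('n)) m \<xi> x))"
      by (simp only: sum_distrib_left sum_distrib_right mult_ac)
  qed
  also have "\<dots> = (\<Sum>\<xi>\<in>T'. class_vol m \<xi> * \<phi> \<xi> *
      (\<Sum>x\<in>T. class_vol m x * pairing_kernel eval_one m x \<eta> * pairing_kernel (beta_dist CARD('n)) m \<xi> x))"
    unfolding sum_distrib_left by (rule sum.swap)
  also have "\<dots> = (\<Sum>\<xi>\<in>T'. class_vol m \<xi> * \<phi> \<xi> *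
      (if \<eta> \<in> hom_class m \<xi> then of_nat (residue_order TYPE('f)) powi (int CARD('n) * (m - V.lev \<xi>)) else 0))"
  proof (rule sum.cong[OF refl])
    fix \<xi> assume \<xi>: "\<xi> \<in> T'"
    note \<xi>0 = class_reps_ne_0[OF T' \<xi>]
    have J: "m - 1 - V.lev \<xi> \<le> J" using class_reps_lev[OF T' \<xi>] by (simp add: J_def)
    \<comment> \<open>The kernel formula is in terms of \<open>\<eta>\<close>, the remaining sum in
      terms of \<open>\<xi>\<close>: within a class the levels agree and membership is
      symmetric.\<close>
    have "V.lev \<xi> = V.lev \<eta>" if "\<xi> \<in> hom_class m \<eta>" using hom_class_lev(2)[OF m \<eta> that] .
    then show "class_vol m \<xi> * \<phi> \<xi> * (\<Sum>x\<in>T. class_vol m x * pairing_kernel eval_one m x \<eta> * pairing_kernel (beta_dist CARD('n)) m \<xi> x) =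
      class_vol m \<xi> * \<phi> \<xi> *
      (if \<eta> \<in> hom_class m \<xi> then of_nat (residue_order TYPE('f)) powi (int CARD('n) * (m - V.lev \<xi>)) else 0)"
      unfolding pairing_kernel_product[OF n m \<eta> \<xi>0 order_refl J T] hom_class_sym[OF m \<eta> \<xi>0] by simp
  qed
  also have "\<dots> = \<phi> \<eta>"
  proof (cases "\<eta> \<in> annulus L J'")
    case True
    then show ?thesis by (rule class_delta_sum[OF m \<phi>(2) T'])
  next
    case False
    then have "\<phi> \<eta> = 0" using \<phi>(3)[of \<eta>] \<eta> m by (auto simp: annulus_def J'_def)
    moreover have "\<eta> \<notin> hom_class m \<xi>" if "\<xi> \<in> T'" for \<xi>
      using hom_class_annulus[OF m, of \<eta> \<xi> L J'] T' that False unfolding class_reps_def by blast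
    ultimately show ?thesis by (simp add: sum.neutral)
  qed
  finally show ?thesis .
qed

lemma A_op_radon:
  fixes f :: "'f::nonarch_local_field^'n::finite \<Rightarrow> 'e::field_char_0"
  assumes n: "CARD('n) \<ge> 2" and m: "m \<ge> 1"
    and f: "f 0 = 0" "homothety_invariant m f" "\<And>x. f x \<noteq> 0 \<Longrightarrow> V.lev x \<le> N"
  shows "A_op (beta_dist CARD('n)) (radon f) y = f y"
proof (cases "y = 0")
  case True
  then show ?thesis by (simp add: A_op_0 f(1))
next
  case y: False
  \<comment> \<open>Beyond the first bound the kernel of \<beta> at \<open>y\<close> vanishes; the
    second places \<open>y\<close> above the lower end of the annulus of \<open>T'\<close>.\<close>
  define J where "J = max (m - 1 - V.lev y) (- V.lev y)"
  obtain T :: "('f^'n) set" where T: "class_reps m (- N) J T" using ex_class_reps[OF m] by blast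
  obtain T' :: "('f^'n) set" where T': "class_reps m (- J) N T'" using ex_class_reps[OF m] by blast
  have "A_op (beta_dist CARD('n)) (radon f) y = (\<Sum>\<xi>\<in>T. class_vol m \<xi> * radon f \<xi> * pairing_kernel (beta_dist CARD('n)) m \<xi> y)"
  proof (rule A_op_class_sum[where \<phi>="radon f", OF n y m radon_0 _ _ _ T])
    show "homothety_invariant m (radon f)" by (rule radon_homothety_invariant[OF m f(2,3)])
    show "- N \<le> V.lev \<xi>" if "radon f \<xi> \<noteq> 0" for \<xi> by (rule radon_support[OF m f(2,3) that])
  qed (simp add: J_def)
  \<comment> \<open>Both kernels are transposed here, which brings the composition into the order
    treated by \<open>pairing_kernel_product\<close>.\<close>
  also have "\<dots> = (\<Sum>\<xi>\<in>T. \<Sum>x\<in>T'. class_vol m x * f x * (class_vol m \<xi> * pairing_kernel eval_one m \<xi> x * pairing_kernel (beta_dist CARD('n)) m y \<xi>))"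
  proof (rule sum.cong[OF refl])
    fix \<xi> assume \<xi>: "\<xi> \<in> T"
    have "radon f \<xi> = (\<Sum>x\<in>T'. class_vol m x * f x * pairing_kernel eval_one m x \<xi>)"
      by (rule radon_class_sum[OF class_reps_ne_0[OF T \<xi>] m f(2,3) _ T']) (use class_reps_lev[OF T \<xi>] in simp_all)
    then show "class_vol m \<xi> * radon f \<xi> * pairing_kernel (beta_dist CARD('n)) m \<xi> y =
      (\<Sum>x\<in>T'. class_vol m x * f x * (class_vol m \<xi> * pairing_kernel eval_one m \<xi> x * pairing_kernel (beta_dist CARD('n)) m y \<xi>))"
      by (simp only: pairing_kernel_commute[of _ m \<xi>] sum_distrib_left sum_distrib_right mult_ac)
  qed
  also have "\<dots> = (\<Sum>x\<in>T'. class_vol m x * f x *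
      (\<Sum>\<xi>\<in>T. class_vol m \<xi> * pairing_kernel eval_one m \<xi> x * pairing_kernel (beta_dist CARD('n)) m y \<xi>))"
    unfolding sum_distrib_left by (rule sum.swap)
  also have "\<dots> = (\<Sum>x\<in>T'. class_vol m x * f x *
      (if y \<in> hom_class m x then of_nat (residue_order TYPE('f)) powi (int CARD('n) * (m - V.lev x)) else 0))"
  proof (rule sum.cong[OF refl])
    fix x assume x: "x \<in> T'"
    have L: "- N \<le> - V.lev x" using class_reps_lev[OF T' x] by simp
    have J: "m - 1 - V.lev y \<le> J" by (simp add: J_def)
    show "class_vol m x * f x * (\<Sum>\<xi>\<in>T. class_vol m \<xi> * pairing_kernel eval_one m \<xi> x * pairing_kernel (beta_dist CARD('n)) m y \<xi>) =
      class_vol m x * f x *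
      (if y \<in> hom_class m x then of_nat (residue_order TYPE('f)) powi (int CARD('n) * (m - V.lev x)) else 0)"
      unfolding pairing_kernel_product[OF n m class_reps_ne_0[OF T' x] y L J T] ..
  qed
  also have "\<dots> = f y"
  proof (cases "y \<in> annulus (- J) N")
    case True
    then show ?thesis by (rule class_delta_sum[OF m f(2) T'])
  next
    case False
    then have "f y = 0" using f(3)[of y] y by (auto simp: annulus_def J_def)
    moreover have "y \<notin> hom_class m x" if "x \<in> T'" for x
      using hom_class_annulus[OF m, of y x "- J" N] T' that False unfolding class_reps_def by blast
    ultimately show ?thesis by (simp add: sum.neutral)
  qed
  finally show ?thesis .
qed

text \<open>Functions in \<open>C_plus\<close> need not be locally constant at 0, hence need not be
  test functions, and \<open>hyperplane_integral_sum\<close> does not apply to them directly. Sums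
  over classes at a common scale give linearity.\<close>

lemma radon_linear: "linear_map_on (C_plus :: ('f::nonarch_local_field^'n::finite \<Rightarrow> 'e::field_char_0) set) radon fun_scale"
  unfolding linear_map_on_def
proof (intro conjI ballI allI)
  fix f g :: "'f^'n \<Rightarrow> 'e" assume "f \<in> C_plus" "g \<in> C_plus"
  then obtain m m' N N' where f: "m \<ge> 1" "homothety_invariant m f" "\<And>x. f x \<noteq> 0 \<Longrightarrow> V.lev x \<le> N"
    and g: "m' \<ge> 1" "homothety_invariant m' g" "\<And>x. g x \<noteq> 0 \<Longrightarrow> V.lev x \<le> N'"
    unfolding C_plus_iff by blast
  define l M where "l = max m m'" and "M = max N N'"
  have l: "l \<ge> 1" using f(1) by (simp add: l_def)
  have f': "homothety_invariant l f" "\<And>x. f x \<noteq> 0 \<Longrightarrow> V.lev x \<le> M"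
    using homothety_invariant_mono[OF f(2), of l] f(3) by (auto simp: l_def M_def le_max_iff_disj)
  have g': "homothety_invariant l g" "\<And>x. g x \<noteq> 0 \<Longrightarrow> V.lev x \<le> M"
    using homothety_invariant_mono[OF g(2), of l] g(3) by (auto simp: l_def M_def le_max_iff_disj)
  have fg: "homothety_invariant l (f + g)" using f'(1) g'(1) unfolding homothety_invariant_def plus_fun_def by metis
  have fg_supp: "V.lev x \<le> M" if "(f + g) x \<noteq> 0" for x
    using that f'(2)[of x] g'(2)[of x] by (cases "f x = 0") auto
  show "radon (f + g) = radon f + radon g"
  proof
    fix \<xi> :: "'f^'n"
    show "radon (f + g) \<xi> = (radon f + radon g) \<xi>"
    proof (cases "\<xi> = 0")
      case True
      then show ?thesis by (simp add: radon_0)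
    next
      case False
      obtain T :: "('f^'n) set" where T: "class_reps l (- V.lev \<xi>) M T" using ex_class_reps[OF l] by blast
      have "radon f \<xi> = (\<Sum>t\<in>T. class_vol l t * f t * pairing_kernel eval_one l t \<xi>)"
        by (rule radon_class_sum[OF False l f' order_refl T])
      moreover have "radon g \<xi> = (\<Sum>t\<in>T. class_vol l t * g t * pairing_kernel eval_one l t \<xi>)"
        by (rule radon_class_sum[OF False l g' order_refl T])
      moreover have "radon (f + g) \<xi> = (\<Sum>t\<in>T. class_vol l t * (f + g) t * pairing_kernel eval_one l t \<xi>)"
        by (rule radon_class_sum[OF False l fg fg_supp order_refl T])
      ultimately show ?thesis by (simp add: sum.distrib[symmetric] distrib_left distrib_right)
    qed
  qed
next
  fix c :: 'e and f :: "'f^'n \<Rightarrow> 'e" assume "f \<in> C_plus"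
  then obtain m N where f: "m \<ge> 1" "homothety_invariant m f" "\<And>x. f x \<noteq> 0 \<Longrightarrow> V.lev x \<le> N"
    unfolding C_plus_iff by blast
  have cf: "homothety_invariant m (fun_scale c f)" "\<And>x. fun_scale c f x \<noteq> 0 \<Longrightarrow> V.lev x \<le> N"
    using f unfolding homothety_invariant_def fun_scale_def by (metis, simp)
  show "radon (fun_scale c f) = fun_scale c (radon f)"
  proof
    fix \<xi> :: "'f^'n"
    show "radon (fun_scale c f) \<xi> = fun_scale c (radon f) \<xi>"
    proof (cases "\<xi> = 0")
      case True
      then show ?thesis by (simp add: radon_0 fun_scale_def)
    next
      case False
      obtain T :: "('f^'n) set" where T: "class_reps m (- V.lev \<xi>) N T" using ex_class_reps[OF f(1)] by blast
      have "radon f \<xi> = (\<Sum>t\<in>T. class_vol m t * f t * pairing_kernel eval_one m t \<xi>)"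
        by (rule radon_class_sum[OF False f order_refl T])
      moreover have "radon (fun_scale c f) \<xi> = (\<Sum>t\<in>T. class_vol m t * fun_scale c f t * pairing_kernel eval_one m t \<xi>)"
        by (rule radon_class_sum[OF False f(1) cf order_refl T])
      ultimately show ?thesis by (simp add: fun_scale_def sum_distrib_left mult_ac)
    qed
  qed
qed

lemma radon_C_minus: "f \<in> C_plus \<Longrightarrow> radon f \<in> (C_minus :: ('f::nonarch_local_field^'n::finite \<Rightarrow> 'e::field_char_0) set)"
  unfolding C_plus_iff C_minus_iff using radon_0 radon_homothety_invariant[of _ f] radon_support[of _ f] by blast

lemma A_op_C_plus:
  "CARD('n) \<ge> 2 \<Longrightarrow> \<phi> \<in> C_minus \<Longrightarrow> A_op (beta_dist CARD('n)) \<phi> \<in> (C_plus :: ('f::nonarch_local_field^'n::finite \<Rightarrow> 'e::field_char_0) set)"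
  unfolding C_plus_iff C_minus_iff using A_op_0 A_op_homothety_invariant[of _ \<phi>] A_op_support[of _ \<phi>] by blast

theorem theorem3p2p6:
  fixes \<beta> :: "('f::nonarch_local_field, 'e::field_char_0) functional" and q :: 'e
  assumes "CARD('n::finite) \<ge> 2"
    and "q = of_nat (residue_order TYPE('f))"
    and "\<beta> = (\<lambda>f. (1 - q ^ (CARD('n) - 1)) / (1 - q powi (- int CARD('n))) *
           (translate_by_one (norm_neg_power CARD('n)) f - norm_neg_power CARD('n) f))"
  shows "linear_map_on (C_plus :: ('f^'n \<Rightarrow> 'e) set) radon fun_scale \<and>
    bij_betw radon (C_plus :: ('f^'n \<Rightarrow> 'e) set) C_minus \<and>
    \<beta> \<in> S_b \<and> compactly_supported \<beta> \<and>
    (\<forall>\<phi>\<in>(C_minus :: ('f^'n \<Rightarrow> 'e) set). A_op \<beta> \<phi> \<in> C_plus \<and> radon (A_op \<beta> \<phi>) = \<phi>) \<and>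
    (\<forall>f\<in>(C_plus :: ('f^'n \<Rightarrow> 'e) set). A_op \<beta> (radon f) = f)"
proof -
  note n = assms(1)
  have \<beta>: "\<beta> = beta_dist CARD('n)"
    unfolding assms(2,3) by (rule ext) (simp only: beta_dist_def)
  have MA: "radon (A_op \<beta> \<phi>) = \<phi>" if \<phi>: "\<phi> \<in> C_minus" for \<phi> :: "'f^'n \<Rightarrow> 'e"
  proof -
    obtain m L where "m \<ge> 1" "\<phi> 0 = 0" "homothety_invariant m \<phi>" "\<forall>x. \<phi> x \<noteq> 0 \<longrightarrow> L \<le> V.lev x"
      using \<phi> unfolding C_minus_iff by blast
    then show ?thesis unfolding \<beta> by (intro ext radon_A_op[OF n]) auto
  qed
  have AM: "A_op \<beta> (radon f) = f" if f: "f \<in> C_plus" for f :: "'f^'n \<Rightarrow> 'e"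
  proof -
    obtain m N where "m \<ge> 1" "f 0 = 0" "homothety_invariant m f" "\<forall>x. f x \<noteq> 0 \<longrightarrow> V.lev x \<le> N"
      using f unfolding C_plus_iff by blast
    then show ?thesis unfolding \<beta> by (intro ext A_op_radon[OF n]) auto
  qed
  have A: "A_op \<beta> \<phi> \<in> C_plus" if "\<phi> \<in> C_minus" for \<phi> :: "'f^'n \<Rightarrow> 'e"
    unfolding \<beta> by (rule A_op_C_plus[OF n that])
  have "bij_betw radon (C_plus :: ('f^'n \<Rightarrow> 'e) set) C_minus"
    by (rule bij_betwI[of _ _ _ "A_op \<beta>"]) (use radon_C_minus A AM MA in auto)
  moreover have "\<beta> \<in> S_b" unfolding \<beta> by (rule beta_dist_S_b[OF n])
  moreover have "compactly_supported \<beta>" unfolding \<beta> by (rule compactly_supported_beta_dist[OF n])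
  ultimately show ?thesis using radon_linear A MA AM by blast
qed

end
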